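(* The following statements hold. (a) For each holomorphic map $f:\mathbb C^n\to\mathbb C^m$ there is a function $\mu:\mathbb Z_+\to\mathbb R_+$ such that the graph $\Gamma_f\subset\mathbb C^{n+m}$ admits the Bernstein type inequality of exponent $\mu$. (b) Let $f:\mathbb C^n\to\mathbb C^m$ be holomorphic and $\mu:\mathbb Z_+\to\mathbb R_+$. The graph $\Gamma_f$ admits the Bernstein type inequality of exponent $\mu$ if and only if for each compact nonpluripolar subset $K\subset\mathbb C^n$ there exist constants $C(K;r)$, $r>0$, such that for all $r>0$ and all holomorphic polynomials $p$ on $\mathbb C^{n+m}$ $$\max_{\|z\|\le r}|p(z,f(z))|\le C(K;r)^{\mu(\deg p)}\max_{z\in K}|p(z,f(z))|.$$ (c) If $f:\mathbb C^n\to\mathbb C^m$ is holomorphic, $\Gamma_f\subset\mathbb C^{n+m}$ is nonalgebraic and admits the Bernstein type inequality of exponent $\mu$, then $$\liminf_{k\to\infty}\frac{\mu(k)}{k^{1+\frac1n}}\ne 0.$$ (d) If $\Gamma_f\subset\mathbb C^{n+m}$ (with $f:\mathbb C^n\to\mathbb C^m$ holomorphic) admits the Bernstein type inequalities of exponents $\mu_1$ and $\mu_2$, then it admits the Bernstein type inequality of every exponent $\mu:\mathbb Z_+\to\mathbb R_+$ with $\mu\ge\min(\mu_1,\mu_2)$ pointwise. (e) If $\Gamma_f\subset\mathbb C^{n+m}$ (with $f:\mathbb C^n\to\mathbb C^m$ holomorphic) admits the Bernstein type inequality of exponent $\mu$, then for each $w\in\mathbb C^n$ the graph $\Gamma_{f_w}\subset\mathbb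 C^{n+m}$ of $f_w(z):=f(z+w)$, $z\in\mathbb C^n$, admits the Bernstein type inequality of exponent $\mu$ as well. (f) If the graphs $\Gamma_{f_i}\subset\mathbb C^{n_i+m_i}$ of holomorphic maps $f_i:\mathbb C^{n_i}\to\mathbb C^{m_i}$ admit Bernstein type inequalities of exponents $\mu_i$, $i=1,2$, then the graph $\Gamma_{f_1\times f_2}\subset\mathbb C^{n_1+n_2+m_1+m_2}$ of the map $(f_1\times f_2)(z_1,z_2):=(f_1(z_1),f_2(z_2))\in\mathbb C^{m_1+m_2}$, $z_i\in\mathbb C^{n_i}$, admits the Bernstein type inequality of exponent $\max(\mu_1,\mu_2)$. In turn, if $\Gamma_{f_1\times f_2}$ admits the Bernstein type inequality of exponent $\mu$, then each $\Gamma_{f_i}$, $i=1,2$, admits it as well.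
   Context: $\mathbb Z_+=\{0,1,2,\dots\}$, $\mathbb R_+=[0,\infty)$; $\|\cdot\|$ is the Euclidean norm. The graph of a holomorphic map $f:\mathbb C^n\to\mathbb C^m$ is $\Gamma_f=\{(z,f(z)):z\in\mathbb C^n\}\subset\mathbb C^{n+m}$. The graph $\Gamma_f$ is said to admit the Bernstein type inequality of exponent $\mu:\mathbb Z_+\to\mathbb R_+$ if for each $r>0$ there exists a nonnegative constant $C(r)$ such that for all holomorphic polynomials $p$ on $\mathbb C^{n+m}$ $$\max_{\|z\|\le er}|p(z,f(z))|\le C(r)^{\mu(\deg p)}\max_{\|z\|\le r}|p(z,f(z))|.$$ $\Gamma_f$ is algebraic if it is a complex algebraic submanifold of $\mathbb C^{n+m}$, and nonalgebraic otherwise. A subset $K\subset\mathbb C^n$ is pluripolar if there is a plurisubharmonic function $u\not\equiv-\infty$ on $\mathbb C^n$ with $u|_K=-\infty$; otherwise it is nonpluripolar. *)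

theory Defs
  imports "HOL-Analysis.Analysis" "HOL-Library.Poly_Mapping"
begin

text \<open>\<open>has_derivative\<close> is the real Frechet derivative; requiring it to be complex linear is
  complex differentiability.  (The library's \<open>holomorphic_on\<close> is for functions of one variable.)\<close>

definition holomorphic_map_on ::
  "(complex ^ 'n \<Rightarrow> complex ^ 'm) \<Rightarrow> (complex ^ 'n) set \<Rightarrow> bool"
  where "holomorphic_map_on f U \<longleftrightarrow>
    (\<forall>z\<in>U. \<exists>D. (f has_derivative D) (at z) \<and> (\<forall>c v. D (c *s v) = c *s D v))"

text \<open>\<open>\<complex>\<^sup>n\<^sup>+\<^sup>m\<close> is \<^typ>\<open>complex ^ ('n + 'm)\<close>, whose norm is the Euclidean one.\<close>

definition vec_pair :: "complex ^ 'n \<Rightarrow> complex ^ 'm \<Rightarrow> complex ^ ('n + 'm)"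
  where "vec_pair z w = (\<chi> k. case k of Inl i \<Rightarrow> z $ i | Inr j \<Rightarrow> w $ j)"

definition vec_fst :: "complex ^ ('n + 'm::finite) \<Rightarrow> complex ^ 'n"
  where "vec_fst x = (\<chi> i. x $ Inl i)"

definition vec_snd :: "complex ^ ('n::finite + 'm) \<Rightarrow> complex ^ 'm"
  where "vec_snd x = (\<chi> j. x $ Inr j)"

definition prod_map ::
  "(complex ^ 'n1 \<Rightarrow> complex ^ 'm1) \<Rightarrow> (complex ^ 'n2 \<Rightarrow> complex ^ 'm2)
    \<Rightarrow> complex ^ ('n1 + 'n2) \<Rightarrow> complex ^ ('m1 + 'm2)"
  where "prod_map f1 f2 z = vec_pair (f1 (vec_fst z)) (f2 (vec_snd z))"

definition graph_of :: "(complex ^ 'n \<Rightarrow> complex ^ 'm) \<Rightarrow> (complex ^ ('n + 'm)) set"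
  where "graph_of f = range (\<lambda>z. vec_pair z (f z))"

text \<open>Multivariate polynomials as finitely supported families of coefficients, indexed by
  multi-indices.  The zero polynomial gets degree 0.\<close>

type_synonym 'k cpoly = "('k \<Rightarrow>\<^sub>0 nat) \<Rightarrow>\<^sub>0 complex"

definition poly_eval :: "('k::finite) cpoly \<Rightarrow> complex ^ 'k \<Rightarrow> complex"
  where "poly_eval p x =
    (\<Sum>\<alpha>\<in>Poly_Mapping.keys p.
       Poly_Mapping.lookup p \<alpha> * (\<Prod>i\<in>UNIV. x $ i ^ Poly_Mapping.lookup \<alpha> i))"

definition total_degree :: "('k::finite) cpoly \<Rightarrow> nat"
  where "total_degree p =
    Max (insert 0 ((\<lambda>\<alpha>. \<Sum>i\<in>UNIV. Poly_Mapping.lookup \<alpha> i) ` Poly_Mapping.keys p))"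

text \<open>Real powers of nonnegative reals with \<open>0\<^sup>0 = 1\<close>; in the library \<open>0 powr 0 = 0\<close>.\<close>

definition rpow :: "real \<Rightarrow> real \<Rightarrow> real"
  where "rpow c s = (if s = 0 then 1 else c powr s)"

text \<open>Only used for continuous \<open>f\<close> and nonempty compact \<open>K\<close>, where the supremum is attained.\<close>

definition max_on_graph ::
  "(complex ^ 'n \<Rightarrow> complex ^ 'm) \<Rightarrow> ('n + 'm) cpoly \<Rightarrow> (complex ^ 'n) set \<Rightarrow> real"
  where "max_on_graph f p K = (SUP z\<in>K. cmod (poly_eval p (vec_pair z (f z))))"

definition admits_bernstein ::
  "(complex ^ 'n \<Rightarrow> complex ^ 'm) \<Rightarrow> (nat \<Rightarrow> real) \<Rightarrow> bool"
  where "admits_bernstein f \<mu> \<longleftrightarrow>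
    (\<forall>r>0. \<exists>C\<ge>0. \<forall>p.
       max_on_graph f p (cball 0 (exp 1 * r))
         \<le> rpow C (\<mu> (total_degree p)) * max_on_graph f p (cball 0 r))"

definition algebraic_set :: "(complex ^ 'k) set \<Rightarrow> bool"
  where "algebraic_set S \<longleftrightarrow> (\<exists>P. S = {x. \<forall>p\<in>P. poly_eval p x = 0})"

definition complex_submanifold :: "nat \<Rightarrow> (complex ^ 'k) set \<Rightarrow> bool"
  where "complex_submanifold d S \<longleftrightarrow>
    (\<forall>x\<in>S. \<exists>U V \<phi> \<psi> I.
       open U \<and> x \<in> U \<and> open V \<and> homeomorphism U V \<phi> \<psi> \<and>
       holomorphic_map_on \<phi> U \<and> holomorphic_map_on \<psi> V \<and>
       card I = d \<and> \<phi> ` (S \<inter> U) = V \<inter> {y :: complex ^ 'k. \<forall>i. i \<notin> I \<longrightarrow> y $ i = 0})"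

definition algebraic_submanifold :: "(complex ^ 'k) set \<Rightarrow> bool"
  where "algebraic_submanifold S \<longleftrightarrow> algebraic_set S \<and> (\<exists>d. complex_submanifold d S)"

definition upper_semicontinuous :: "('a::topological_space \<Rightarrow> ereal) \<Rightarrow> bool"
  where "upper_semicontinuous u \<longleftrightarrow> (\<forall>c. open {x. u x < c})"

text \<open>Mean value over a circle, in \<open>[-\<infinity>, \<infinity>)\<close> if \<open>u < \<infinity>\<close> is upper semicontinuous: \<^const>\<open>e2ennreal\<close>
  sends negative numbers to 0, so the two integrals are those of the positive and of the negative
  part of \<open>u\<close>, and the first one is finite since \<open>u\<close> is bounded above on the circle.\<close>

definition circle_mean :: "(complex \<Rightarrow> ereal) \<Rightarrow> complex \<Rightarrow> real \<Rightarrow> ereal"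
  where "circle_mean u a r =
    ereal (1 / (2 * pi)) *
      (enn2ereal (\<integral>\<^sup>+\<theta>\<in>{0..2 * pi}. e2ennreal (u (a + of_real r * cis \<theta>)) \<partial>lborel)
       - enn2ereal (\<integral>\<^sup>+\<theta>\<in>{0..2 * pi}. e2ennreal (- u (a + of_real r * cis \<theta>)) \<partial>lborel))"

text \<open>Subharmonic on all of \<open>\<complex>\<close>; the constant \<open>-\<infinity>\<close> is allowed.\<close>

definition subharmonic :: "(complex \<Rightarrow> ereal) \<Rightarrow> bool"
  where "subharmonic u \<longleftrightarrow>
    upper_semicontinuous u \<and> (\<forall>z. u z < \<infinity>) \<and> (\<forall>a. \<forall>r>0. u a \<le> circle_mean u a r)"

definition plurisubharmonic :: "(complex ^ 'n \<Rightarrow> ereal) \<Rightarrow> bool"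
  where "plurisubharmonic u \<longleftrightarrow>
    upper_semicontinuous u \<and> (\<forall>z. u z < \<infinity>) \<and>
    (\<forall>a b. subharmonic (\<lambda>\<zeta>. u (a + \<zeta> *s b)))"

definition pluripolar :: "(complex ^ 'n) set \<Rightarrow> bool"
  where "pluripolar K \<longleftrightarrow>
    (\<exists>u. plurisubharmonic u \<and> (\<exists>z. u z \<noteq> -\<infinity>) \<and> (\<forall>z\<in>K. u z = -\<infinity>))"

end

theory Submission
  imports Defs "HOL-Complex_Analysis.Complex_Analysis"
    "HOL-Computational_Algebra.Fundamental_Theorem_Algebra"
begin

text \<open>Composing polynomials with \<open>z \<mapsto> (z, f z)\<close> gives spaces of entire functions, and all parts compare
  the maxima of such functions on two sets. A two-constants estimate moves the inequality from balls
  around the origin to balls around any point; this gives invariance under translations, and products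
  are treated one factor at a time. The exponent in (a) exists since polynomials of bounded degree
  form a finite-dimensional space. If (b) fails for \<open>K\<close>, there are normalised functions \<open>g\<^sub>k\<close> which are
  extremely small on \<open>K\<close>, and a weighted sum of the \<open>log |g\<^sub>k|\<close>, kept finite at a point of a nested
  sequence of balls, shows that \<open>K\<close> is pluripolar. For (c), a transcendental component \<open>f\<^sub>j\<close> allows a
  polynomial \<open>P\<close> of degree \<open>k\<close> with \<open>P(z, f\<^sub>j z)\<close> nonzero but vanishing to order about \<open>k\<^sup>1\<^sup>+\<^sup>1\<^sup>/\<^sup>n\<close> at the
  origin, and Schwarz's lemma contradicts a smaller exponent.\<close>

no_notation fps_nth (infixl "$" 75)

section \<open>Polynomial functions\<close>

abbreviation mon_degree :: "('k::finite \<Rightarrow>\<^sub>0 nat) \<Rightarrow> nat"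
  where "mon_degree \<alpha> \<equiv> (\<Sum>i\<in>UNIV. Poly_Mapping.lookup \<alpha> i)"

abbreviation mon_eval :: "('k::finite \<Rightarrow>\<^sub>0 nat) \<Rightarrow> complex ^ 'k \<Rightarrow> complex"
  where "mon_eval \<alpha> x \<equiv> (\<Prod>i\<in>UNIV. x $ i ^ Poly_Mapping.lookup \<alpha> i)"

definition polyfun :: "nat \<Rightarrow> (complex ^ 'k::finite \<Rightarrow> complex) \<Rightarrow> bool"
  where "polyfun d \<phi> \<longleftrightarrow> (\<exists>p. total_degree p \<le> d \<and> poly_eval p = \<phi>)"

lemma total_degree_le_iff: "total_degree p \<le> d \<longleftrightarrow> (\<forall>\<alpha>\<in>Poly_Mapping.keys p. mon_degree \<alpha> \<le> d)"
  unfolding total_degree_def by (subst Max_le_iff) auto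

lemma poly_eval_superset:
  assumes "finite S" "Poly_Mapping.keys p \<subseteq> S"
  shows "poly_eval p x = (\<Sum>\<alpha>\<in>S. Poly_Mapping.lookup p \<alpha> * mon_eval \<alpha> x)"
  unfolding poly_eval_def
  by (rule sum.mono_neutral_left[OF assms]) (auto simp: in_keys_iff)

lemma poly_eval_add: "poly_eval (p + q) x = poly_eval p x + poly_eval q x"
proof -
  let ?S = "Poly_Mapping.keys p \<union> Poly_Mapping.keys q"
  have S: "finite ?S" by simp
  have "Poly_Mapping.keys (p + q) \<subseteq> ?S" by (rule Poly_Mapping.keys_add)
  then show ?thesis
    by (simp add: poly_eval_superset[OF S] lookup_add distrib_right sum.distrib)
qed

lemma poly_eval_single: "poly_eval (Poly_Mapping.single \<alpha> c) x = c * mon_eval \<alpha> x"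
  by (subst poly_eval_superset[of "{\<alpha>}"]) auto

lemma finite_mon_degree_le: "finite {\<alpha> :: 'k::finite \<Rightarrow>\<^sub>0 nat. mon_degree \<alpha> \<le> d}"
proof -
  have "inj_on Poly_Mapping.lookup {\<alpha> :: 'k \<Rightarrow>\<^sub>0 nat. mon_degree \<alpha> \<le> d}"
    by (rule inj_onI) (rule poly_mapping_eqI, simp)
  moreover have "Poly_Mapping.lookup ` {\<alpha> :: 'k \<Rightarrow>\<^sub>0 nat. mon_degree \<alpha> \<le> d} \<subseteq> (\<Pi>\<^sub>E i\<in>UNIV. {..d})"
  proof (clarsimp simp: PiE_iff)
    fix \<alpha> :: "'k \<Rightarrow>\<^sub>0 nat" and i
    assume "mon_degree \<alpha> \<le> d"
    moreover have "Poly_Mapping.lookup \<alpha> i \<le> mon_degree \<alpha>"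
      by (rule member_le_sum) auto
    ultimately show "Poly_Mapping.lookup \<alpha> i \<le> d" by simp
  qed
  moreover have "finite (\<Pi>\<^sub>E i\<in>(UNIV :: 'k set). {..d})" by (rule finite_PiE) auto
  ultimately show ?thesis by (rule inj_on_finite)
qed

lemma polyfun_mono: "polyfun d \<phi> \<Longrightarrow> d \<le> e \<Longrightarrow> polyfun e \<phi>"
  unfolding polyfun_def using order_trans by blast

lemma polyfun_add:
  assumes "polyfun d \<phi>" "polyfun d \<psi>" shows "polyfun d (\<lambda>x. \<phi> x + \<psi> x)"
proof -
  obtain p q where pq: "total_degree p \<le> d" "poly_eval p = \<phi>" "total_degree q \<le> d" "poly_eval q = \<psi>"
    using assms unfolding polyfun_def by auto
  have "total_degree (p + q) \<le> d"
    using pq(1,3) Poly_Mapping.keys_add[of p q] unfolding total_degree_le_iff by blast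
  moreover have "poly_eval (p + q) = (\<lambda>x. \<phi> x + \<psi> x)"
    using pq by (auto simp: poly_eval_add)
  ultimately show ?thesis unfolding polyfun_def by blast
qed

lemma polyfun_monom: "mon_degree \<alpha> \<le> d \<Longrightarrow> polyfun d (\<lambda>x. c * mon_eval \<alpha> x)"
  unfolding polyfun_def
  by (rule exI[of _ "Poly_Mapping.single \<alpha> c"]) (auto simp: total_degree_le_iff poly_eval_single fun_eq_iff simp del: single_zero)

lemma polyfun_const: "polyfun d (\<lambda>x. c)"
  using polyfun_monom[of 0 d c] by simp

lemma polyfun_sum: "(\<And>i. i \<in> I \<Longrightarrow> polyfun d (\<phi> i)) \<Longrightarrow> polyfun d (\<lambda>x. \<Sum>i\<in>I. \<phi> i x)"
  by (induction I rule: infinite_finite_induct) (auto intro: polyfun_const polyfun_add)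

lemma polyfun_representation:
  assumes "polyfun d \<phi>"
  obtains c where "\<And>x. \<phi> x = (\<Sum>\<alpha> | mon_degree \<alpha> \<le> d. c \<alpha> * mon_eval \<alpha> x)"
proof -
  obtain p where p: "total_degree p \<le> d" "poly_eval p = \<phi>"
    using assms unfolding polyfun_def by auto
  have "Poly_Mapping.keys p \<subseteq> {\<alpha>. mon_degree \<alpha> \<le> d}"
    using p(1) unfolding total_degree_le_iff by blast
  from poly_eval_superset[OF finite_mon_degree_le this] show thesis
    unfolding p(2) by (rule that)
qed

lemma mon_eval_mult: "mon_eval (\<alpha> + \<beta>) x = mon_eval \<alpha> x * mon_eval \<beta> x"
  by (simp add: lookup_add power_add prod.distrib)

lemma polyfun_mult:
  assumes "polyfun d \<phi>" "polyfun e \<psi>" shows "polyfun (d + e) (\<lambda>x. \<phi> x * \<psi> x)"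
proof -
  obtain a where a: "\<And>x. \<phi> x = (\<Sum>\<alpha> | mon_degree \<alpha> \<le> d. a \<alpha> * mon_eval \<alpha> x)"
    using polyfun_representation[OF assms(1)] by blast
  obtain b where b: "\<And>x. \<psi> x = (\<Sum>\<alpha> | mon_degree \<alpha> \<le> e. b \<alpha> * mon_eval \<alpha> x)"
    using polyfun_representation[OF assms(2)] by blast
  have "(\<lambda>x. \<phi> x * \<psi> x) = (\<lambda>x. \<Sum>\<alpha> | mon_degree \<alpha> \<le> d. \<Sum>\<beta> | mon_degree \<beta> \<le> e.
      (a \<alpha> * b \<beta>) * mon_eval (\<alpha> + \<beta>) x)"
    unfolding a b sum_product mon_eval_mult by (simp add: mult_ac)
  moreover have "polyfun (d + e) (\<lambda>x. \<Sum>\<alpha> | mon_degree \<alpha> \<le> d. \<Sum>\<beta> | mon_degree \<beta> \<le> e.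
      (a \<alpha> * b \<beta>) * mon_eval (\<alpha> + \<beta>) x)"
    by (intro polyfun_sum polyfun_monom) (auto simp: lookup_add sum.distrib intro: add_mono)
  ultimately show ?thesis by simp
qed

lemma polyfun_cmult: "polyfun d \<phi> \<Longrightarrow> polyfun d (\<lambda>x. c * \<phi> x)"
  using polyfun_mult[of 0 "\<lambda>x. c" d \<phi>] by (simp add: polyfun_const)

lemma polyfun_diff:
  assumes "polyfun d \<phi>" "polyfun d \<psi>" shows "polyfun d (\<lambda>x. \<phi> x - \<psi> x)"
proof -
  have "polyfun d (\<lambda>x. \<phi> x + (- 1) * \<psi> x)"
    by (rule polyfun_add[OF assms(1) polyfun_cmult[OF assms(2)]])
  then show ?thesis by (simp only: mult_minus1 add_uminus_conv_diff)
qed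

lemma mon_eval_coord: "mon_eval (Poly_Mapping.single i d) x = x $ i ^ d"
proof -
  have "mon_eval (Poly_Mapping.single i d) x = (\<Prod>j\<in>UNIV. if j = i then x $ i ^ d else 1)"
    by (rule prod.cong) (auto simp: lookup_single when_def)
  then show ?thesis by simp
qed

lemma mon_degree_single: "mon_degree (Poly_Mapping.single i d) = d"
proof -
  have "mon_degree (Poly_Mapping.single i d) = (\<Sum>j\<in>UNIV. if j = i then d else 0)"
    by (rule sum.cong) (auto simp: lookup_single when_def)
  then show ?thesis by simp
qed

lemma polyfun_coord: "1 \<le> d \<Longrightarrow> polyfun d (\<lambda>x. x $ i)"
  using polyfun_monom[of "Poly_Mapping.single i 1" d 1]
  by (simp only: mon_degree_single mon_eval_coord) simp

lemma polyfun_power: "polyfun d \<phi> \<Longrightarrow> polyfun (k * d) (\<lambda>x. \<phi> x ^ k)"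
proof (induction k)
  case (Suc k)
  then show ?case using polyfun_mult[of d \<phi> "k * d" "\<lambda>x. \<phi> x ^ k"] by simp
qed (simp add: polyfun_const)

lemma polyfun_prod:
  "(\<And>i. i \<in> I \<Longrightarrow> polyfun (d i) (\<phi> i)) \<Longrightarrow> polyfun (\<Sum>i\<in>I. d i) (\<lambda>x. \<Prod>i\<in>I. \<phi> i x)"
  by (induction I rule: infinite_finite_induct) (auto intro: polyfun_const polyfun_mult)

lemma polyfun_compose:
  assumes "polyfun d \<phi>" "\<And>k. polyfun 1 (\<lambda>x. T x $ k)"
  shows "polyfun d (\<lambda>x. \<phi> (T x))"
proof -
  obtain a where a: "\<And>x. \<phi> x = (\<Sum>\<alpha> | mon_degree \<alpha> \<le> d. a \<alpha> * mon_eval \<alpha> x)"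
    using polyfun_representation[OF assms(1)] by blast
  have "polyfun (mon_degree \<alpha>) (\<lambda>x. mon_eval \<alpha> (T x))" for \<alpha>
    by (rule polyfun_prod) (metis assms(2) mult.right_neutral polyfun_power)
  then have "polyfun d (\<lambda>x. a \<alpha> * mon_eval \<alpha> (T x))" if "mon_degree \<alpha> \<le> d" for \<alpha>
    using that polyfun_mono polyfun_cmult by blast
  then show ?thesis unfolding a by (intro polyfun_sum) simp
qed

lemma polyfun_0_const: "polyfun 0 \<phi> \<Longrightarrow> \<phi> x = \<phi> y"
proof -
  assume "polyfun 0 \<phi>"
  then obtain a where a: "\<And>x. \<phi> x = (\<Sum>\<alpha> | mon_degree \<alpha> \<le> 0. a \<alpha> * mon_eval \<alpha> x)"
    using polyfun_representation by blast
  have "mon_eval \<alpha> x = mon_eval \<alpha> y" if "mon_degree \<alpha> \<le> 0" for \<alpha>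
    using that by auto
  then show ?thesis unfolding a by (intro sum.cong) auto
qed

section \<open>Entire functions\<close>

definition entire :: "(complex ^ 'n \<Rightarrow> complex) \<Rightarrow> bool"
  where "entire g \<longleftrightarrow> continuous_on UNIV g \<and> (\<forall>a b. (\<lambda>\<zeta>. g (a + \<zeta> *s b)) holomorphic_on UNIV)"

lemma entire_continuous: "entire g \<Longrightarrow> continuous_on S g"
  unfolding entire_def using continuous_on_subset by blast

lemma entire_line: "entire g \<Longrightarrow> (\<lambda>\<zeta>. g (a + \<zeta> *s b)) holomorphic_on S"
  unfolding entire_def using holomorphic_on_subset by blast

lemma entire_const: "entire (\<lambda>z. c)"
  by (simp add: entire_def)

lemma entire_add: "entire g \<Longrightarrow> entire h \<Longrightarrow> entire (\<lambda>z. g z + h z)"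
  unfolding entire_def by (auto intro!: continuous_intros holomorphic_intros)

lemma entire_diff: "entire g \<Longrightarrow> entire h \<Longrightarrow> entire (\<lambda>z. g z - h z)"
  unfolding entire_def by (auto intro!: continuous_intros holomorphic_intros)

lemma entire_mult: "entire g \<Longrightarrow> entire h \<Longrightarrow> entire (\<lambda>z. g z * h z)"
  unfolding entire_def by (auto intro!: continuous_intros holomorphic_intros)

lemma entire_sum: "(\<And>i. i \<in> I \<Longrightarrow> entire (g i)) \<Longrightarrow> entire (\<lambda>z. \<Sum>i\<in>I. g i z)"
  by (induction I rule: infinite_finite_induct) (auto intro: entire_const entire_add)

lemma entire_prod: "(\<And>i. i \<in> I \<Longrightarrow> entire (g i)) \<Longrightarrow> entire (\<lambda>z. \<Prod>i\<in>I. g i z)"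
  by (induction I rule: infinite_finite_induct) (auto intro: entire_const entire_mult)

lemma entire_power: "entire g \<Longrightarrow> entire (\<lambda>z. g z ^ k)"
  by (induction k) (auto intro: entire_const entire_mult)

lemma entire_coord: "entire (\<lambda>z. z $ i)"
  unfolding entire_def by (auto intro!: continuous_intros holomorphic_intros)

lemma entire_polyfun:
  assumes "polyfun d \<phi>" "\<And>k. entire (\<lambda>z. T z $ k)"
  shows "entire (\<lambda>z. \<phi> (T z))"
proof -
  obtain a where a: "\<And>x. \<phi> x = (\<Sum>\<alpha> | mon_degree \<alpha> \<le> d. a \<alpha> * mon_eval \<alpha> x)"
    using polyfun_representation[OF assms(1)] by blast
  show ?thesis unfolding a
    by (intro entire_sum entire_mult entire_const entire_prod entire_power assms(2))
qed

lemma entire_of_holomorphic_map: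
  fixes f :: "complex ^ 'n \<Rightarrow> complex ^ 'm"
  assumes "holomorphic_map_on f UNIV" shows "entire (\<lambda>z. f z $ j)"
proof -
  have D: "\<exists>D. (f has_derivative D) (at z) \<and> (\<forall>c v. D (c *s v) = c *s D v)" for z
    using assms unfolding holomorphic_map_on_def by auto
  have "continuous_on UNIV f"
    using D by (meson continuous_at_imp_continuous_on has_derivative_continuous)
  moreover have "(\<lambda>\<zeta>. f (a + \<zeta> *s b) $ j) holomorphic_on UNIV" for a b
    unfolding holomorphic_on_def
  proof
    fix \<zeta> :: complex
    obtain D where D: "(f has_derivative D) (at (a + \<zeta> *s b))" "\<And>c v. D (c *s v) = c *s D v"
      using D by blast
    have lin: "bounded_linear (\<lambda>\<zeta>. \<zeta> *s b)"
      by (rule linear_conv_bounded_linear[THEN iffD1]) (auto intro!: linearI simp: vec_eq_iff algebra_simps)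
    have "((\<lambda>\<zeta>. a + \<zeta> *s b) has_derivative (\<lambda>\<zeta>. \<zeta> *s b)) (at \<zeta>)"
      by (auto intro!: derivative_eq_intros bounded_linear.has_derivative[OF lin])
    from diff_chain_at[OF this D(1)]
    have "((\<lambda>\<zeta>. f (a + \<zeta> *s b)) has_derivative (\<lambda>\<zeta>. \<zeta> *s D b)) (at \<zeta>)"
      by (simp add: o_def D(2))
    from bounded_linear.has_derivative[OF bounded_linear_vec_nth this, of j]
    have "((\<lambda>\<zeta>. f (a + \<zeta> *s b) $ j) has_field_derivative D b $ j) (at \<zeta>)"
      by (simp add: has_field_derivative_def mult_commute_abs)
    then show "(\<lambda>\<zeta>. f (a + \<zeta> *s b) $ j) field_differentiable at \<zeta> within UNIV"
      unfolding field_differentiable_def by auto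
  qed
  ultimately show ?thesis
    unfolding entire_def by (auto intro!: continuous_intros)
qed

lemma entire_translate:
  assumes "entire g" shows "entire (\<lambda>z. g (z + w))"
  unfolding entire_def
proof safe
  show "continuous_on UNIV (\<lambda>z. g (z + w))"
    by (rule continuous_on_compose2[OF entire_continuous[OF assms, of UNIV]]) (auto intro!: continuous_intros)
  fix a b
  show "(\<lambda>\<zeta>. g (a + \<zeta> *s b + w)) holomorphic_on UNIV"
    using entire_line[OF assms, of "a + w" b] by (simp add: add_ac)
qed

lemma entire_zero_on_ball:
  assumes g: "entire g" and e: "0 < e" and 0: "\<And>z. z \<in> ball w e \<Longrightarrow> g z = 0"
  shows "g z = 0"
proof -
  let ?h = "\<lambda>\<zeta>. g (w + \<zeta> *s (z - w))"
  have c: "continuous_on UNIV (\<lambda>\<zeta>::complex. w + \<zeta> *s (z - w))"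
    by (auto intro!: continuous_intros simp: continuous_on_vec_lambda vector_scalar_mult_def)
  have op: "open ((\<lambda>\<zeta>::complex. w + \<zeta> *s (z - w)) -` ball w e)"
    by (rule open_vimage[OF open_ball c])
  have "0 \<in> (\<lambda>\<zeta>::complex. w + \<zeta> *s (z - w)) -` ball w e" using e by simp
  then obtain d where d: "0 < d" "ball 0 d \<subseteq> (\<lambda>\<zeta>::complex. w + \<zeta> *s (z - w)) -` ball w e"
    using op by (meson openE)
  have "?h 1 = 0"
  proof (rule analytic_continuation_open[of "ball 0 d" UNIV ?h "\<lambda>_. 0"])
    show "?h holomorphic_on UNIV" by (rule entire_line[OF g])
    show "?h \<zeta> = 0" if "\<zeta> \<in> ball 0 d" for \<zeta>
      using d(2) that 0 by auto
    show "ball (0::complex) d \<noteq> {}" using d(1) by simp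
  qed auto
  then show ?thesis by (simp add: vec_eq_iff)
qed

definition taylor_coeff :: "(complex \<Rightarrow> complex) \<Rightarrow> nat \<Rightarrow> complex"
  where "taylor_coeff h k = (deriv ^^ k) h 0 / fact k"

lemma taylor_coeff_bound:
  assumes "h holomorphic_on UNIV" "0 < R" "\<And>\<zeta>. cmod \<zeta> \<le> R \<Longrightarrow> cmod (h \<zeta>) \<le> M"
  shows "cmod (taylor_coeff h k) \<le> M / R ^ k"
proof -
  have "norm ((deriv ^^ k) h 0) \<le> fact k * M / R ^ k"
    by (rule Cauchy_inequality)
      (use assms in \<open>auto intro: holomorphic_on_subset holomorphic_on_imp_continuous_on\<close>)
  then show ?thesis
    by (simp add: taylor_coeff_def norm_divide field_simps)
qed

lemma taylor_remainder_bound: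
  assumes h: "h holomorphic_on UNIV" and R: "0 < R"
    and M: "\<And>\<zeta>. cmod \<zeta> \<le> R \<Longrightarrow> cmod (h \<zeta>) \<le> M" and \<zeta>: "cmod \<zeta> \<le> R / 2"
  shows "cmod (h \<zeta> - (\<Sum>k<m. taylor_coeff h k * \<zeta> ^ k)) \<le> 2 * M * (cmod \<zeta> / R) ^ m"
proof -
  let ?c = "\<lambda>k. taylor_coeff h k * \<zeta> ^ k" and ?x = "cmod \<zeta> / R"
  have M0: "0 \<le> M" using order_trans[OF norm_ge_zero M[of 0]] R by simp
  have x: "0 \<le> ?x" "?x \<le> 1/2" using R \<zeta> by (auto simp: field_simps)
  have xn: "norm ?x < 1" using x unfolding real_norm_def by linarith
  have b: "cmod (?c k) \<le> M * ?x ^ k" for k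
  proof -
    have "cmod (?c k) = cmod (taylor_coeff h k) * cmod \<zeta> ^ k"
      by (simp add: norm_mult norm_power)
    also have "\<dots> \<le> M / R ^ k * cmod \<zeta> ^ k"
      by (intro mult_right_mono taylor_coeff_bound[OF h R M]) auto
    finally show ?thesis by (simp add: power_divide)
  qed
  have "?c sums h \<zeta>"
    using holomorphic_power_series[of h 0 "cmod \<zeta> + 1" \<zeta>] h
    by (auto intro: holomorphic_on_subset simp: taylor_coeff_def)
  then have "h \<zeta> - (\<Sum>k<m. ?c k) = suminf (\<lambda>k. ?c (k + m))"
    using suminf_minus_initial_segment[of ?c m] by (simp add: sums_iff)
  also have "cmod \<dots> \<le> suminf (\<lambda>k. M * ?x ^ m * ?x ^ k)"
  proof (rule norm_suminf_le)
    show "cmod (?c (k + m)) \<le> M * ?x ^ m * ?x ^ k" for k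
      using b[of "k + m"] by (simp add: power_add mult_ac)
    show "summable (\<lambda>k. M * ?x ^ m * ?x ^ k)"
      by (intro summable_mult summable_geometric xn)
  qed
  also have "\<dots> = M * ?x ^ m * (1 / (1 - ?x))"
    using suminf_mult[OF summable_geometric[OF xn], of "M * ?x ^ m"] suminf_geometric[OF xn] by metis
  also have "\<dots> \<le> M * ?x ^ m * 2"
  proof (intro mult_left_mono mult_nonneg_nonneg zero_le_power M0 x(1))
    have "1/2 \<le> 1 - ?x" using x(2) by linarith
    then show "1 / (1 - ?x) \<le> 2" using frac_le[of 1 1 "1/2" "1 - ?x"] by auto
  qed
  finally show ?thesis by (simp add: mult_ac)
qed

section \<open>Bernstein inequalities as a relation between compact sets\<close>

definition graph_funs ::
  "(complex ^ 'n \<Rightarrow> complex ^ 'm) \<Rightarrow> nat \<Rightarrow> (complex ^ 'n \<Rightarrow> complex) set"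
  where "graph_funs f d = {\<lambda>z. \<phi> (vec_pair z (f z)) |\<phi>. polyfun d \<phi>}"

text \<open>In contrast to \<^const>\<open>admits_bernstein\<close>, \<open>d\<close> is only an upper bound for the degree here; this
  is what makes the relation stable under affine substitutions and restrictions.\<close>

definition controls ::
  "(complex ^ 'n \<Rightarrow> complex ^ 'm) \<Rightarrow> (nat \<Rightarrow> real) \<Rightarrow> (complex ^ 'n) set \<Rightarrow> (complex ^ 'n) set \<Rightarrow> bool"
  where "controls f \<mu> K L \<longleftrightarrow>
    (\<exists>C\<ge>1. \<forall>d. \<forall>g\<in>graph_funs f d. \<forall>M. (\<forall>z\<in>K. cmod (g z) \<le> M) \<longrightarrow>
       (\<forall>z\<in>L. cmod (g z) \<le> C powr \<mu> d * M))"

lemma graph_funsI: "polyfun d \<phi> \<Longrightarrow> (\<And>z. g z = \<phi> (vec_pair z (f z))) \<Longrightarrow> g \<in> graph_funs f d"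
  unfolding graph_funs_def by auto

lemma graph_funsE:
  assumes "g \<in> graph_funs f d"
  obtains \<phi> where "polyfun d \<phi>" "\<And>z. g z = \<phi> (vec_pair z (f z))"
  using assms unfolding graph_funs_def by auto

lemma controlsE:
  assumes "controls f \<mu> K L"
  obtains C where "1 \<le> C"
    "\<And>d g M z. g \<in> graph_funs f d \<Longrightarrow> (\<And>z. z \<in> K \<Longrightarrow> cmod (g z) \<le> M) \<Longrightarrow> z \<in> L \<Longrightarrow>
       cmod (g z) \<le> C powr \<mu> d * M"
  using assms unfolding controls_def by metis

lemma vec_pair_nth [simp]: "vec_pair z w $ Inl i = z $ i" "vec_pair z w $ Inr j = w $ j"
  by (simp_all add: vec_pair_def)

lemma vec_fst_snd_nth [simp]: "vec_fst x $ i = x $ Inl i" "vec_snd x $ j = x $ Inr j"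
  by (simp_all add: vec_fst_def vec_snd_def)

lemma vec_fst_snd_pair [simp]: "vec_fst (vec_pair z w) = z" "vec_snd (vec_pair z w) = w"
  by (simp_all add: vec_eq_iff)

lemma vec_pair_fst_snd [simp]: "vec_pair (vec_fst x) (vec_snd x) = x"
  by (auto simp: vec_eq_iff vec_pair_def split: sum.split)

lemma polyfun_vec_pair:
  assumes "\<And>i. polyfun d (\<lambda>x. A x $ i)" "\<And>j. polyfun d (\<lambda>x. B x $ j)"
  shows "polyfun d (\<lambda>x. vec_pair (A x) (B x) $ k)"
  using assms by (cases k) simp_all

lemma entire_vec_pair:
  assumes "\<And>i. entire (\<lambda>x. A x $ i)" "\<And>j. entire (\<lambda>x. B x $ j)"
  shows "entire (\<lambda>x. vec_pair (A x) (B x) $ k)"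
  using assms by (cases k) simp_all

lemma graph_funs_entire:
  fixes f :: "complex ^ 'n \<Rightarrow> complex ^ 'm"
  assumes f: "holomorphic_map_on f UNIV" and g: "g \<in> graph_funs f d"
  shows "entire g"
proof -
  obtain \<phi> where \<phi>: "polyfun d \<phi>" "\<And>z. g z = \<phi> (vec_pair z (f z))"
    using graph_funsE[OF g] by blast
  have "entire (\<lambda>z. \<phi> (vec_pair z (f z)))"
    by (rule entire_polyfun[OF \<phi>(1)]) (intro entire_vec_pair entire_coord entire_of_holomorphic_map[OF f])
  then show ?thesis using \<phi>(2) by presburger
qed

lemma graph_funs_poly_eval: "(\<lambda>z. poly_eval p (vec_pair z (f z))) \<in> graph_funs f (total_degree p)"
  by (rule graph_funsI[of _ "poly_eval p"]) (auto simp: polyfun_def)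

lemma graph_funs_coord: "1 \<le> d \<Longrightarrow> (\<lambda>z. z $ i) \<in> graph_funs f d"
  by (rule graph_funsI[of _ "\<lambda>x. x $ Inl i"]) (auto intro: polyfun_coord)

lemma graph_funs_cmult:
  assumes "g \<in> graph_funs f d" shows "(\<lambda>z. c * g z) \<in> graph_funs f d"
proof -
  obtain \<phi> where \<phi>: "polyfun d \<phi>" "\<And>z. g z = \<phi> (vec_pair z (f z))"
    using graph_funsE[OF assms] by blast
  show ?thesis by (rule graph_funsI[OF polyfun_cmult[OF \<phi>(1), of c]]) (simp add: \<phi>(2))
qed

lemma graph_funs_0_const: 
  assumes "g \<in> graph_funs f 0" shows "g z = g w"
  using assms by (metis graph_funsE polyfun_0_const)

lemma compact_bounded_entire:
  assumes "entire g" "compact K"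
  obtains B where "0 \<le> B" "\<And>z. z \<in> K \<Longrightarrow> cmod (g z) \<le> B"
proof -
  have "compact (g ` K)"
    by (intro compact_continuous_image entire_continuous assms)
  then obtain B where "\<And>x. x \<in> g ` K \<Longrightarrow> cmod x \<le> B"
    by (meson bounded_iff compact_imp_bounded)
  then have "cmod (g z) \<le> max B 0" if "z \<in> K" for z
    using that by fastforce
  then show thesis by (rule that[rotated]) auto
qed

lemma compact_attains_max_entire:
  assumes "entire g" "compact K" "K \<noteq> {}"
  obtains z where "z \<in> K" "\<And>x. x \<in> K \<Longrightarrow> cmod (g x) \<le> cmod (g z)"
  using continuous_attains_sup[of K "\<lambda>z. cmod (g z)"] assms
  by (metis continuous_on_norm entire_continuous)

lemma max_on_graph_le_iff:
  fixes f :: "complex ^ 'n \<Rightarrow> complex ^ 'm"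
  assumes f: "holomorphic_map_on f UNIV"
    and K: "compact K" "K \<noteq> {}" and L: "compact L" "L \<noteq> {}" and A: "0 \<le> A"
  shows "max_on_graph f p L \<le> A * max_on_graph f p K \<longleftrightarrow>
    (\<forall>M. (\<forall>z\<in>K. cmod (poly_eval p (vec_pair z (f z))) \<le> M) \<longrightarrow>
      (\<forall>z\<in>L. cmod (poly_eval p (vec_pair z (f z))) \<le> A * M))" (is "?l \<longleftrightarrow> ?r")
proof -
  define g where "g = (\<lambda>z. poly_eval p (vec_pair z (f z)))"
  have g: "entire g"
    unfolding g_def by (rule graph_funs_entire[OF f graph_funs_poly_eval])
  have le: "cmod (g z) \<le> (SUP z\<in>S. cmod (g z))" if "compact S" "z \<in> S" for z S
  proof -
    obtain B where "\<And>z. z \<in> S \<Longrightarrow> cmod (g z) \<le> B"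
      using compact_bounded_entire[OF g \<open>compact S\<close>] by blast
    then show ?thesis using that by (intro cSUP_upper bdd_aboveI2) auto
  qed
  have "(SUP z\<in>L. cmod (g z)) \<le> A * (SUP z\<in>K. cmod (g z)) \<longleftrightarrow>
    (\<forall>M. (\<forall>z\<in>K. cmod (g z) \<le> M) \<longrightarrow> (\<forall>z\<in>L. cmod (g z) \<le> A * M))" (is "?l' \<longleftrightarrow> ?r'")
  proof
    assume l: ?l'
    show ?r'
    proof (intro allI impI ballI)
      fix M z assume M: "\<forall>z\<in>K. cmod (g z) \<le> M" and z: "z \<in> L"
      have "(SUP z\<in>K. cmod (g z)) \<le> M" using K M by (intro cSUP_least) auto
      then have "A * (SUP z\<in>K. cmod (g z)) \<le> A * M" using A by (rule mult_left_mono)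
      with le[OF L(1) z] l show "cmod (g z) \<le> A * M" by linarith
    qed
  next
    assume r: ?r'
    have "\<forall>z\<in>L. cmod (g z) \<le> A * (SUP z\<in>K. cmod (g z))"
      using le[OF K(1)] r by blast
    then show ?l' using L by (intro cSUP_least) auto
  qed
  then show ?thesis unfolding max_on_graph_def g_def .
qed

lemma rpow_le_powr_max: "0 \<le> C \<Longrightarrow> 0 \<le> s \<Longrightarrow> rpow C s \<le> max C 1 powr s"
  unfolding rpow_def by (auto intro: powr_mono2)

lemma rpow_nonneg: "0 \<le> rpow C s"
  unfolding rpow_def by auto

lemma total_degree_add_single:
  assumes "total_degree p \<le> mon_degree \<alpha>" "c \<noteq> - Poly_Mapping.lookup p \<alpha>"
  shows "total_degree (p + Poly_Mapping.single \<alpha> c) = mon_degree \<alpha>"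
proof (rule antisym)
  have "Poly_Mapping.keys (p + Poly_Mapping.single \<alpha> c) \<subseteq> Poly_Mapping.keys p \<union> {\<alpha>}"
    using Poly_Mapping.keys_add[of p "Poly_Mapping.single \<alpha> c"] by (auto split: if_splits)
  then show "total_degree (p + Poly_Mapping.single \<alpha> c) \<le> mon_degree \<alpha>"
    using assms(1) unfolding total_degree_le_iff by blast
  have "Poly_Mapping.lookup (p + Poly_Mapping.single \<alpha> c) \<alpha> \<noteq> 0"
    using assms(2) by (auto simp: lookup_add add_eq_0_iff)
  then have "\<alpha> \<in> Poly_Mapping.keys (p + Poly_Mapping.single \<alpha> c)"
    by (simp add: in_keys_iff)
  then show "mon_degree \<alpha> \<le> total_degree (p + Poly_Mapping.single \<alpha> c)"
    using total_degree_le_iff by blast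
qed

text \<open>A polynomial of degree at most \<open>d\<close> becomes one of degree exactly \<open>d\<close> after adding a small
  multiple of the \<open>d\<close>-th power of a coordinate.\<close>

lemma controls_iff_max_on_graph:
  fixes f :: "complex ^ 'n \<Rightarrow> complex ^ 'm"
  assumes f: "holomorphic_map_on f UNIV" and \<mu>: "\<And>k. 0 \<le> \<mu> k"
    and K: "compact K" "K \<noteq> {}" and L: "compact L" "L \<noteq> {}"
  shows "controls f \<mu> K L \<longleftrightarrow>
    (\<exists>C\<ge>0. \<forall>p. max_on_graph f p L \<le> rpow C (\<mu> (total_degree p)) * max_on_graph f p K)"
proof
  assume "controls f \<mu> K L"
  then obtain C where C: "1 \<le> C"
    "\<And>d g M z. g \<in> graph_funs f d \<Longrightarrow> (\<And>z. z \<in> K \<Longrightarrow> cmod (g z) \<le> M) \<Longrightarrow> z \<in> L \<Longrightarrow>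
       cmod (g z) \<le> C powr \<mu> d * M"
    by (metis controlsE)
  have r: "rpow C s = C powr s" for s using C(1) by (simp add: rpow_def)
  have "max_on_graph f p L \<le> rpow C (\<mu> (total_degree p)) * max_on_graph f p K" for p
    unfolding r max_on_graph_le_iff[OF f K L powr_ge_zero]
    using C(2)[OF graph_funs_poly_eval] by blast
  then show "\<exists>C\<ge>0. \<forall>p. max_on_graph f p L \<le> rpow C (\<mu> (total_degree p)) * max_on_graph f p K"
    using C(1) by (intro exI[of _ C]) auto
next
  assume "\<exists>C\<ge>0. \<forall>p. max_on_graph f p L \<le> rpow C (\<mu> (total_degree p)) * max_on_graph f p K"
  then obtain C where C: "0 \<le> C"
    "\<And>p. max_on_graph f p L \<le> rpow C (\<mu> (total_degree p)) * max_on_graph f p K" by blast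
  let ?C = "max C 1"
  have "cmod (g z) \<le> ?C powr \<mu> d * M"
    if g: "g \<in> graph_funs f d" and M: "\<And>z. z \<in> K \<Longrightarrow> cmod (g z) \<le> M" and z: "z \<in> L" for d g M z
  proof -
    obtain \<phi> where \<phi>: "polyfun d \<phi>" "\<And>z. g z = \<phi> (vec_pair z (f z))"
      using graph_funsE[OF g] by blast
    obtain p where p: "total_degree p \<le> d" "poly_eval p = \<phi>"
      using \<phi>(1) unfolding polyfun_def by blast
    obtain i :: 'n where True by simp
    define \<alpha> :: "('n + 'm) \<Rightarrow>\<^sub>0 nat" where "\<alpha> = Poly_Mapping.single (Inl i) d"
    have \<alpha>: "mon_degree \<alpha> = d" unfolding \<alpha>_def by (rule mon_degree_single)
    have \<alpha>_eval: "mon_eval \<alpha> (vec_pair z (f z)) = z $ i ^ d" for z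
      unfolding \<alpha>_def mon_eval_coord by simp
    obtain Q where Q: "0 \<le> Q" "\<And>z. z \<in> K \<union> L \<Longrightarrow> cmod (z $ i ^ d) \<le> Q"
      using compact_bounded_entire[OF entire_power[OF entire_coord] compact_Un[OF K(1) L(1)]] by metis
    have M0: "0 \<le> M" using K(2) M by (meson all_not_in_conv norm_ge_zero order_trans)
    let ?A = "?C powr \<mu> d"
    have "cmod (g z) \<le> ?A * M + e" if e: "0 < e" for e
    proof -
      define \<eta> where "\<eta> = e / (?A * Q + Q + 1)"
      have den: "0 < ?A * Q + Q + 1" using Q(1) by (simp add: add_nonneg_pos)
      have \<eta>: "0 < \<eta>" unfolding \<eta>_def using e den by simp
      obtain c where c: "c \<noteq> - Poly_Mapping.lookup p \<alpha>" "cmod c \<le> \<eta>"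
      proof (cases "complex_of_real \<eta> = - Poly_Mapping.lookup p \<alpha>")
        case True
        then have "complex_of_real (\<eta> / 2) \<noteq> - Poly_Mapping.lookup p \<alpha>"
          using \<eta> by (metis field_sum_of_halves less_numeral_extra(3) add_cancel_left_right half_gt_zero of_real_eq_iff)
        then show thesis using \<eta> by (intro that[of "complex_of_real (\<eta> / 2)"]) auto
      next
        case False
        then show thesis using \<eta> by (intro that[of "complex_of_real \<eta>"]) auto
      qed
      define q where "q = p + Poly_Mapping.single \<alpha> c"
      have deg: "total_degree q = d"
        unfolding q_def using total_degree_add_single[of p \<alpha> c] p(1) \<alpha> c(1) by simp
      have q: "poly_eval q (vec_pair z (f z)) = g z + c * z $ i ^ d" for z
        unfolding q_def poly_eval_add poly_eval_single \<alpha>_eval p(2) \<phi>(2) ..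
      have cz: "cmod (c * z $ i ^ d) \<le> \<eta> * Q" if "z \<in> K \<union> L" for z
        unfolding norm_mult using c(2) Q(1) Q(2)[OF that] \<eta> by (intro mult_mono) auto
      have "cmod (poly_eval q (vec_pair z (f z))) \<le> M + \<eta> * Q" if "z \<in> K" for z
        unfolding q using M[OF that] cz[of z] that norm_triangle_ineq[of "g z" "c * z $ i ^ d"] by auto
      then have "cmod (poly_eval q (vec_pair z (f z))) \<le> rpow C (\<mu> d) * (M + \<eta> * Q)"
        using C(2)[of q] z unfolding max_on_graph_le_iff[OF f K L rpow_nonneg] deg by blast
      also have "\<dots> \<le> ?A * (M + \<eta> * Q)"
        using M0 \<eta> Q(1) C(1) \<mu> by (intro mult_right_mono rpow_le_powr_max) auto
      finally have "cmod (g z + c * z $ i ^ d) \<le> ?A * (M + \<eta> * Q)" unfolding q .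
      then have "cmod (g z) \<le> ?A * (M + \<eta> * Q) + \<eta> * Q"
        using cz[of z] z norm_triangle_ineq4[of "g z + c * z $ i ^ d" "c * z $ i ^ d"] by auto
      also have "\<dots> = ?A * M + \<eta> * (?A * Q + Q)" by (simp add: algebra_simps)
      also have "\<dots> \<le> ?A * M + \<eta> * (?A * Q + Q + 1)" using \<eta> by simp
      also have "\<eta> * (?A * Q + Q + 1) = e" unfolding \<eta>_def using den by simp
      finally show ?thesis .
    qed
    then show ?thesis by (rule field_le_epsilon)
  qed
  then show "controls f \<mu> K L"
    unfolding controls_def by (intro exI[of _ ?C]) auto
qed

lemma admits_bernstein_iff_controls:
  assumes "holomorphic_map_on f UNIV" "\<And>k. 0 \<le> \<mu> k"
  shows "admits_bernstein f \<mu> \<longleftrightarrow> (\<forall>r>0. controls f \<mu> (cball 0 r) (cball 0 (exp 1 * r)))"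
  unfolding admits_bernstein_def
  by (intro arg_cong[where f=All] ext imp_cong refl)
    (subst controls_iff_max_on_graph[OF assms], auto simp: not_less)

lemma controls_mono: "controls f \<mu> K L \<Longrightarrow> K \<subseteq> K' \<Longrightarrow> L' \<subseteq> L \<Longrightarrow> controls f \<mu> K' L'"
  unfolding controls_def by (meson subset_iff)

lemma controls_refl: "controls f \<mu> K K"
  unfolding controls_def by (rule exI[of _ 1]) auto

lemma controls_trans:
  assumes "controls f \<mu> K L" "controls f \<mu> L N" shows "controls f \<mu> K N"
proof -
  obtain C where C: "1 \<le> C"
    "\<And>d g M z. g \<in> graph_funs f d \<Longrightarrow> (\<And>z. z \<in> K \<Longrightarrow> cmod (g z) \<le> M) \<Longrightarrow> z \<in> L \<Longrightarrow>
       cmod (g z) \<le> C powr \<mu> d * M"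
    using controlsE[OF assms(1)] by blast
  obtain D where D: "1 \<le> D"
    "\<And>d g M z. g \<in> graph_funs f d \<Longrightarrow> (\<And>z. z \<in> L \<Longrightarrow> cmod (g z) \<le> M) \<Longrightarrow> z \<in> N \<Longrightarrow>
       cmod (g z) \<le> D powr \<mu> d * M"
    using controlsE[OF assms(2)] by blast
  have "cmod (g z) \<le> (D * C) powr \<mu> d * M"
    if "g \<in> graph_funs f d" "\<forall>z\<in>K. cmod (g z) \<le> M" "z \<in> N" for g d M z
    using D(2)[OF that(1) _ that(3), of "C powr \<mu> d * M"] C(2)[OF that(1)] that(2) C(1) D(1)
    by (simp add: powr_mult mult.assoc)
  moreover have "1 \<le> D * C" using C(1) D(1) mult_mono[of 1 D 1 C] by simp
  ultimately show ?thesis unfolding controls_def by blast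
qed

lemma admits_bernstein_imp_controls_origin:
  assumes "holomorphic_map_on f UNIV" "\<And>k. 0 \<le> \<mu> k" "admits_bernstein f \<mu>" "0 < r"
  shows "controls f \<mu> (cball 0 r) (cball 0 R)"
proof -
  have *: "controls f \<mu> (cball 0 r) (cball 0 (exp 1 ^ N * r))" for N
  proof (induction N)
    case (Suc N)
    have "controls f \<mu> (cball 0 (exp 1 ^ N * r)) (cball 0 (exp 1 * (exp 1 ^ N * r)))"
      using admits_bernstein_iff_controls[of f \<mu>] assms by simp
    from controls_trans[OF Suc this] show ?case by (simp add: mult_ac)
  qed (simp add: controls_refl)
  obtain N where "R / r < exp 1 ^ N"
    using real_arch_pow[of "exp 1" "R / r"] by auto
  then have "R \<le> exp 1 ^ N * r" using assms(4) by (simp add: field_simps)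
  then show ?thesis using controls_mono[OF *[of N] order_refl] by (simp add: cball_subset_cball_iff)
qed

text \<open>Coordinate functions have degree 1 and grow, so the exponent is bounded away from 0 on
  positive degrees; this absorbs constant factors into the power.\<close>

lemma admits_bernstein_powr_ge_2:
  fixes f :: "complex ^ 'n \<Rightarrow> complex ^ 'm"
  assumes "holomorphic_map_on f UNIV" "\<And>k. 0 \<le> \<mu> k" "admits_bernstein f \<mu>"
  obtains B where "1 \<le> B" "\<And>d. 1 \<le> d \<Longrightarrow> 2 \<le> B powr \<mu> d"
proof -
  have "controls f \<mu> (cball 0 1) (cball 0 2)"
    by (rule admits_bernstein_imp_controls_origin[OF assms]) auto
  then obtain C where C: "1 \<le> C"
    "\<And>d g M z. g \<in> graph_funs f d \<Longrightarrow> (\<And>z. z \<in> cball 0 1 \<Longrightarrow> cmod (g z) \<le> M) \<Longrightarrow> z \<in> cball 0 2 \<Longrightarrow>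
       cmod (g z) \<le> C powr \<mu> d * M"
    by (metis controlsE)
  obtain i :: 'n where True by simp
  have "2 \<le> C powr \<mu> d" if "1 \<le> d" for d
    using C(2)[OF graph_funs_coord[OF that], of i 1 "2 *\<^sub>R axis i 1"]
      order_trans[OF Finite_Cartesian_Product.norm_nth_le]
    by (auto simp: norm_axis_1)
  with C(1) that show thesis by blast
qed

lemma norm_vector_scalar_mult: "norm (c *s v) = cmod c * norm v" for v :: "complex ^ 'n"
  by (simp add: norm_vec_def norm_mult L2_set_right_distrib)

lemma dist_add: "dist w (w + v) = norm v" for v :: "'a::real_normed_vector"
  by (simp add: dist_norm)

lemma power_powr: "0 \<le> x \<Longrightarrow> (x ^ j) powr a = (x powr a) ^ (j::nat)" for x :: real
  by (induction j) (simp_all add: powr_mult)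

lemma two_constants_disc:
  assumes h: "h holomorphic_on UNIV" and q: "1 \<le> q"
    and \<epsilon>: "\<And>\<zeta>. cmod \<zeta> \<le> 1 / q \<Longrightarrow> cmod (h \<zeta>) \<le> \<epsilon>" and M: "\<And>\<zeta>. cmod \<zeta> \<le> 2 \<Longrightarrow> cmod (h \<zeta>) \<le> M"
  shows "cmod (h 1) \<le> real p * q ^ p * \<epsilon> + 2 * M / 2 ^ p"
proof -
  have \<epsilon>0: "0 \<le> \<epsilon>" using order_trans[OF norm_ge_zero \<epsilon>[of 0]] q by simp
  have c: "cmod (taylor_coeff h k * 1 ^ k) \<le> q ^ p * \<epsilon>" if "k < p" for k
  proof -
    have "cmod (taylor_coeff h k) \<le> \<epsilon> / (1 / q) ^ k"
      by (rule taylor_coeff_bound[OF h _ \<epsilon>]) (use q in auto)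
    also have "\<dots> = q ^ k * \<epsilon>" using q by (simp add: power_divide)
    also have "\<dots> \<le> q ^ p * \<epsilon>"
      using that q \<epsilon>0 by (intro mult_right_mono power_increasing) auto
    finally show ?thesis by simp
  qed
  have "cmod (\<Sum>k<p. taylor_coeff h k * 1 ^ k) \<le> real (card {..<p}) * (q ^ p * \<epsilon>)"
    using c by (intro sum_norm_bound) auto
  moreover have "cmod (h 1 - (\<Sum>k<p. taylor_coeff h k * 1 ^ k)) \<le> 2 * M * (cmod 1 / 2) ^ p"
    by (rule taylor_remainder_bound[OF h _ M]) auto
  ultimately show ?thesis
    using norm_triangle_ineq[of "h 1 - (\<Sum>k<p. taylor_coeff h k * 1 ^ k)" "\<Sum>k<p. taylor_coeff h k * 1 ^ k"]
    by (simp add: power_divide mult.assoc)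
qed

text \<open>If \<open>g\<close> is small on the small ball and grows at most by \<open>A\<^sup>\<mu>\<close> between two large balls, restrict it
  to the disc through \<open>w\<close> and a maximum point, and cut its Taylor series at order about \<open>\<mu> log A\<close>.\<close>

lemma admits_bernstein_imp_controls:
  fixes f :: "complex ^ 'n \<Rightarrow> complex ^ 'm"
  assumes f: "holomorphic_map_on f UNIV" and \<mu>: "\<And>k. 0 \<le> \<mu> k" and b: "admits_bernstein f \<mu>"
    and s: "0 < s"
  shows "controls f \<mu> (cball w s) (cball 0 R)"
proof -
  define R1 where "R1 = max R 1"
  define \<rho> where "\<rho> = norm w + R1"
  define q where "q = max 1 (\<rho> / s)"
  have R1: "1 \<le> R1" "R \<le> R1" by (auto simp: R1_def)
  then have R1p: "0 < R1" by linarith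
  have q: "1 \<le> q" "\<rho> \<le> q * s" using s by (auto simp: q_def field_simps max_def)
  obtain A where A: "1 \<le> A"
    "\<And>d g M z. g \<in> graph_funs f d \<Longrightarrow> (\<And>z. z \<in> cball 0 R1 \<Longrightarrow> cmod (g z) \<le> M) \<Longrightarrow>
       z \<in> cball 0 (2 * \<rho> + norm w) \<Longrightarrow> cmod (g z) \<le> A powr \<mu> d * M"
    using controlsE[OF admits_bernstein_imp_controls_origin[OF f \<mu> b R1p, of "2 * \<rho> + norm w"]]
    by blast
  obtain B where B: "1 \<le> B" "\<And>d. 1 \<le> d \<Longrightarrow> 2 \<le> B powr \<mu> d"
    using admits_bernstein_powr_ge_2[OF f \<mu> b] by blast
  obtain j where j: "2 * q < 2 ^ j" using real_arch_pow[of 2 "2 * q"] by auto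
  define C where "C = B * (B ^ 3 * A) ^ j"
  have C1: "1 \<le> C" unfolding C_def
    using mult_mono[of 1 B 1 "(B ^ 3 * A) ^ j"] mult_mono[of 1 "B ^ 3" 1 A] A(1) B(1) by simp
  have "cmod (g x) \<le> C powr \<mu> d * \<epsilon>"
    if g: "g \<in> graph_funs f d" and \<epsilon>: "\<forall>z\<in>cball w s. cmod (g z) \<le> \<epsilon>" and x: "x \<in> cball 0 R1" for d g \<epsilon> x
  proof (cases "d = 0")
    case True
    then have "g x = g w" using g graph_funs_0_const by blast
    then have "cmod (g x) \<le> \<epsilon>" using \<epsilon> s by simp
    moreover have "0 \<le> \<epsilon>" using calculation norm_ge_zero order_trans by blast
    moreover have "1 \<le> C powr \<mu> d" using C1 \<mu> by (simp add: ge_one_powr_ge_zero)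
    ultimately show ?thesis using mult_right_mono[of 1 "C powr \<mu> d" \<epsilon>] by simp
  next
    case False
    then have B2: "2 \<le> B powr \<mu> d" using B(2) by simp
    have \<epsilon>0: "0 \<le> \<epsilon>" using \<epsilon> s by (meson centre_in_cball less_imp_le norm_ge_zero order_trans)
    have ent: "entire g" by (rule graph_funs_entire[OF f g])
    obtain z0 where z0: "z0 \<in> cball 0 R1" "\<And>x. x \<in> cball 0 R1 \<Longrightarrow> cmod (g x) \<le> cmod (g z0)"
      using compact_attains_max_entire[OF ent compact_cball, of 0 R1] R1(1) by (auto simp: not_less)
    define N where "N = cmod (g z0)"
    define X where "X = A powr \<mu> d"
    have X1: "1 \<le> X" using A(1) \<mu> by (simp add: X_def ge_one_powr_ge_zero)
    define p where "p = (LEAST p. 4 * X \<le> 2 ^ p)"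
    obtain p0 where "4 * X < 2 ^ p0" using real_arch_pow[of 2 "4 * X"] by auto
    then have p: "4 * X \<le> 2 ^ p" unfolding p_def by (metis LeastI less_imp_le)
    have p0: "p \<noteq> 0" using p X1 by (intro notI) simp
    have "\<not> 4 * X \<le> 2 ^ (p - 1)"
      using not_less_Least[of "p - 1" "\<lambda>p. 4 * X \<le> 2 ^ p"] p0 unfolding p_def[symmetric] by simp
    then have p8: "2 ^ p \<le> 8 * X" using p0 by (cases p) auto
    define h where "h = (\<lambda>\<zeta>. g (w + \<zeta> *s (z0 - w)))"
    have h: "h holomorphic_on UNIV" unfolding h_def by (rule entire_line[OF ent])
    have b\<rho>: "norm (z0 - w) \<le> \<rho>"
      unfolding \<rho>_def using z0(1) norm_triangle_ineq4[of z0 w] by simp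
    have nb: "norm (\<zeta> *s (z0 - w)) \<le> cmod \<zeta> * \<rho>" for \<zeta>
      unfolding norm_vector_scalar_mult using b\<rho> by (simp add: mult_left_mono)
    have "cmod (h 1) \<le> real p * q ^ p * \<epsilon> + 2 * (X * N) / 2 ^ p"
    proof (rule two_constants_disc[OF h q(1)])
      fix \<zeta> :: complex assume "cmod \<zeta> \<le> 1 / q"
      then have "cmod \<zeta> * \<rho> \<le> 1 / q * (q * s)" using q s by (intro mult_mono') (auto simp: \<rho>_def R1_def)
      then have "norm (\<zeta> *s (z0 - w)) \<le> s" using nb[of \<zeta>] q(1) by simp
      then have "w + \<zeta> *s (z0 - w) \<in> cball w s" unfolding mem_cball dist_add .
      then show "cmod (h \<zeta>) \<le> \<epsilon>" unfolding h_def using \<epsilon> by blast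
    next
      fix \<zeta> :: complex assume "cmod \<zeta> \<le> 2"
      then have "cmod \<zeta> * \<rho> \<le> 2 * \<rho>" by (intro mult_right_mono) (auto simp: \<rho>_def R1_def)
      then have "norm (w + \<zeta> *s (z0 - w)) \<le> 2 * \<rho> + norm w"
        using nb[of \<zeta>] norm_triangle_ineq[of w "\<zeta> *s (z0 - w)"] by simp
      then show "cmod (h \<zeta>) \<le> X * N" unfolding h_def X_def N_def by (intro A(2)[OF g z0(2)]) (auto simp only: mem_cball_0)
    qed
    moreover have "h 1 = g z0" unfolding h_def by (simp add: vec_eq_iff)
    moreover have "2 * (X * N) / 2 ^ p \<le> N / 2"
    proof -
      have "4 * X * N \<le> 2 ^ p * N" using p by (rule mult_right_mono) (simp add: N_def)
      then show ?thesis by (simp add: field_simps)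
    qed
    ultimately have "N \<le> real p * q ^ p * \<epsilon> + N / 2" unfolding N_def by simp
    then have "N \<le> 2 * (real p * q ^ p) * \<epsilon>" by linarith
    also have "\<dots> \<le> (2 * ((2 * q) ^ p)) * \<epsilon>"
    proof -
      have "real p \<le> 2 ^ p" using of_nat_less_two_power[of p] by (simp add: less_imp_le)
      then have "real p * q ^ p \<le> 2 ^ p * q ^ p" by (rule mult_right_mono) (use q in auto)
      then show ?thesis using \<epsilon>0 by (intro mult_right_mono) (auto simp: power_mult_distrib)
    qed
    also have "\<dots> \<le> C powr \<mu> d * \<epsilon>"
    proof (rule mult_right_mono[OF _ \<epsilon>0])
      have "(2 * q) ^ p \<le> (2 ^ j) ^ p" using j q by (intro power_mono) auto
      also have "\<dots> = (2 ^ p) ^ j" by (simp add: power_mult[symmetric] mult.commute)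
      also have "\<dots> \<le> (8 * X) ^ j" using p8 by (intro power_mono) auto
      also have "\<dots> \<le> ((B powr \<mu> d) ^ 3 * X) ^ j"
        using X1 power_mono[OF B2, of 3] by (intro power_mono mult_right_mono) auto
      also have "\<dots> = ((B ^ 3 * A) ^ j) powr \<mu> d"
        using A(1) B(1) unfolding X_def by (simp add: power_powr powr_mult)
      finally have "2 * (2 * q) ^ p \<le> B powr \<mu> d * ((B ^ 3 * A) ^ j) powr \<mu> d"
        using B2 q by (intro mult_mono) auto
      also have "\<dots> = C powr \<mu> d" unfolding C_def using A(1) B(1) by (simp add: powr_mult)
      finally show "2 * (2 * q) ^ p \<le> C powr \<mu> d" .
    qed
    finally show ?thesis using z0(2)[OF x] unfolding N_def by linarith
  qed
  then have "controls f \<mu> (cball w s) (cball 0 R1)"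
    unfolding controls_def using C1 by blast
  then show ?thesis by (rule controls_mono) (use R1 in auto)
qed

lemma controls_min:
  assumes K: "K \<noteq> {}" and 1: "controls f \<mu>1 K L" and 2: "controls f \<mu>2 K L"
    and \<mu>: "\<And>k. 0 \<le> \<mu>1 k" "\<And>k. 0 \<le> \<mu>2 k" "\<And>k. min (\<mu>1 k) (\<mu>2 k) \<le> \<mu> k"
  shows "controls f \<mu> K L"
proof -
  obtain C where C: "1 \<le> C"
    "\<And>d g M z. g \<in> graph_funs f d \<Longrightarrow> (\<And>z. z \<in> K \<Longrightarrow> cmod (g z) \<le> M) \<Longrightarrow> z \<in> L \<Longrightarrow>
       cmod (g z) \<le> C powr \<mu>1 d * M"
    using controlsE[OF 1] by blast
  obtain D where D: "1 \<le> D"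
    "\<And>d g M z. g \<in> graph_funs f d \<Longrightarrow> (\<And>z. z \<in> K \<Longrightarrow> cmod (g z) \<le> M) \<Longrightarrow> z \<in> L \<Longrightarrow>
       cmod (g z) \<le> D powr \<mu>2 d * M"
    using controlsE[OF 2] by blast
  have mono: "a powr \<nu> \<le> max C D powr \<mu> d" if "1 \<le> a" "a \<le> max C D" "0 \<le> \<nu>" "\<nu> \<le> \<mu> d" for a \<nu> d
  proof -
    have "a powr \<nu> \<le> max C D powr \<nu>" using that by (intro powr_mono2) auto
    also have "\<dots> \<le> max C D powr \<mu> d" using that by (intro powr_mono) auto
    finally show ?thesis .
  qed
  have "cmod (g z) \<le> max C D powr \<mu> d * M"
    if g: "g \<in> graph_funs f d" and M: "\<forall>z\<in>K. cmod (g z) \<le> M" and z: "z \<in> L" for d g M z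
  proof -
    have M0: "0 \<le> M" using K M by (meson all_not_in_conv norm_ge_zero order_trans)
    show ?thesis
    proof (cases "\<mu>1 d \<le> \<mu> d")
      case True
      then have "C powr \<mu>1 d * M \<le> max C D powr \<mu> d * M"
        using C(1) \<mu> M0 by (intro mult_right_mono mono) auto
      then show ?thesis using C(2)[OF g _ z] M by fastforce
    next
      case False
      then have "\<mu>2 d \<le> \<mu> d" using \<mu>(3)[of d] by (auto simp: min_def split: if_splits)
      then have "D powr \<mu>2 d * M \<le> max C D powr \<mu> d * M"
        using D(1) \<mu> M0 by (intro mult_right_mono mono) auto
      then show ?thesis using D(2)[OF g _ z] M by fastforce
    qed
  qed
  then show ?thesis
    unfolding controls_def using C(1) by (intro exI[of _ "max C D"]) auto
qed

lemma holomorphic_map_on_translate: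
  fixes f :: "complex ^ 'n \<Rightarrow> complex ^ 'm"
  assumes "holomorphic_map_on f UNIV" shows "holomorphic_map_on (\<lambda>z. f (z + w)) UNIV"
  unfolding holomorphic_map_on_def
proof
  fix z
  obtain D where D: "(f has_derivative D) (at (z + w))" "\<forall>c v. D (c *s v) = c *s D v"
    using assms unfolding holomorphic_map_on_def by blast
  have "((\<lambda>z. z + w) has_derivative (\<lambda>x. x)) (at z)"
    by (auto intro!: derivative_eq_intros)
  from diff_chain_at[OF this D(1)] have "((\<lambda>z. f (z + w)) has_derivative D) (at z)"
    by (simp add: o_def)
  then show "\<exists>D. ((\<lambda>z. f (z + w)) has_derivative D) (at z) \<and> (\<forall>c v. D (c *s v) = c *s D v)"
    using D(2) by blast
qed

lemma graph_funs_translate: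
  fixes f :: "complex ^ 'n \<Rightarrow> complex ^ 'm"
  assumes "g \<in> graph_funs (\<lambda>z. f (z + w)) d" shows "(\<lambda>z. g (z - w)) \<in> graph_funs f d"
proof -
  obtain \<phi> where \<phi>: "polyfun d \<phi>" "\<And>z. g z = \<phi> (vec_pair z (f (z + w)))"
    using graph_funsE[OF assms] by blast
  have "polyfun d (\<lambda>x. \<phi> (vec_pair (vec_fst x - w) (vec_snd x)))"
    by (rule polyfun_compose[OF \<phi>(1)])
      (intro polyfun_vec_pair; simp add: polyfun_coord polyfun_const polyfun_diff)
  then show ?thesis by (rule graph_funsI) (simp add: \<phi>(2))
qed

lemma admits_bernstein_translate:
  fixes f :: "complex ^ 'n \<Rightarrow> complex ^ 'm"
  assumes f: "holomorphic_map_on f UNIV" and \<mu>: "\<And>k. 0 \<le> \<mu> k" and b: "admits_bernstein f \<mu>"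
  shows "admits_bernstein (\<lambda>z. f (z + w)) \<mu>"
  unfolding admits_bernstein_iff_controls[OF holomorphic_map_on_translate[OF f] \<mu>]
proof (intro allI impI)
  fix r :: real assume r: "0 < r"
  obtain C where C: "1 \<le> C"
    "\<And>d g M z. g \<in> graph_funs f d \<Longrightarrow> (\<And>z. z \<in> cball w r \<Longrightarrow> cmod (g z) \<le> M) \<Longrightarrow>
       z \<in> cball 0 (exp 1 * r + norm w) \<Longrightarrow> cmod (g z) \<le> C powr \<mu> d * M"
    using controlsE[OF admits_bernstein_imp_controls[OF f \<mu> b r]] by blast
  show "controls (\<lambda>z. f (z + w)) \<mu> (cball 0 r) (cball 0 (exp 1 * r))"
    unfolding controls_def
  proof (intro exI[of _ C] conjI C(1) allI ballI impI)
    fix d g M and z :: "complex ^ 'n"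
    assume g: "g \<in> graph_funs (\<lambda>z. f (z + w)) d" and M: "\<forall>z\<in>cball 0 r. cmod (g z) \<le> M"
      and z: "z \<in> cball 0 (exp 1 * r)"
    have "cmod (g (z + w - w)) \<le> C powr \<mu> d * M"
    proof (rule C(2)[OF graph_funs_translate[OF g]])
      show "cmod (g (x - w)) \<le> M" if "x \<in> cball w r" for x
        using that M by (simp add: dist_norm norm_minus_commute)
      show "z + w \<in> cball 0 (exp 1 * r + norm w)"
        using z norm_triangle_ineq[of z w] by simp
    qed
    then show "cmod (g z) \<le> C powr \<mu> d * M" by simp
  qed
qed

lemma norm_vec_pair:
  fixes z :: "complex ^ 'n" and w :: "complex ^ 'm"
  shows "(norm (vec_pair z w))\<^sup>2 = (norm z)\<^sup>2 + (norm w)\<^sup>2"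
proof -
  have sq: "(norm x)\<^sup>2 = (\<Sum>k\<in>UNIV. (cmod (x $ k))\<^sup>2)" for x :: "complex ^ 'x::finite"
    by (simp add: norm_vec_def L2_set_def sum_nonneg)
  show ?thesis
    unfolding sq UNIV_Plus_UNIV[symmetric] by (subst sum.Plus) auto
qed

lemma norm_vec_fst_le: "norm (vec_fst x) \<le> norm x" for x :: "complex ^ ('n::finite + 'm::finite)"
  by (rule power2_le_imp_le) (use norm_vec_pair[of "vec_fst x" "vec_snd x"] in simp_all)

lemma norm_vec_snd_le: "norm (vec_snd x) \<le> norm x" for x :: "complex ^ ('n::finite + 'm::finite)"
  by (rule power2_le_imp_le) (use norm_vec_pair[of "vec_fst x" "vec_snd x"] in simp_all)

lemma norm_vec_pair_le: "norm (vec_pair z w) \<le> norm z + norm w"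
  for z :: "complex ^ 'n" and w :: "complex ^ 'm"
  by (rule power2_le_imp_le) (simp_all add: norm_vec_pair power2_sum)

lemma bounded_linear_vec_pair_maps:
  shows "bounded_linear (\<lambda>z :: complex ^ 'n. vec_pair z (0 :: complex ^ 'm))"
    "bounded_linear (\<lambda>w :: complex ^ 'm. vec_pair (0 :: complex ^ 'n) w)"
    "bounded_linear (vec_fst :: complex ^ ('n::finite + 'm::finite) \<Rightarrow> complex ^ 'n)"
    "bounded_linear (vec_snd :: complex ^ ('n::finite + 'm::finite) \<Rightarrow> complex ^ 'm)"
  unfolding linear_conv_bounded_linear[symmetric]
  by (rule linearI; auto simp: vec_eq_iff vec_pair_def split: sum.split)+

lemma holomorphic_map_on_prod_map:
  fixes f1 :: "complex ^ 'n1 \<Rightarrow> complex ^ 'm1" and f2 :: "complex ^ 'n2 \<Rightarrow> complex ^ 'm2"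
  assumes f1: "holomorphic_map_on f1 UNIV" and f2: "holomorphic_map_on f2 UNIV"
  shows "holomorphic_map_on (prod_map f1 f2) UNIV"
  unfolding holomorphic_map_on_def
proof
  fix z :: "complex ^ ('n1 + 'n2)"
  obtain D where D: "(f1 has_derivative D) (at (vec_fst z))" "\<And>c v. D (c *s v) = c *s D v"
    using f1 unfolding holomorphic_map_on_def by blast
  obtain E where E: "(f2 has_derivative E) (at (vec_snd z))" "\<And>c v. E (c *s v) = c *s E v"
    using f2 unfolding holomorphic_map_on_def by blast
  have eq: "prod_map F G = (\<lambda>z. vec_pair (F (vec_fst z)) 0 + vec_pair 0 (G (vec_snd z)))"
    for F :: "complex ^ 'n1 \<Rightarrow> complex ^ 'm1" and G :: "complex ^ 'n2 \<Rightarrow> complex ^ 'm2"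
    by (auto simp: fun_eq_iff prod_map_def vec_eq_iff vec_pair_def split: sum.split)
  note bl = bounded_linear_imp_has_derivative[OF bounded_linear_vec_pair_maps(3)]
    bounded_linear_imp_has_derivative[OF bounded_linear_vec_pair_maps(4)]
  have "(prod_map f1 f2 has_derivative prod_map D E) (at z)"
    unfolding eq
    by (intro has_derivative_add bounded_linear.has_derivative[OF bounded_linear_vec_pair_maps(1)]
        bounded_linear.has_derivative[OF bounded_linear_vec_pair_maps(2)]
        has_derivative_compose[OF bl(1) D(1)] has_derivative_compose[OF bl(2) E(1)])
  moreover have "prod_map D E (c *s v) = c *s prod_map D E v" for c and v :: "complex ^ ('n1 + 'n2)"
  proof -
    have "vec_fst (c *s v) = c *s vec_fst v" "vec_snd (c *s v) = c *s vec_snd v"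
      by (simp_all add: vec_eq_iff)
    then show ?thesis
      by (simp add: prod_map_def D(2) E(2)) (auto simp: vec_eq_iff vec_pair_def split: sum.split)
  qed
  ultimately show "\<exists>D. (prod_map f1 f2 has_derivative D) (at z) \<and> (\<forall>c v. D (c *s v) = c *s D v)"
    by blast
qed

lemma graph_funs_prod_map_slice:
  fixes f1 :: "complex ^ 'n1 \<Rightarrow> complex ^ 'm1" and f2 :: "complex ^ 'n2 \<Rightarrow> complex ^ 'm2"
  assumes "g \<in> graph_funs (prod_map f1 f2) d"
  shows "(\<lambda>z1. g (vec_pair z1 z2)) \<in> graph_funs f1 d" "(\<lambda>z2. g (vec_pair z1 z2)) \<in> graph_funs f2 d"
proof -
  obtain \<phi> where \<phi>: "polyfun d \<phi>" "\<And>z. g z = \<phi> (vec_pair z (prod_map f1 f2 z))"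
    using graph_funsE[OF assms] by blast
  have "polyfun d (\<lambda>x. \<phi> (vec_pair (vec_pair (vec_fst x) z2) (vec_pair (vec_snd x) (f2 z2))))"
    by (rule polyfun_compose[OF \<phi>(1)]) (intro polyfun_vec_pair; simp add: polyfun_coord polyfun_const)
  then show "(\<lambda>z1. g (vec_pair z1 z2)) \<in> graph_funs f1 d"
    by (rule graph_funsI) (simp add: \<phi>(2) prod_map_def)
  have "polyfun d (\<lambda>x. \<phi> (vec_pair (vec_pair z1 (vec_fst x)) (vec_pair (f1 z1) (vec_snd x))))"
    by (rule polyfun_compose[OF \<phi>(1)]) (intro polyfun_vec_pair; simp add: polyfun_coord polyfun_const)
  then show "(\<lambda>z2. g (vec_pair z1 z2)) \<in> graph_funs f2 d"
    by (rule graph_funsI) (simp add: \<phi>(2) prod_map_def)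
qed

lemma graph_funs_prod_map_lift:
  fixes f1 :: "complex ^ 'n1 \<Rightarrow> complex ^ 'm1" and f2 :: "complex ^ 'n2 \<Rightarrow> complex ^ 'm2"
  shows "g1 \<in> graph_funs f1 d \<Longrightarrow> (\<lambda>z. g1 (vec_fst z)) \<in> graph_funs (prod_map f1 f2) d"
    and "g2 \<in> graph_funs f2 d \<Longrightarrow> (\<lambda>z. g2 (vec_snd z)) \<in> graph_funs (prod_map f1 f2) d"
proof -
  assume "g1 \<in> graph_funs f1 d"
  then obtain \<phi> where \<phi>: "polyfun d \<phi>" "\<And>z. g1 z = \<phi> (vec_pair z (f1 z))"
    using graph_funsE by blast
  have "polyfun d (\<lambda>x. \<phi> (vec_pair (vec_fst (vec_fst x)) (vec_fst (vec_snd x))))"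
    by (rule polyfun_compose[OF \<phi>(1)]) (intro polyfun_vec_pair; simp add: polyfun_coord)
  then show "(\<lambda>z. g1 (vec_fst z)) \<in> graph_funs (prod_map f1 f2) d"
    by (rule graph_funsI) (simp add: \<phi>(2) prod_map_def)
next
  assume "g2 \<in> graph_funs f2 d"
  then obtain \<phi> where \<phi>: "polyfun d \<phi>" "\<And>z. g2 z = \<phi> (vec_pair z (f2 z))"
    using graph_funsE by blast
  have "polyfun d (\<lambda>x. \<phi> (vec_pair (vec_snd (vec_fst x)) (vec_snd (vec_snd x))))"
    by (rule polyfun_compose[OF \<phi>(1)]) (intro polyfun_vec_pair; simp add: polyfun_coord)
  then show "(\<lambda>z. g2 (vec_snd z)) \<in> graph_funs (prod_map f1 f2) d"
    by (rule graph_funsI) (simp add: \<phi>(2) prod_map_def)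
qed

lemma admits_bernstein_prod_map:
  fixes f1 :: "complex ^ 'n1 \<Rightarrow> complex ^ 'm1" and f2 :: "complex ^ 'n2 \<Rightarrow> complex ^ 'm2"
  assumes f1: "holomorphic_map_on f1 UNIV" and f2: "holomorphic_map_on f2 UNIV"
    and \<mu>: "\<And>k. 0 \<le> \<mu>1 k" "\<And>k. 0 \<le> \<mu>2 k"
    and b: "admits_bernstein f1 \<mu>1" "admits_bernstein f2 \<mu>2"
  shows "admits_bernstein (prod_map f1 f2) (\<lambda>k. max (\<mu>1 k) (\<mu>2 k))"
proof -
  have "controls (prod_map f1 f2) (\<lambda>k. max (\<mu>1 k) (\<mu>2 k)) (cball 0 r) (cball 0 R)" if r: "0 < r" for r R
  proof -
    obtain C where C: "1 \<le> C"
      "\<And>d g M z. g \<in> graph_funs f1 d \<Longrightarrow> (\<And>z. z \<in> cball 0 (r / 2) \<Longrightarrow> cmod (g z) \<le> M) \<Longrightarrow>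
         z \<in> cball 0 R \<Longrightarrow> cmod (g z) \<le> C powr \<mu>1 d * M"
      using controlsE[OF admits_bernstein_imp_controls[OF f1 \<mu>(1) b(1) half_gt_zero[OF r]]] by blast
    obtain D where D: "1 \<le> D"
      "\<And>d g M z. g \<in> graph_funs f2 d \<Longrightarrow> (\<And>z. z \<in> cball 0 (r / 2) \<Longrightarrow> cmod (g z) \<le> M) \<Longrightarrow>
         z \<in> cball 0 R \<Longrightarrow> cmod (g z) \<le> D powr \<mu>2 d * M"
      using controlsE[OF admits_bernstein_imp_controls[OF f2 \<mu>(2) b(2) half_gt_zero[OF r]]] by blast
    have "cmod (g z) \<le> (D * C) powr max (\<mu>1 d) (\<mu>2 d) * M"
      if g: "g \<in> graph_funs (prod_map f1 f2) d" and M: "\<forall>z\<in>cball 0 r. cmod (g z) \<le> M"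
        and z: "z \<in> cball 0 R" for d g M z
    proof -
      have M0: "0 \<le> M" using M r by (meson centre_in_cball less_imp_le norm_ge_zero order_trans)
      have 1: "cmod (g (vec_pair z1 z2)) \<le> M" if "z1 \<in> cball 0 (r/2)" "z2 \<in> cball 0 (r/2)" for z1 z2
        using that M norm_vec_pair_le[of z1 z2] by auto
      have 2: "cmod (g (vec_pair z1 z2)) \<le> C powr \<mu>1 d * M" if "z1 \<in> cball 0 R" "z2 \<in> cball 0 (r/2)" for z1 z2
        by (rule C(2)[OF graph_funs_prod_map_slice(1)[OF g] _ that(1)]) (rule 1[OF _ that(2)])
      have 3: "cmod (g (vec_pair z1 z2)) \<le> D powr \<mu>2 d * (C powr \<mu>1 d * M)" if "z1 \<in> cball 0 R" "z2 \<in> cball 0 R" for z1 z2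
        by (rule D(2)[OF graph_funs_prod_map_slice(2)[OF g] _ that(2)]) (rule 2[OF that(1)])
      have "cmod (g z) \<le> D powr \<mu>2 d * (C powr \<mu>1 d * M)"
        using 3[of "vec_fst z" "vec_snd z"] z norm_vec_fst_le[of z] norm_vec_snd_le[of z] by simp
      also have "\<dots> \<le> D powr max (\<mu>1 d) (\<mu>2 d) * (C powr max (\<mu>1 d) (\<mu>2 d) * M)"
        using C(1) D(1) M0 by (intro mult_mono powr_mono) auto
      finally show ?thesis using C(1) D(1) by (simp add: powr_mult)
    qed
    moreover have "1 \<le> D * C" using C(1) D(1) mult_mono[of 1 D 1 C] by simp
    ultimately show ?thesis unfolding controls_def by blast
  qed
  then show ?thesis
    using \<mu> by (subst admits_bernstein_iff_controls[OF holomorphic_map_on_prod_map[OF f1 f2]])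
      (auto simp: max_def)
qed

lemma admits_bernstein_prod_map_factors:
  fixes f1 :: "complex ^ 'n1 \<Rightarrow> complex ^ 'm1" and f2 :: "complex ^ 'n2 \<Rightarrow> complex ^ 'm2"
  assumes f1: "holomorphic_map_on f1 UNIV" and f2: "holomorphic_map_on f2 UNIV"
    and \<mu>: "\<And>k. 0 \<le> \<mu> k" and b: "admits_bernstein (prod_map f1 f2) \<mu>"
  shows "admits_bernstein f1 \<mu>" "admits_bernstein f2 \<mu>"
proof -
  have c: "controls (prod_map f1 f2) \<mu> (cball 0 r) (cball 0 (exp 1 * r))" if "0 < r" for r
    using b that unfolding admits_bernstein_iff_controls[OF holomorphic_map_on_prod_map[OF f1 f2] \<mu>] by blast
  have fst_le: "norm (vec_fst z) \<le> r" and snd_le: "norm (vec_snd z) \<le> r" if "norm z \<le> r" for z :: "complex ^ ('n1 + 'n2)" and r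
    using norm_vec_fst_le[of z] norm_vec_snd_le[of z] that by auto
  have nz: "norm (vec_pair z 0 :: complex ^ ('n1 + 'n2)) \<le> norm z" "norm (vec_pair 0 z' :: complex ^ ('n1 + 'n2)) \<le> norm z'" 
    for z :: "complex ^ 'n1" and z' :: "complex ^ 'n2"
    using norm_vec_pair_le[of z 0] norm_vec_pair_le[of 0 z'] by auto
  have "controls f1 \<mu> (cball 0 r) (cball 0 (exp 1 * r))" if r: "0 < r" for r
  proof -
    obtain C where C: "1 \<le> C"
      "\<And>d g M z. g \<in> graph_funs (prod_map f1 f2) d \<Longrightarrow> (\<And>z. z \<in> cball 0 r \<Longrightarrow> cmod (g z) \<le> M) \<Longrightarrow>
         z \<in> cball 0 (exp 1 * r) \<Longrightarrow> cmod (g z) \<le> C powr \<mu> d * M"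
      using controlsE[OF c[OF r]] by blast
    have "cmod (g z) \<le> C powr \<mu> d * M"
      if "g \<in> graph_funs f1 d" "\<forall>z\<in>cball 0 r. cmod (g z) \<le> M" "z \<in> cball 0 (exp 1 * r)" for g d M z
    proof -
      have "cmod (g (vec_fst (vec_pair z 0 :: complex ^ ('n1 + 'n2)))) \<le> C powr \<mu> d * M"
        by (rule C(2)[OF graph_funs_prod_map_lift(1)[OF that(1)]])
          (use that(2,3) fst_le order_trans[OF nz(1)[of z]] in simp_all)
      then show ?thesis by simp
    qed
    then show ?thesis unfolding controls_def using C(1) by blast
  qed
  then show "admits_bernstein f1 \<mu>" by (simp add: admits_bernstein_iff_controls[OF f1 \<mu>])
  have "controls f2 \<mu> (cball 0 r) (cball 0 (exp 1 * r))" if r: "0 < r" for r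
  proof -
    obtain C where C: "1 \<le> C"
      "\<And>d g M z. g \<in> graph_funs (prod_map f1 f2) d \<Longrightarrow> (\<And>z. z \<in> cball 0 r \<Longrightarrow> cmod (g z) \<le> M) \<Longrightarrow>
         z \<in> cball 0 (exp 1 * r) \<Longrightarrow> cmod (g z) \<le> C powr \<mu> d * M"
      using controlsE[OF c[OF r]] by blast
    have "cmod (g z) \<le> C powr \<mu> d * M"
      if "g \<in> graph_funs f2 d" "\<forall>z\<in>cball 0 r. cmod (g z) \<le> M" "z \<in> cball 0 (exp 1 * r)" for g d M z
    proof -
      have "cmod (g (vec_snd (vec_pair 0 z :: complex ^ ('n1 + 'n2)))) \<le> C powr \<mu> d * M"
        by (rule C(2)[OF graph_funs_prod_map_lift(2)[OF that(1)]])
          (use that(2,3) snd_le order_trans[OF nz(2)[of z]] in simp_all)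
      then show ?thesis by simp
    qed
    then show ?thesis unfolding controls_def using C(1) by blast
  qed
  then show "admits_bernstein f2 \<mu>" by (simp add: admits_bernstein_iff_controls[OF f2 \<mu>])
qed

section \<open>Existence of an exponent\<close>

text \<open>Point evaluations separate the span of finitely many entire functions already on a small ball,
  so every function in the span is a Lagrange-type combination of its values there. The Lagrange
  functions \<open>L k\<close> are built by Gauss elimination, one new node per function.\<close>

lemma finite_family_interpolation:
  fixes \<phi> :: "'i \<Rightarrow> complex ^ 'n \<Rightarrow> complex"
  assumes I: "finite I" and \<phi>: "\<And>i. i \<in> I \<Longrightarrow> entire (\<phi> i)" and e: "0 < e"
  shows "\<exists>x L. (\<forall>k\<in>I. x k \<in> ball w e \<and> entire (L k)) \<and> (\<forall>i\<in>I. \<forall>z. \<phi> i z = (\<Sum>k\<in>I. \<phi> i (x k) * L k z))"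
  using I \<phi>
proof (induction I)
  case (insert j I)
  then obtain x L where x: "\<And>k. k \<in> I \<Longrightarrow> x k \<in> ball w e" and L: "\<And>k. k \<in> I \<Longrightarrow> entire (L k)"
    and rep: "\<And>i z. i \<in> I \<Longrightarrow> \<phi> i z = (\<Sum>k\<in>I. \<phi> i (x k) * L k z)" by (metis insertCI)
  define \<psi> where "\<psi> = (\<lambda>z. \<phi> j z - (\<Sum>k\<in>I. \<phi> j (x k) * L k z))"
  have \<psi>: "entire \<psi>" unfolding \<psi>_def
    using insert.prems L by (intro entire_diff entire_sum entire_mult entire_const) auto
  obtain y \<eta> where y: "y \<in> ball w e" and \<eta>: "\<And>z. \<psi> z = \<psi> y * \<eta> z" "entire \<eta>" "\<eta> = (\<lambda>_. 0) \<or> \<psi> y \<noteq> 0"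
  proof (cases "\<forall>z\<in>ball w e. \<psi> z = 0")
    case True
    then have "\<psi> z = 0" for z using entire_zero_on_ball[OF \<psi> e] by blast
    then show thesis using e by (intro that[of w "\<lambda>_. 0"]) (auto intro: entire_const)
  next
    case False
    then obtain y where "y \<in> ball w e" "\<psi> y \<noteq> 0" by blast
    then show thesis
      using entire_mult[OF entire_const[of "1 / \<psi> y"] \<psi>] by (intro that[of y "\<lambda>z. 1 / \<psi> y * \<psi> z"]) auto
  qed
  define L' where "L' = (\<lambda>k z. if k = j then \<eta> z else L k z - L k y * \<eta> z)"
  define x' where "x' = x(j := y)"
  have sum_eq: "(\<Sum>k\<in>insert j I. \<phi> i (x' k) * L' k z) =
      (\<Sum>k\<in>I. \<phi> i (x k) * L k z) + (\<phi> i y - (\<Sum>k\<in>I. \<phi> i (x k) * L k y)) * \<eta> z" for i z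
  proof -
    have "(\<Sum>k\<in>insert j I. \<phi> i (x' k) * L' k z) = \<phi> i y * \<eta> z + (\<Sum>k\<in>I. \<phi> i (x' k) * L' k z)"
      using insert.hyps by (simp add: x'_def L'_def)
    also have "(\<Sum>k\<in>I. \<phi> i (x' k) * L' k z) = (\<Sum>k\<in>I. \<phi> i (x k) * L k z - \<phi> i (x k) * L k y * \<eta> z)"
      using insert.hyps by (intro sum.cong) (auto simp: x'_def L'_def algebra_simps)
    finally show ?thesis by (simp add: sum_subtractf sum_distrib_right[symmetric] left_diff_distrib)
  qed
  have "\<phi> i z = (\<Sum>k\<in>insert j I. \<phi> i (x' k) * L' k z)" if "i \<in> insert j I" for i z
  proof (cases "i = j")
    case True
    show ?thesis unfolding sum_eq True using \<eta>(1)[of z] by (simp add: \<psi>_def diff_eq_eq add.commute)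
  next
    case False
    then have "i \<in> I" using that by simp
    then show ?thesis unfolding sum_eq using rep[of i z] rep[of i y] by simp
  qed
  moreover have "x' k \<in> ball w e \<and> entire (L' k)" if "k \<in> insert j I" for k
    using that x L y \<eta>(2) insert.hyps
    by (cases "k = j") (auto simp: x'_def L'_def intro!: entire_diff entire_mult entire_const)
  ultimately show ?case by blast
qed auto

lemma graph_funs_ball_comparison:
  fixes f :: "complex ^ 'n \<Rightarrow> complex ^ 'm"
  assumes f: "holomorphic_map_on f UNIV" and r: "0 < r"
  shows "\<exists>A\<ge>1. \<forall>g\<in>graph_funs f d. \<forall>M. (\<forall>z\<in>cball 0 r. cmod (g z) \<le> M) \<longrightarrow> (\<forall>z\<in>cball 0 R. cmod (g z) \<le> A * M)"
proof -
  let ?I = "{\<alpha> :: ('n + 'm) \<Rightarrow>\<^sub>0 nat. mon_degree \<alpha> \<le> d}"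
  let ?\<phi> = "\<lambda>\<alpha> z. mon_eval \<alpha> (vec_pair z (f z))"
  have I: "finite ?I" by (rule finite_mon_degree_le)
  have "entire (?\<phi> \<alpha>)" for \<alpha>
    by (intro entire_prod entire_power entire_vec_pair entire_coord entire_of_holomorphic_map[OF f])
  then have "\<exists>x L. (\<forall>k\<in>?I. x k \<in> ball 0 r \<and> entire (L k)) \<and> (\<forall>i\<in>?I. \<forall>z. ?\<phi> i z = (\<Sum>k\<in>?I. ?\<phi> i (x k) * L k z))"
    by (intro finite_family_interpolation[OF I _ r])
  then obtain x L where x: "\<And>k. k \<in> ?I \<Longrightarrow> x k \<in> ball 0 r" and L: "\<And>k. k \<in> ?I \<Longrightarrow> entire (L k)"
    and rep: "\<And>i z. i \<in> ?I \<Longrightarrow> ?\<phi> i z = (\<Sum>k\<in>?I. ?\<phi> i (x k) * L k z)" by blast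
  have "\<exists>b\<ge>0. \<forall>z\<in>cball 0 R. cmod (L k z) \<le> b" if "k \<in> ?I" for k
    using compact_bounded_entire[OF L[OF that] compact_cball] by metis
  then obtain b where b: "\<And>k. k \<in> ?I \<Longrightarrow> 0 \<le> b k" "\<And>k z. k \<in> ?I \<Longrightarrow> z \<in> cball 0 R \<Longrightarrow> cmod (L k z) \<le> b k"
    by metis
  define A where "A = 1 + (\<Sum>k\<in>?I. b k)"
  have "cmod (g z) \<le> A * M"
    if g: "g \<in> graph_funs f d" and M: "\<forall>z\<in>cball 0 r. cmod (g z) \<le> M" and z: "z \<in> cball 0 R" for g M z
  proof -
    have M0: "0 \<le> M" using M r by (meson centre_in_cball less_imp_le norm_ge_zero order_trans)
    obtain \<phi> where \<phi>: "polyfun d \<phi>" "\<And>z. g z = \<phi> (vec_pair z (f z))"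
      using graph_funsE[OF g] by blast
    obtain c where c: "\<And>x. \<phi> x = (\<Sum>\<alpha>\<in>?I. c \<alpha> * mon_eval \<alpha> x)"
      using polyfun_representation[OF \<phi>(1)] by blast
    have gz: "g z = (\<Sum>\<alpha>\<in>?I. c \<alpha> * ?\<phi> \<alpha> z)" for z unfolding \<phi>(2) c ..
    have "g z = (\<Sum>\<alpha>\<in>?I. c \<alpha> * (\<Sum>k\<in>?I. ?\<phi> \<alpha> (x k) * L k z))"
      unfolding gz using rep by (intro sum.cong refl) simp
    also have "\<dots> = (\<Sum>k\<in>?I. g (x k) * L k z)"
      unfolding gz sum_distrib_left sum_distrib_right by (subst sum.swap) (simp add: mult.assoc)
    also have "cmod \<dots> \<le> (\<Sum>k\<in>?I. M * b k)"
    proof (rule sum_norm_le)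
      fix k assume k: "k \<in> ?I"
      then have "x k \<in> cball 0 r" using x ball_subset_cball by blast
      then show "cmod (g (x k) * L k z) \<le> M * b k"
        unfolding norm_mult using M0 M b[OF k] z by (intro mult_mono) auto
    qed
    also have "\<dots> \<le> A * M"
      unfolding A_def using M0 by (simp add: sum_distrib_left[symmetric] algebra_simps)
    finally show ?thesis .
  qed
  moreover have "1 \<le> A" unfolding A_def using sum_nonneg[of ?I b, OF b(1)] by simp
  ultimately show ?thesis by blast
qed

lemma exists_admissible_exponent:
  fixes f :: "complex ^ 'n \<Rightarrow> complex ^ 'm"
  assumes f: "holomorphic_map_on f UNIV"
  shows "\<exists>\<mu>. (\<forall>k. 0 \<le> \<mu> k) \<and> admits_bernstein f \<mu>"
proof -
  have "\<forall>d N. \<exists>A\<ge>1. \<forall>g\<in>graph_funs f d. \<forall>M. (\<forall>z\<in>cball 0 (1 / (real N + 1)). cmod (g z) \<le> M) \<longrightarrow>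
      (\<forall>z\<in>cball 0 (real N). cmod (g z) \<le> A * M)"
    using graph_funs_ball_comparison[OF f] by simp
  then obtain A where A1: "\<And>d N. 1 \<le> A d N"
    and A: "\<And>d N g M z. g \<in> graph_funs f d \<Longrightarrow> (\<And>z. z \<in> cball 0 (1 / (real N + 1)) \<Longrightarrow> cmod (g z) \<le> M) \<Longrightarrow>
      z \<in> cball 0 (real N) \<Longrightarrow> cmod (g z) \<le> A d N * M"
    unfolding choice_iff by blast
  define \<mu> where "\<mu> = (\<lambda>d. 1 + (\<Sum>N\<le>d. ln (A d N)))"
  have lnA: "0 \<le> ln (A d N)" for d N using A1 by simp
  have \<mu>1: "1 \<le> \<mu> d" for d unfolding \<mu>_def using lnA by (simp add: sum_nonneg)
  have \<mu>0: "0 \<le> \<mu> d" for d using \<mu>1[of d] by linarith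
  have "controls f \<mu> (cball 0 r) (cball 0 (exp 1 * r))" if r: "0 < r" for r
  proof -
    obtain N1 where N1: "exp 1 * r < real N1" using reals_Archimedean2 by blast
    obtain N2 where N2: "1 / r < real N2" using reals_Archimedean2 by blast
    define N where "N = max N1 N2"
    have N: "exp 1 * r \<le> real N" using N1 unfolding N_def by simp
    have "1 / r \<le> real N + 1" using N2 unfolding N_def by simp
    then have N': "1 / (real N + 1) \<le> r" using r by (simp add: field_simps)
    define C where "C = exp (1 + (\<Sum>k<N. ln (A k N)))"
    have S0: "0 \<le> (\<Sum>k<N. ln (A k N))" using lnA by (simp add: sum_nonneg)
    have AC: "A d N \<le> C powr \<mu> d" for d
    proof -
      have "ln (A d N) \<le> (1 + (\<Sum>k<N. ln (A k N))) * \<mu> d"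
      proof (cases "d < N")
        case True
        have "ln (A d N) \<le> (\<Sum>k<N. ln (A k N))"
          using True lnA by (intro member_le_sum) auto
        also have "\<dots> \<le> (1 + (\<Sum>k<N. ln (A k N))) * 1" by simp
        also have "\<dots> \<le> (1 + (\<Sum>k<N. ln (A k N))) * \<mu> d"
          using S0 \<mu>1 by (intro mult_left_mono) auto
        finally show ?thesis .
      next
        case False
        have "ln (A d N) \<le> (\<Sum>N\<le>d. ln (A d N))"
          using False lnA by (intro member_le_sum) auto
        also have "\<dots> \<le> 1 * \<mu> d" unfolding \<mu>_def by simp
        also have "\<dots> \<le> (1 + (\<Sum>k<N. ln (A k N))) * \<mu> d"
          using S0 \<mu>0 by (intro mult_right_mono) auto
        finally show ?thesis .
      qed
      then have "exp (ln (A d N)) \<le> C powr \<mu> d"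
        unfolding C_def powr_def by (simp add: mult.commute)
      then show ?thesis using A1[of d N] by simp
    qed
    have "cmod (g z) \<le> C powr \<mu> d * M"
      if g: "g \<in> graph_funs f d" and M: "\<forall>z\<in>cball 0 r. cmod (g z) \<le> M" and z: "z \<in> cball 0 (exp 1 * r)" for d g M z
    proof -
      have M0: "0 \<le> M" using M r by (meson centre_in_cball less_imp_le norm_ge_zero order_trans)
      have "cmod (g z) \<le> A d N * M"
        by (rule A[OF g]) (use M N N' z in auto)
      also have "\<dots> \<le> C powr \<mu> d * M" using AC M0 by (rule mult_right_mono)
      finally show ?thesis .
    qed
    moreover have "1 \<le> C" unfolding C_def using S0 by simp
    ultimately show ?thesis unfolding controls_def by blast
  qed
  then have "admits_bernstein f \<mu>" using admits_bernstein_iff_controls[of f \<mu>] f \<mu>0 by blast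
  then show ?thesis using \<mu>0 by blast
qed

section \<open>Subharmonicity of truncated logarithms\<close>

lemma sum_le_integral_of_modulus:
  fixes F :: "real \<Rightarrow> real"
  assumes F: "continuous_on UNIV F" and s: "0 < s" and t: "0 \<le> t" "t \<le> s"
    and mod: "\<And>x y. x \<in> {0..real n * s} \<Longrightarrow> \<bar>x - y\<bar> \<le> s \<Longrightarrow> \<bar>F x - F y\<bar> \<le> \<epsilon>" and m: "m \<le> n"
  shows "s * (\<Sum>l<m. F (t + real l * s)) \<le> integral {0..real m * s} F + real m * s * \<epsilon>"
  using m
proof (induction m)
  case (Suc m)
  let ?I = "{real m * s..real (Suc m) * s}"
  have int: "F integrable_on {a..b}" for a b
    by (rule integrable_continuous_interval) (rule continuous_on_subset[OF F], simp)
  have "real (Suc m) * s \<le> real n * s" using Suc.prems s by (intro mult_right_mono) auto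
  have arc: "F (t + real m * s) \<le> F x + \<epsilon>" if "x \<in> ?I" for x
  proof -
    have "0 \<le> real m * s" using s by simp
    then have "0 \<le> x" using that by auto
    then show ?thesis
      using mod[of x "t + real m * s"] that t \<open>real (Suc m) * s \<le> real n * s\<close>
      by (auto simp: abs_le_iff algebra_simps)
  qed
  then have "integral ?I (\<lambda>x. F (t + real m * s)) \<le> integral ?I (\<lambda>x. F x + \<epsilon>)"
    by (intro integral_le integrable_add int) (use arc in auto)
  also have "\<dots> = integral ?I F + s * \<epsilon>"
    using s by (subst integral_add) (auto intro!: int simp: algebra_simps)
  finally have "s * F (t + real m * s) \<le> integral ?I F + s * \<epsilon>"
    using s by (simp add: algebra_simps)
  moreover have "integral {0..real m * s} F + integral ?I F = integral {0..real (Suc m) * s} F"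
    using s by (intro Henstock_Kurzweil_Integration.integral_combine int) (auto simp: algebra_simps)
  moreover have "s * (\<Sum>l<m. F (t + real l * s)) \<le> integral {0..real m * s} F + real m * s * \<epsilon>"
    using Suc by simp
  ultimately show ?case by (simp add: algebra_simps)
qed simp

lemma periodic_sum_shift:
  fixes F :: "real \<Rightarrow> real"
  assumes "\<And>x. F (x + real n * s) = F x"
  shows "(\<Sum>l<n. F (x + real j * s + real l * s)) = (\<Sum>l<n. F (x + real l * s))"
proof (induction j)
  case (Suc j)
  let ?y = "x + real j * s"
  have "(\<Sum>l<n. F (x + real (Suc j) * s + real l * s)) = (\<Sum>l<n. F (?y + real (Suc l) * s))"
    by (simp add: algebra_simps)
  also have "\<dots> = (\<Sum>l<Suc n. F (?y + real l * s)) - F ?y"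
    by (simp only: sum.lessThan_Suc_shift) simp
  also have "\<dots> = (\<Sum>l<n. F (?y + real l * s))" using assms[of ?y] by simp
  finally show ?case using Suc by simp
qed simp

text \<open>Jensen's inequality without zero counting: apply the maximum principle to the product of the
  \<open>n\<close> rotations of \<open>h\<close>, take logarithms, and recognise a Riemann sum.\<close>

lemma ln_max_le_circle_average:
  assumes h: "h holomorphic_on UNIV" and \<delta>: "0 < \<delta>" and r: "0 < r"
  shows "2 * pi * ln (max (cmod (h a)) \<delta>) \<le>
    integral {0..2 * pi} (\<lambda>\<theta>. ln (max (cmod (h (a + of_real r * cis \<theta>))) \<delta>))"
proof -
  define F where "F = (\<lambda>\<theta>. ln (max (cmod (h (a + of_real r * cis \<theta>))) \<delta>))"
  have hc: "continuous_on UNIV h" using h by (rule holomorphic_on_imp_continuous_on)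
  have F: "continuous_on UNIV F"
  proof -
    have "continuous_on UNIV (\<lambda>\<theta>. cmod (h (a + of_real r * cis \<theta>)))"
      by (intro continuous_on_norm continuous_on_compose2[OF hc] continuous_intros) auto
    moreover have "max (cmod (h (a + of_real r * cis \<theta>))) \<delta> \<noteq> 0" for \<theta>
      using \<delta> by (auto simp: max_def)
    ultimately show ?thesis
      unfolding F_def by (intro continuous_on_ln continuous_on_max continuous_on_const) auto
  qed
  have int: "F integrable_on {a..b}" for a b
    by (rule integrable_continuous_interval) (rule continuous_on_subset[OF F], simp)
  have per: "F (x + 2 * pi) = F x" for x
    unfolding F_def by (simp add: cis_mult[symmetric])
  show ?thesis
  proof (cases "cmod (h a) \<le> \<delta>")
    case True
    have "integral {0..2 * pi} (\<lambda>_. ln \<delta>) \<le> integral {0..2 * pi} F"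
      by (intro integral_le int) (use \<delta> in \<open>auto simp: F_def\<close>)
    then show ?thesis using True by (simp add: F_def max_absorb2)
  next
    case False
    then have h0: "0 < cmod (h a)" using \<delta> by linarith
    have "2 * pi * ln (cmod (h a)) \<le> integral {0..2 * pi} F + \<epsilon>" if \<epsilon>: "0 < \<epsilon>" for \<epsilon>
    proof -
      define e where "e = \<epsilon> / (2 * pi)"
      have e: "0 < e" using \<epsilon> by (simp add: e_def)
      have "uniformly_continuous_on {-2 * pi..4 * pi} F"
        by (intro compact_uniformly_continuous continuous_on_subset[OF F]) auto
      then obtain \<eta> where \<eta>: "0 < \<eta>"
        "\<And>x y. x \<in> {-2 * pi..4 * pi} \<Longrightarrow> y \<in> {-2 * pi..4 * pi} \<Longrightarrow> dist y x < \<eta> \<Longrightarrow> dist (F y) (F x) < e"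
        using e unfolding uniformly_continuous_on_def by metis
      obtain n0 where n0: "2 * pi / \<eta> < real n0" using reals_Archimedean2 by blast
      define n where "n = Suc n0"
      define s where "s = 2 * pi / real n"
      have n: "0 < n" "real n \<noteq> 0" by (auto simp: n_def)
      have s: "0 < s" "s \<le> 2 * pi" "real n * s = 2 * pi"
        by (auto simp: s_def n_def field_simps)
      have "2 * pi / \<eta> < real n" using n0 by (simp add: n_def)
      then have s\<eta>: "s < \<eta>" using \<eta>(1) n by (simp add: s_def field_simps)
      define H where "H = (\<lambda>\<zeta>. \<Prod>l<n. h (a + cis (real l * s) * \<zeta>))"
      have H: "H holomorphic_on S" for S
      proof -
        have "(\<lambda>\<zeta>. h (a + cis (real l * s) * \<zeta>)) holomorphic_on S" for l
        proof -
          have "(\<lambda>\<zeta>. a + cis (real l * s) * \<zeta>) holomorphic_on S" by (intro holomorphic_intros)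
          from holomorphic_on_compose_gen[OF this h] show ?thesis by (simp add: o_def)
        qed
        then show ?thesis unfolding H_def by (intro holomorphic_on_prod)
      qed
      have "continuous_on (sphere 0 r) (\<lambda>\<zeta>. cmod (H \<zeta>))"
        by (intro continuous_intros holomorphic_on_imp_continuous_on H)
      moreover have "sphere (0::complex) r \<noteq> {}" using r by simp
      ultimately obtain \<zeta>0 where \<zeta>0: "\<zeta>0 \<in> sphere 0 r" "\<And>\<zeta>. \<zeta> \<in> sphere 0 r \<Longrightarrow> cmod (H \<zeta>) \<le> cmod (H \<zeta>0)"
        using continuous_attains_sup[OF compact_sphere] by metis
      have "cmod (H 0) \<le> cmod (H \<zeta>0)"
        by (rule maximum_modulus_frontier[of H "ball 0 r"])
          (use r \<zeta>0 in \<open>auto intro: H holomorphic_on_imp_continuous_on\<close>)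
      moreover obtain \<theta>0 where \<theta>0: "0 \<le> \<theta>0" "\<zeta>0 = of_real r * cis \<theta>0"
        using Arg2pi[of \<zeta>0] \<zeta>0(1) by (auto simp: is_Arg_def cis_conv_exp)
      ultimately have "cmod (h a) ^ n \<le> (\<Prod>l<n. cmod (h (a + of_real r * cis (\<theta>0 + real l * s))))"
        by (simp add: H_def prod_norm norm_power cis_mult mult_ac add_ac flip: cis_mult)
      also have "\<dots> \<le> (\<Prod>l<n. max (cmod (h (a + of_real r * cis (\<theta>0 + real l * s)))) \<delta>)"
        by (intro prod_mono) auto
      finally have "ln (cmod (h a) ^ n) \<le> ln (\<Prod>l<n. max (cmod (h (a + of_real r * cis (\<theta>0 + real l * s)))) \<delta>)"
        using h0 \<delta> by (subst ln_le_cancel_iff) (auto intro!: prod_pos simp: less_max_iff_disj)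
      also have "\<dots> = (\<Sum>l<n. F (\<theta>0 + real l * s))"
        unfolding F_def using \<delta> by (intro ln_prod) (auto simp: max_def)
      finally have 1: "real n * ln (cmod (h a)) \<le> (\<Sum>l<n. F (\<theta>0 + real l * s))"
        using h0 by (simp add: ln_realpow)
      define j where "j = nat \<lfloor>\<theta>0 / s\<rfloor>"
      define t where "t = \<theta>0 - real j * s"
      have "real j \<le> \<theta>0 / s" "\<theta>0 / s \<le> real j + 1"
        using \<theta>0(1) s(1) unfolding j_def by (simp_all add: of_nat_nat)
      then have t: "0 \<le> t" "t \<le> s" using s(1) unfolding t_def by (auto simp: field_simps)
      have "(\<Sum>l<n. F (\<theta>0 + real l * s)) = (\<Sum>l<n. F (t + real l * s))"
        using periodic_sum_shift[of F n s t j] per s(3) by (simp add: t_def)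
      with 1 have "s * (real n * ln (cmod (h a))) \<le> s * (\<Sum>l<n. F (t + real l * s))"
        using s(1) by (intro mult_left_mono) auto
      also have "\<dots> \<le> integral {0..real n * s} F + real n * s * e"
      proof (rule sum_le_integral_of_modulus[OF F s(1) t _ order_refl])
        fix x y assume x: "x \<in> {0..real n * s}" and y: "\<bar>x - y\<bar> \<le> s"
        then have "dist (F y) (F x) < e" using s s\<eta> by (intro \<eta>(2)) (auto simp: dist_real_def abs_le_iff)
        then show "\<bar>F x - F y\<bar> \<le> e" by (simp add: dist_real_def)
      qed
      also have "s * (real n * ln (cmod (h a))) = 2 * pi * ln (cmod (h a))"
        using s(3) by (metis mult.assoc mult.commute)
      finally show ?thesis unfolding s(3) by (simp add: e_def)
    qed
    then have "2 * pi * ln (cmod (h a)) \<le> integral {0..2 * pi} F" by (rule field_le_epsilon)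
    then show ?thesis using False by (simp add: F_def max_absorb1)
  qed
qed

lemma positive_part_balance:
  fixes x :: "nat \<Rightarrow> real"
  assumes x: "\<And>N. x (Suc N) \<le> x N" and S: "0 \<le> S" "x 0 \<le> S"
  shows "e2ennreal (INF N. ereal (x N)) + (SUP N. ennreal (S - x N)) =
    e2ennreal (- (INF N. ereal (x N))) + ennreal S"
proof -
  have dec: "decseq x" using x by (rule decseq_SucI)
  have xS: "x N \<le> S" for N using decseqD[OF dec, of 0 N] S by simp
  have lim: "(\<lambda>N. ereal (x N)) \<longlonglongrightarrow> (INF N. ereal (x N))"
    by (rule LIMSEQ_INF) (use dec in \<open>auto simp: decseq_def\<close>)
  have c: "continuous_on UNIV e2ennreal" by (rule continuous_on_e2ennreal)
  have 1: "(\<lambda>N. e2ennreal (ereal (x N))) \<longlonglongrightarrow> e2ennreal (INF N. ereal (x N))"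
    by (rule continuous_on_tendsto_compose[OF c lim]) auto
  have 2: "(\<lambda>N. e2ennreal (- ereal (x N))) \<longlonglongrightarrow> e2ennreal (- (INF N. ereal (x N)))"
    by (rule continuous_on_tendsto_compose[OF c tendsto_uminus_ereal[OF lim]]) auto
  have 3: "(\<lambda>N. ennreal (S - x N)) \<longlonglongrightarrow> (SUP N. ennreal (S - x N))"
    by (rule LIMSEQ_SUP) (use dec in \<open>auto simp: decseq_def incseq_def intro!: ennreal_leI\<close>)
  have eq: "e2ennreal (ereal (x N)) + ennreal (S - x N) = e2ennreal (- ereal (x N)) + ennreal S" for N
  proof (cases "0 \<le> x N")
    case True
    then show ?thesis using xS[of N] by (simp add: ennreal_plus[symmetric] ennreal_neg del: ennreal_plus)
  next
    case False
    then show ?thesis using S(1) by (simp add: ennreal_plus[symmetric] ennreal_neg del: ennreal_plus)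
  qed
  have "(\<lambda>N. e2ennreal (ereal (x N)) + ennreal (S - x N)) \<longlonglongrightarrow>
      e2ennreal (INF N. ereal (x N)) + (SUP N. ennreal (S - x N))"
    by (intro tendsto_add 1 3)
  moreover have "(\<lambda>N. e2ennreal (ereal (x N)) + ennreal (S - x N)) \<longlonglongrightarrow>
      e2ennreal (- (INF N. ereal (x N))) + ennreal S"
    unfolding eq by (intro tendsto_add 2 tendsto_const)
  ultimately show ?thesis by (rule LIMSEQ_unique)
qed

lemma circle_mean_ge_of_decreasing_limit:
  fixes w :: "nat \<Rightarrow> complex \<Rightarrow> real" and u :: "complex \<Rightarrow> ereal"
  assumes r: "0 < r" and cont: "\<And>N. continuous_on UNIV (w N)"
    and dec: "\<And>N \<zeta>. \<zeta> \<in> cball a r \<Longrightarrow> w (Suc N) \<zeta> \<le> w N \<zeta>"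
    and u: "\<And>\<zeta>. \<zeta> \<in> cball a r \<Longrightarrow> u \<zeta> = (INF N. ereal (w N \<zeta>))"
    and sub: "\<And>N. 2 * pi * w N a \<le> integral {0..2 * pi} (\<lambda>\<theta>. w N (a + of_real r * cis \<theta>))"
  shows "u a \<le> circle_mean u a r"
proof (cases "u a = -\<infinity>")
  case False
  have ua: "u a = (INF N. ereal (w N a))" using u r by simp
  have "u a \<le> ereal (w 0 a)" unfolding ua by (rule INF_lower) simp
  with False obtain t where t: "u a = ereal t" by (cases "u a") auto
  have tw: "t \<le> w N a" for N
  proof -
    have "u a \<le> ereal (w N a)" unfolding ua by (rule INF_lower) simp
    then show ?thesis unfolding t by simp
  qed
  define p where "p = (\<lambda>\<theta>. a + of_real r * cis \<theta>)"
  have p: "p \<theta> \<in> cball a r" for \<theta> using r by (simp add: p_def dist_norm norm_mult)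
  have "compact (w 0 ` cball a r)"
    by (intro compact_continuous_image continuous_on_subset[OF cont]) auto
  then obtain S0 where "\<forall>x\<in>w 0 ` cball a r. norm x \<le> S0"
    using compact_imp_bounded bounded_iff by blast
  then have S0: "\<bar>w 0 \<zeta>\<bar> \<le> S0" if "\<zeta> \<in> cball a r" for \<zeta> using that by auto
  define S where "S = max S0 0"
  have S: "0 \<le> S" "\<And>\<zeta>. \<zeta> \<in> cball a r \<Longrightarrow> w 0 \<zeta> \<le> S" using S0 unfolding S_def by (auto simp: abs_le_iff le_max_iff_disj)
  have wS: "w N \<zeta> \<le> S" if "\<zeta> \<in> cball a r" for N \<zeta>
    using S(2)[OF that] dec[OF that] by (induction N) (auto intro: order_trans)
  have wp: "continuous_on UNIV (\<lambda>\<theta>. w N (p \<theta>))" for N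
    unfolding p_def by (intro continuous_on_compose2[OF cont] continuous_intros) auto
  have [measurable]: "(\<lambda>\<theta>. w N (p \<theta>)) \<in> borel_measurable borel" for N
    by (rule borel_measurable_continuous_onI[OF wp])
  have up: "(\<lambda>\<theta>. u (p \<theta>)) = (\<lambda>\<theta>. INF N. ereal (w N (p \<theta>)))" using u p by auto
  have [measurable]: "(\<lambda>\<theta>. u (p \<theta>)) \<in> borel_measurable borel" unfolding up by measurable
  let ?J = "{0..2 * pi}"
  define v where "v = (\<lambda>N \<theta>. ennreal (S - w N (p \<theta>)) * indicator ?J \<theta>)"
  have [measurable]: "v N \<in> borel_measurable lborel" for N unfolding v_def by measurable
  have "incseq v"
    unfolding v_def by (intro incseq_SucI le_funI mult_right_mono ennreal_leI diff_left_mono dec p) simp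
  have vint: "integral\<^sup>N lborel (v N) \<le> ennreal (2 * pi * (S - t))" for N
  proof -
    have i: "(\<lambda>\<theta>. w N (p \<theta>)) integrable_on ?J"
      by (intro integrable_continuous_interval continuous_on_subset[OF wp]) auto
    have "((\<lambda>\<theta>. S - w N (p \<theta>)) has_integral (2 * pi * S - integral ?J (\<lambda>\<theta>. w N (p \<theta>)))) ?J"
      using has_integral_diff[OF has_integral_const_real[of S 0 "2 * pi"] integrable_integral[OF i]] by simp
    then have "integral\<^sup>N lborel (v N) = ennreal (2 * pi * S - integral ?J (\<lambda>\<theta>. w N (p \<theta>)))"
      unfolding v_def using wS p by (intro nn_integral_has_integral_lebesgue') auto
    also have "\<dots> \<le> ennreal (2 * pi * (S - t))"
    proof (rule ennreal_leI)
      have "2 * pi * t \<le> 2 * pi * w N a" using tw[of N] by simp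
      then have "2 * pi * t \<le> integral ?J (\<lambda>\<theta>. w N (p \<theta>))" using sub[of N] unfolding p_def by linarith
      then show "2 * pi * S - integral ?J (\<lambda>\<theta>. w N (p \<theta>)) \<le> 2 * pi * (S - t)"
        by (simp add: right_diff_distrib)
    qed
    finally show ?thesis .
  qed
  define V P Q where "V = (\<integral>\<^sup>+\<theta>. (SUP N. v N \<theta>) \<partial>lborel)"
    and "P = (\<integral>\<^sup>+\<theta>\<in>?J. e2ennreal (u (p \<theta>)) \<partial>lborel)" and "Q = (\<integral>\<^sup>+\<theta>\<in>?J. e2ennreal (- u (p \<theta>)) \<partial>lborel)"
  have "V = (SUP N. integral\<^sup>N lborel (v N))"
    unfolding V_def by (rule nn_integral_monotone_convergence_SUP[OF \<open>incseq v\<close>]) measurable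
  then have V: "V \<le> ennreal (2 * pi * (S - t))" using vint by (auto intro: SUP_least)
  have pt: "e2ennreal (u (p \<theta>)) * indicator ?J \<theta> + (SUP N. v N \<theta>) =
      e2ennreal (- u (p \<theta>)) * indicator ?J \<theta> + ennreal S * indicator ?J \<theta>" for \<theta>
    using positive_part_balance[of "\<lambda>N. w N (p \<theta>)" S, OF dec[OF p] S(1) S(2)[OF p]] u[OF p]
    by (auto simp: v_def indicator_def)
  have SJ: "(\<integral>\<^sup>+\<theta>. ennreal S * indicator ?J \<theta> \<partial>lborel) = ennreal (2 * pi * S)"
    using S(1) by (subst nn_integral_cmult_indicator) (auto simp: ennreal_mult[symmetric] mult_ac)
  have PV: "P + V = Q + ennreal (2 * pi * S)"
  proof -
    have "P + V = (\<integral>\<^sup>+\<theta>. e2ennreal (u (p \<theta>)) * indicator ?J \<theta> + (SUP N. v N \<theta>) \<partial>lborel)"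
      unfolding P_def V_def by (subst nn_integral_add) auto
    also have "\<dots> = Q + (\<integral>\<^sup>+\<theta>. ennreal S * indicator ?J \<theta> \<partial>lborel)"
      unfolding Q_def pt by (subst nn_integral_add) auto
    finally show ?thesis unfolding SJ .
  qed
  have "P \<le> (\<integral>\<^sup>+\<theta>. ennreal S * indicator ?J \<theta> \<partial>lborel)"
    unfolding P_def
  proof (intro nn_integral_mono mult_right_mono)
    fix \<theta>
    have "u (p \<theta>) \<le> ereal (w 0 (p \<theta>))" unfolding u[OF p] by (rule INF_lower) simp
    also have "\<dots> \<le> ereal S" using S(2)[OF p] by simp
    finally have "e2ennreal (u (p \<theta>)) \<le> e2ennreal (ereal S)" by (rule e2ennreal_mono)
    then show "e2ennreal (u (p \<theta>)) \<le> ennreal S" by simp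
  qed simp
  then have "P < top" unfolding SJ by (rule le_less_trans) simp
  then obtain P' where P': "P = ennreal P'" "0 \<le> P'" by (cases P) auto
  have "V < top" using V by (rule le_less_trans) simp
  then obtain V' where V': "V = ennreal V'" "0 \<le> V'" by (cases V) auto
  have "Q \<le> P + V" unfolding PV by simp
  then have "Q < top" using P' V' by (simp add: ennreal_plus[symmetric] le_less_trans del: ennreal_plus)
  then obtain Q' where Q': "Q = ennreal Q'" "0 \<le> Q'" by (cases Q) auto
  have "P' + V' = Q' + 2 * pi * S"
    using PV P' V' Q' S(1) by (simp add: ennreal_plus[symmetric] del: ennreal_plus)
  moreover have "V' \<le> 2 * pi * (S - t)"
    using V V' tw[of 0] S(2)[of a] r by (simp add: ennreal_le_iff)
  ultimately have "2 * pi * t \<le> P' - Q'" by (simp add: algebra_simps)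
  then have "t \<le> 1 / (2 * pi) * (P' - Q')" by (simp add: field_simps)
  then have "ereal t \<le> ereal (1 / (2 * pi)) * (ereal P' - ereal Q')" by simp
  then show ?thesis
    unfolding circle_mean_def t using P' Q' unfolding P_def Q_def p_def by simp
qed simp

section \<open>Pluripolar sets\<close>

lemma continuous_on_line: "continuous_on UNIV (\<lambda>\<zeta>. a + \<zeta> *s b)" for a b :: "complex ^ 'n"
  by (auto intro!: continuous_intros simp: vector_scalar_mult_def)

lemma plurisubharmonic_of_decreasing_limit:
  fixes u :: "complex ^ 'n \<Rightarrow> ereal"
  assumes "\<And>R. \<exists>w :: nat \<Rightarrow> complex ^ 'n \<Rightarrow> real. (\<forall>N. continuous_on UNIV (w N)) \<and>
      (\<forall>N. \<forall>z\<in>cball 0 R. w (Suc N) z \<le> w N z) \<and> (\<forall>z\<in>cball 0 R. u z = (INF N. ereal (w N z))) \<and>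
      (\<forall>N a b r. 0 < r \<longrightarrow> 2 * pi * w N a \<le> integral {0..2 * pi} (\<lambda>\<theta>. w N (a + (of_real r * cis \<theta>) *s b)))"
  shows "plurisubharmonic u"
proof -
  have usc: "upper_semicontinuous u"
    unfolding upper_semicontinuous_def
  proof
    fix c
    show "open {z. u z < c}"
    proof (subst open_subopen, intro ballI)
      fix z assume z: "z \<in> {z. u z < c}"
      obtain w :: "nat \<Rightarrow> complex ^ 'n \<Rightarrow> real" where w: "\<And>N. continuous_on UNIV (w N)"
        "\<And>y. y \<in> cball 0 (norm z + 1) \<Longrightarrow> u y = (INF N. ereal (w N y))"
        using assms[of "norm z + 1"] by metis
      have "(INF N. ereal (w N z)) < c" using w(2)[of z] z by simp
      then obtain N where N: "ereal (w N z) < c" by (auto simp: INF_less_iff)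
      have "open {y. ereal (w N y) < c}"
        by (intro open_Collect_less continuous_intros w(1))
      moreover have "{y. ereal (w N y) < c} \<inter> ball 0 (norm z + 1) \<subseteq> {z. u z < c}"
        using w(2) by (auto simp: INF_less_iff)
      ultimately show "\<exists>T. open T \<and> z \<in> T \<and> T \<subseteq> {z. u z < c}"
        using N by (intro exI[of _ "{y. ereal (w N y) < c} \<inter> ball 0 (norm z + 1)"]) auto
    qed
  qed
  have fin: "u z < \<infinity>" for z
  proof -
    obtain w :: "nat \<Rightarrow> complex ^ 'n \<Rightarrow> real" where "u z = (INF N. ereal (w N z))"
      using assms[of "norm z"] by auto
    then have "u z \<le> ereal (w 0 z)" by (metis INF_lower UNIV_I)
    then show ?thesis by (rule le_less_trans) simp
  qed
  have "subharmonic (\<lambda>\<zeta>. u (a + \<zeta> *s b))" for a b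
    unfolding subharmonic_def
  proof (intro conjI allI impI fin)
    show "upper_semicontinuous (\<lambda>\<zeta>. u (a + \<zeta> *s b))"
      unfolding upper_semicontinuous_def
    proof
      fix c
      have "open {z. u z < c}" using usc unfolding upper_semicontinuous_def by blast
      then have "open ((\<lambda>\<zeta>. a + \<zeta> *s b) -` {z. u z < c})"
        by (rule open_vimage[OF _ continuous_on_line])
      then show "open {\<zeta>. u (a + \<zeta> *s b) < c}" by (simp add: vimage_def)
    qed
    fix \<zeta>0 :: complex and r :: real assume r: "0 < r"
    define R where "R = norm a + (cmod \<zeta>0 + r) * norm b"
    obtain w :: "nat \<Rightarrow> complex ^ 'n \<Rightarrow> real" where w: "\<And>N. continuous_on UNIV (w N)"
      "\<And>N z. z \<in> cball 0 R \<Longrightarrow> w (Suc N) z \<le> w N z"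
      "\<And>z. z \<in> cball 0 R \<Longrightarrow> u z = (INF N. ereal (w N z))"
      "\<And>N a b r. 0 < r \<Longrightarrow> 2 * pi * w N a \<le> integral {0..2 * pi} (\<lambda>\<theta>. w N (a + (of_real r * cis \<theta>) *s b))"
      using assms[of R] by metis
    have R: "a + \<zeta> *s b \<in> cball 0 R" if "\<zeta> \<in> cball \<zeta>0 r" for \<zeta>
    proof -
      have "cmod \<zeta> \<le> cmod \<zeta>0 + r"
        using that norm_triangle_ineq2[of \<zeta> \<zeta>0] by (simp add: dist_norm norm_minus_commute)
      then have "norm (\<zeta> *s b) \<le> (cmod \<zeta>0 + r) * norm b"
        unfolding norm_vector_scalar_mult by (rule mult_right_mono) simp
      then show ?thesis unfolding R_def using norm_triangle_ineq[of a "\<zeta> *s b"] by simp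
    qed
    show "u (a + \<zeta>0 *s b) \<le> circle_mean (\<lambda>\<zeta>. u (a + \<zeta> *s b)) \<zeta>0 r"
    proof (rule circle_mean_ge_of_decreasing_limit[where w="\<lambda>N \<zeta>. w N (a + \<zeta> *s b)", OF r])
      show "continuous_on UNIV (\<lambda>\<zeta>. w N (a + \<zeta> *s b))" for N
        by (rule continuous_on_compose2[OF w(1) continuous_on_line]) simp
      show "2 * pi * w N (a + \<zeta>0 *s b) \<le>
          integral {0..2 * pi} (\<lambda>\<theta>. w N (a + (\<zeta>0 + of_real r * cis \<theta>) *s b))" for N
        using w(4)[OF r, of N "a + \<zeta>0 *s b" b] by (simp add: vector_sadd_rdistrib add.assoc)
    qed (use w(2,3) R in auto)
  qed
  then show ?thesis unfolding plurisubharmonic_def using usc fin by blast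
qed

text \<open>The function \<open>u = \<Sum>\<^sub>k c\<^sub>k log |g\<^sub>k|\<close>, with the \<open>k\<close>-th term cut off at \<open>-N\<close> in the \<open>N\<close>-th partial
  sum, is \<open>-\<infinity>\<close> on \<open>K\<close> and finite at \<open>z0\<close>.\<close>

lemma pluripolar_criterion:
  fixes g :: "nat \<Rightarrow> complex ^ 'n \<Rightarrow> complex"
  assumes g: "\<And>k. entire (g k)" and c: "\<And>k. 0 < c k"
    and upper: "\<And>R. \<exists>D\<ge>0. \<forall>k. \<forall>z\<in>cball 0 R. cmod (g k z) \<le> exp (D * (1/2) ^ k / c k)"
    and small: "\<And>k z. z \<in> K \<Longrightarrow> cmod (g k z) \<le> exp (- 1 / c k)"
    and big: "\<And>k. exp (- ((1/2) ^ k) / c k) \<le> cmod (g k z0)"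
  shows "pluripolar K"
proof -
  define L where "L = (\<lambda>k N z. c k * ln (max (cmod (g k z)) (exp (- real N / c k))))"
  define \<Psi> where "\<Psi> = (\<lambda>N z. \<Sum>k<N. L k N z)"
  define u where "u = (\<lambda>z. limsup (\<lambda>N. ereal (\<Psi> N z)))"
  have le_exp: "L k N z \<le> b" if "cmod (g k z) \<le> exp (b / c k)" "- real N \<le> b" for k N z b
  proof -
    have "exp (- real N / c k) \<le> exp (b / c k)" unfolding exp_le_cancel_iff using that(2) c[of k] by (intro divide_right_mono) auto
    then have "ln (max (cmod (g k z)) (exp (- real N / c k))) \<le> ln (exp (b / c k))"
      using that(1) by (subst ln_le_cancel_iff) (auto simp: less_max_iff_disj)
    then have "L k N z \<le> c k * (b / c k)" unfolding L_def using c[of k] by (intro mult_left_mono) auto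
    then show ?thesis using c[of k] by simp
  qed
  have ge_exp: "b \<le> L k N z" if "exp (b / c k) \<le> cmod (g k z)" for k N z b
  proof -
    have "ln (exp (b / c k)) \<le> ln (max (cmod (g k z)) (exp (- real N / c k)))"
      using that by (subst ln_le_cancel_iff) (auto simp: less_max_iff_disj)
    then have "c k * (b / c k) \<le> L k N z" unfolding L_def using c[of k] by (intro mult_left_mono) auto
    then show ?thesis using c[of k] by simp
  qed
  have L_dec: "L k (Suc N) z \<le> L k N z" for k N z
  proof -
    have "exp (- real (Suc N) / c k) \<le> exp (- real N / c k)" unfolding exp_le_cancel_iff using c[of k] by (intro divide_right_mono) auto
    then have "max (cmod (g k z)) (exp (- real (Suc N) / c k)) \<le> max (cmod (g k z)) (exp (- real N / c k))"
      by (intro max.mono order_refl)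
    then have "ln (max (cmod (g k z)) (exp (- real (Suc N) / c k))) \<le> ln (max (cmod (g k z)) (exp (- real N / c k)))"
      by (subst ln_le_cancel_iff) (auto simp: less_max_iff_disj)
    then show ?thesis unfolding L_def using c[of k] by (intro mult_left_mono) auto
  qed
  have L_cont: "continuous_on UNIV (L k N)" for k N
  proof -
    have "max (cmod (g k z)) (exp (- real N / c k)) \<noteq> 0" for z
      using exp_gt_zero[of "- real N / c k"] by (metis less_max_iff_disj less_irrefl)
    then show ?thesis unfolding L_def
      by (intro continuous_intros continuous_on_max continuous_on_norm entire_continuous g) auto
  qed
  have L_sub: "2 * pi * L k N a \<le> integral {0..2 * pi} (\<lambda>\<theta>. L k N (a + (of_real r * cis \<theta>) *s b))"
    if "0 < r" for k N a b r
  proof -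
    have "2 * pi * ln (max (cmod (g k (a + 0 *s b))) (exp (- real N / c k))) \<le>
      integral {0..2 * pi} (\<lambda>\<theta>. ln (max (cmod (g k (a + (0 + of_real r * cis \<theta>) *s b))) (exp (- real N / c k))))"
      by (rule ln_max_le_circle_average[OF entire_line[OF g] _ that]) simp
    then have "c k * (2 * pi * ln (max (cmod (g k a)) (exp (- real N / c k)))) \<le>
      c k * integral {0..2 * pi} (\<lambda>\<theta>. ln (max (cmod (g k (a + (of_real r * cis \<theta>) *s b))) (exp (- real N / c k))))"
      using c[of k] by (intro mult_left_mono) auto
    then show ?thesis unfolding L_def by (simp add: mult_ac)
  qed
  have main: "\<exists>D w. (\<forall>N z. w N z = \<Psi> N z + 2 * D * (1/2) ^ N) \<and> (\<forall>N. continuous_on UNIV (w N)) \<and>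
      (\<forall>N. \<forall>z\<in>cball 0 R. w (Suc N) z \<le> w N z) \<and> (\<forall>z\<in>cball 0 R. u z = (INF N. ereal (w N z))) \<and>
      (\<forall>N a b r. 0 < r \<longrightarrow> 2 * pi * w N a \<le> integral {0..2 * pi} (\<lambda>\<theta>. w N (a + (of_real r * cis \<theta>) *s b))) \<and> 0 \<le> D" for R
  proof -
    obtain D where D: "0 \<le> D" "\<And>k z. z \<in> cball 0 R \<Longrightarrow> cmod (g k z) \<le> exp (D * (1/2) ^ k / c k)"
      using upper[of R] by blast
    define w where "w = (\<lambda>N z. \<Psi> N z + 2 * D * (1/2) ^ N)"
    have w_cont: "continuous_on UNIV (w N)" for N
      unfolding w_def \<Psi>_def by (intro continuous_intros L_cont)
    have w_dec: "w (Suc N) z \<le> w N z" if "z \<in> cball 0 R" for N z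
    proof -
      have "L N (Suc N) z \<le> D * (1/2) ^ N"
        by (rule le_exp[OF D(2)[OF that]]) (use D(1) in \<open>simp add: order_trans[of _ 0]\<close>)
      moreover have "(\<Sum>k<N. L k (Suc N) z) \<le> (\<Sum>k<N. L k N z)"
        by (intro sum_mono L_dec)
      ultimately show ?thesis by (simp add: w_def \<Psi>_def)
    qed
    have u_eq: "u z = (INF N. ereal (w N z))" if "z \<in> cball 0 R" for z
    proof -
      have "decseq (\<lambda>N. ereal (w N z))"
        by (rule decseq_SucI) (simp only: ereal_less_eq w_dec[OF that])
      then have 1: "(\<lambda>N. ereal (w N z)) \<longlonglongrightarrow> (INF N. ereal (w N z))" by (rule LIMSEQ_INF)
      have "(\<lambda>N. - (2 * D * (1/2) ^ N)) \<longlonglongrightarrow> - (2 * D * 0)"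
        by (intro tendsto_intros LIMSEQ_power_zero) simp
      then have 2: "(\<lambda>N. ereal (- (2 * D * (1/2) ^ N))) \<longlonglongrightarrow> ereal 0" by simp
      have "(\<lambda>N. ereal (w N z) + ereal (- (2 * D * (1/2) ^ N))) \<longlonglongrightarrow> (INF N. ereal (w N z)) + ereal 0"
        by (rule tendsto_add_ereal_general1[OF _ 1 2]) simp
      then have "(\<lambda>N. ereal (\<Psi> N z)) \<longlonglongrightarrow> (INF N. ereal (w N z))"
        by (simp add: w_def zero_ereal_def[symmetric])
      then show ?thesis unfolding u_def by (intro lim_imp_Limsup) auto
    qed
    have w_sub: "2 * pi * w N a \<le> integral {0..2 * pi} (\<lambda>\<theta>. w N (a + (of_real r * cis \<theta>) *s b))"
      if r: "0 < r" for N a b r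
    proof -
      have "continuous_on UNIV (\<lambda>\<theta>. a + (of_real r * cis \<theta>) *s b)"
        by (rule continuous_on_compose2[OF continuous_on_line]) (auto intro!: continuous_intros)
      then have "continuous_on UNIV (\<lambda>\<theta>. L k N (a + (of_real r * cis \<theta>) *s b))" for k
        by (rule continuous_on_compose2[OF L_cont]) simp
      then have i: "(\<lambda>\<theta>. L k N (a + (of_real r * cis \<theta>) *s b)) integrable_on {0..2 * pi}" for k
        by (meson continuous_on_subset integrable_continuous_interval subset_UNIV)
      have i2: "(\<lambda>\<theta>. \<Sum>k<N. L k N (a + (of_real r * cis \<theta>) *s b)) integrable_on {0..2 * pi}"
        by (intro integrable_sum i) simp
      have "2 * pi * w N a = (\<Sum>k<N. 2 * pi * L k N a) + 2 * pi * (2 * D * (1/2) ^ N)"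
        by (simp add: w_def \<Psi>_def sum_distrib_left algebra_simps)
      also have "\<dots> \<le> (\<Sum>k<N. integral {0..2 * pi} (\<lambda>\<theta>. L k N (a + (of_real r * cis \<theta>) *s b))) + 2 * pi * (2 * D * (1/2) ^ N)"
        by (intro add_right_mono sum_mono L_sub r)
      also have "\<dots> = integral {0..2 * pi} (\<lambda>\<theta>. \<Sum>k<N. L k N (a + (of_real r * cis \<theta>) *s b)) +
          integral {0..2 * pi} (\<lambda>\<theta>. 2 * D * (1/2) ^ N)"
        by (subst integral_sum) (auto intro: i)
      also have "\<dots> = integral {0..2 * pi} (\<lambda>\<theta>. w N (a + (of_real r * cis \<theta>) *s b))"
        unfolding w_def \<Psi>_def by (subst integral_add[OF i2]) auto
      finally show ?thesis .
    qed
    show ?thesis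
      by (intro exI[of _ D] exI[of _ w] conjI allI ballI impI w_cont w_dec u_eq w_sub D(1)) (auto simp: w_def)
  qed
  have "plurisubharmonic u"
    by (rule plurisubharmonic_of_decreasing_limit) (use main in metis)
  moreover have "u z0 \<noteq> -\<infinity>"
  proof -
    obtain D w where w: "\<And>N z. w N z = \<Psi> N z + 2 * D * (1/2) ^ N" "0 \<le> D"
      "u z0 = (INF N. ereal (w N z0))" using main[of "norm z0"] by auto
    have "- 2 \<le> w N z0" for N
    proof -
      have "(\<Sum>k<N. - ((1/2) ^ k)) \<le> \<Psi> N z0"
        unfolding \<Psi>_def by (intro sum_mono ge_exp big)
      moreover have "(\<Sum>k<N. (1/2::real) ^ k) \<le> 2"
        by (simp add: sum_gp_strict)
      moreover have "0 \<le> 2 * D * (1/2) ^ N" using w(2) by simp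
      ultimately show ?thesis unfolding w(1) sum_negf by linarith
    qed
    then have "ereal (- 2) \<le> u z0" unfolding w(3) by (intro INF_greatest) simp
    then show ?thesis by auto
  qed
  moreover have "u z = -\<infinity>" if z: "z \<in> K" for z
  proof -
    obtain D w where w: "\<And>N z. w N z = \<Psi> N z + 2 * D * (1/2) ^ N" "0 \<le> D"
      "u z = (INF N. ereal (w N z))" using main[of "norm z"] by auto
    have wN: "w N z \<le> - real N + 2 * D" if N: "1 \<le> N" for N
    proof -
      have "\<Psi> N z \<le> (\<Sum>k<N. - 1)"
        unfolding \<Psi>_def using N by (intro sum_mono le_exp small[OF z]) auto
      moreover have "2 * D * (1/2) ^ N \<le> 2 * D" using w(2) by (simp add: mult_left_le power_le_one)
      ultimately show ?thesis using w(1) by simp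
    qed
    show ?thesis
    proof (rule ereal_bot)
      fix B :: real
      obtain N where N: "max 1 (2 * D - B) < real N" using reals_Archimedean2 by blast
      have "u z \<le> ereal (w N z)" unfolding w(3) by (rule INF_lower) simp
      also have "\<dots> \<le> ereal B" using wN[of N] N by simp
      finally show "u z \<le> ereal B" .
    qed
  qed
  ultimately show ?thesis unfolding pluripolar_def by blast
qed

lemma pluripolar_empty: "pluripolar ({} :: (complex ^ 'n) set)"
  by (rule pluripolar_criterion[of "\<lambda>_ _. 1" "\<lambda>_. 1" _ 0]) (auto intro: entire_const exI[of _ 0])

lemma usc_bounded_above_on_compact:
  assumes u: "upper_semicontinuous u" "\<And>z. u z < \<infinity>" and K: "compact K"
  obtains n :: nat where "\<And>z. z \<in> K \<Longrightarrow> u z \<le> ereal (real n)"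
proof -
  have cover: "K \<subseteq> (\<Union>n\<in>UNIV. {z. u z < ereal (real n)})"
  proof
    fix z
    obtain n :: nat where "u z < ereal (real n)"
      using u(2)[of z] less_PInf_Ex_of_nat[of "u z"] by auto
    then show "z \<in> (\<Union>n\<in>UNIV. {z. u z < ereal (real n)})" by blast
  qed
  have "open {z. u z < ereal (real n)}" for n
    using u(1) unfolding upper_semicontinuous_def by blast
  then obtain I where I: "finite I" "K \<subseteq> (\<Union>n\<in>I. {z. u z < ereal (real n)})"
    using compactE_image[OF K _ cover] by metis
  have "u z \<le> ereal (real (Max I))" if z: "z \<in> K" for z
  proof -
    obtain n where "n \<in> I" "u z < ereal (real n)" using I(2) z by blast
    then show ?thesis using Max_ge[OF I(1)] by (meson ereal_less_eq(3) le_less_trans less_imp_le of_nat_mono order_trans)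
  qed
  then show thesis by (rule that)
qed

text \<open>The circle around any \<open>z1\<close> through the centre of the ball, in the complex line joining them,
  meets the ball in an arc.\<close>

lemma not_pluripolar_cball:
  fixes r :: real
  assumes r: "0 < r" shows "\<not> pluripolar (cball 0 r :: (complex ^ 'n) set)"
proof
  assume "pluripolar (cball 0 r :: (complex ^ 'n) set)"
  then obtain u :: "complex ^ 'n \<Rightarrow> ereal" and z1 where u: "plurisubharmonic u" "u z1 \<noteq> -\<infinity>"
    "\<And>z. z \<in> cball 0 r \<Longrightarrow> u z = -\<infinity>" unfolding pluripolar_def by blast
  define v where "v = (\<lambda>\<zeta>. u (z1 + \<zeta> *s (- z1)))"
  have "subharmonic v" using u(1) unfolding plurisubharmonic_def v_def by blast
  then have v: "upper_semicontinuous v" "\<And>z. v z < \<infinity>" "v 0 \<le> circle_mean v 0 1"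
    unfolding subharmonic_def by auto
  obtain n where n: "\<And>\<zeta>. \<zeta> \<in> cball 0 1 \<Longrightarrow> v \<zeta> \<le> ereal (real n)"
    using usc_bounded_above_on_compact[OF v(1,2) compact_cball] by blast
  define P Q where "P = (\<integral>\<^sup>+\<theta>\<in>{0..2 * pi}. e2ennreal (v (0 + of_real 1 * cis \<theta>)) \<partial>lborel)"
    and "Q = (\<integral>\<^sup>+\<theta>\<in>{0..2 * pi}. e2ennreal (- v (0 + of_real 1 * cis \<theta>)) \<partial>lborel)"
  have "P \<le> (\<integral>\<^sup>+\<theta>. ennreal (real n) * indicator {0..2 * pi} \<theta> \<partial>lborel)"
    unfolding P_def
  proof (intro nn_integral_mono mult_right_mono)
    fix \<theta> :: real
    have "e2ennreal (v (0 + of_real 1 * cis \<theta>)) \<le> e2ennreal (ereal (real n))"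
      by (intro e2ennreal_mono n) simp
    then show "e2ennreal (v (0 + of_real 1 * cis \<theta>)) \<le> ennreal (real n)" by simp
  qed simp
  also have "\<dots> < top" by (subst nn_integral_cmult_indicator) (auto simp: ennreal_mult_less_top)
  finally have P: "P < top" .
  have "continuous_on UNIV (\<lambda>\<theta>. z1 + cis \<theta> *s (- z1))"
    by (rule continuous_on_compose2[OF continuous_on_line]) (auto intro!: continuous_intros)
  then have "open ((\<lambda>\<theta>. z1 + cis \<theta> *s (- z1)) -` ball 0 r)"
    by (rule open_vimage[OF open_ball])
  moreover have "0 \<in> (\<lambda>\<theta>. z1 + cis \<theta> *s (- z1)) -` ball 0 r" using r by (simp add: vec_eq_iff)
  ultimately obtain e where e: "0 < e" "ball 0 e \<subseteq> (\<lambda>\<theta>. z1 + cis \<theta> *s (- z1)) -` ball 0 r"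
    by (meson openE)
  define \<eta> where "\<eta> = min (e / 2) 1"
  have \<eta>: "0 < \<eta>" "\<eta> \<le> 2 * pi" using e(1) pi_gt3 by (auto simp: \<eta>_def)
  have arc: "v (0 + of_real 1 * cis \<theta>) = -\<infinity>" if "\<theta> \<in> {0..\<eta>}" for \<theta>
  proof -
    have "\<theta> \<in> ball 0 e" using that e(1) by (auto simp: \<eta>_def)
    then have "z1 + cis \<theta> *s (- z1) \<in> ball 0 r" using e(2) by blast
    then show ?thesis unfolding v_def using u(3) by simp
  qed
  have "(\<integral>\<^sup>+\<theta>. top * indicator {0..\<eta>} \<theta> \<partial>lborel) \<le> Q"
    unfolding Q_def
    by (intro nn_integral_mono) (use arc \<eta> in \<open>auto simp: indicator_def\<close>)
  moreover have "(\<integral>\<^sup>+\<theta>. top * indicator {0..\<eta>} \<theta> \<partial>lborel) = top"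
    using \<eta>(1) by (subst nn_integral_cmult_indicator) (auto simp: ennreal_top_mult)
  ultimately have Q: "Q = top" by (simp add: top_unique)
  obtain p where p: "P = ennreal p" "0 \<le> p" using P by (cases P) auto
  have "circle_mean v 0 1 = ereal (1 / (2 * pi)) * (enn2ereal P - enn2ereal Q)"
    unfolding circle_mean_def P_def Q_def ..
  also have "\<dots> = -\<infinity>" unfolding Q using p by simp
  finally have "v 0 = -\<infinity>" using v(3) by simp
  moreover have "v 0 = u z1" unfolding v_def by (simp add: vec_eq_iff)
  ultimately show False using u(2) by simp
qed

section \<open>Compact nonpluripolar sets\<close>

lemma not_controls_normalized:
  fixes f :: "complex ^ 'n \<Rightarrow> complex ^ 'm"
  assumes f: "holomorphic_map_on f UNIV" and \<mu>: "\<And>k. 0 \<le> \<mu> k" and b: "admits_bernstein f \<mu>"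
    and K: "K \<noteq> {}" and r: "0 < r" and neg: "\<not> controls f \<mu> K (cball 0 r)" and C: "1 \<le> C"
  shows "\<exists>d. \<exists>g\<in>graph_funs f d. 0 < \<mu> d \<and> (\<forall>z\<in>cball 0 r. cmod (g z) \<le> 1) \<and>
    (\<exists>z\<in>cball 0 r. cmod (g z) = 1) \<and> (\<forall>z\<in>K. cmod (g z) \<le> C powr - \<mu> d)"
proof -
  obtain d g M z where g: "g \<in> graph_funs f d" and M: "\<And>z. z \<in> K \<Longrightarrow> cmod (g z) \<le> M"
    and z: "z \<in> cball 0 r" "C powr \<mu> d * M < cmod (g z)"
    using neg C unfolding controls_def by (meson not_le)
  obtain y where y: "y \<in> K" using K by blast
  have M0: "0 \<le> M" using M[OF y] norm_ge_zero order_trans by blast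
  have C1: "1 \<le> C powr \<mu> d" using C \<mu> by (simp add: ge_one_powr_ge_zero)
  have "d \<noteq> 0"
  proof
    assume "d = 0"
    then have "g z = g y" using g graph_funs_0_const by blast
    then have "cmod (g z) \<le> M" using M[OF y] by simp
    also have "\<dots> \<le> C powr \<mu> d * M" using mult_right_mono[OF C1 M0] by simp
    finally show False using z(2) by simp
  qed
  have "\<mu> d \<noteq> 0"
  proof
    assume 0: "\<mu> d = 0"
    obtain B where "1 \<le> B" "\<And>d. 1 \<le> d \<Longrightarrow> 2 \<le> B powr \<mu> d"
      using admits_bernstein_powr_ge_2[OF f \<mu> b] by blast
    then have "2 \<le> B powr \<mu> d" "1 \<le> B" using \<open>d \<noteq> 0\<close> by auto
    then show False using 0 by simp
  qed
  then have \<mu>d: "0 < \<mu> d" using \<mu>[of d] by simp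
  have "cball (0 :: complex ^ 'n) r \<noteq> {}" using r by simp
  then obtain z0 where z0: "z0 \<in> cball 0 r" "\<And>x. x \<in> cball 0 r \<Longrightarrow> cmod (g x) \<le> cmod (g z0)"
    using compact_attains_max_entire[OF graph_funs_entire[OF f g] compact_cball] by blast
  define m where "m = cmod (g z0)"
  have Mm: "C powr \<mu> d * M < m" using z z0(2) unfolding m_def by fastforce
  then have m: "0 < m" using M0 C1 by (metis le_less_trans mult_nonneg_nonneg powr_ge_zero)
  have cm: "cmod (1 / of_real m * x) = cmod x / m" for x using m by (simp add: norm_mult norm_divide)
  show ?thesis
  proof (intro exI[of _ d] bexI[of _ "\<lambda>z. 1 / of_real m * g z"] conjI ballI)
    show "(\<lambda>z. 1 / of_real m * g z) \<in> graph_funs f d" by (rule graph_funs_cmult[OF g])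
    show "0 < \<mu> d" by (rule \<mu>d)
    show "cmod (1 / of_real m * g z) \<le> 1" if "z \<in> cball 0 r" for z
      unfolding cm using z0(2)[OF that] m by (simp add: m_def)
    show "\<exists>z\<in>cball 0 r. cmod (1 / of_real m * g z) = 1"
      unfolding cm using z0(1) m by (intro bexI[of _ z0]) (auto simp: m_def)
    show "cmod (1 / of_real m * g z) \<le> C powr - \<mu> d" if "z \<in> K" for z
    proof -
      have "C powr \<mu> d * cmod (g z) \<le> C powr \<mu> d * M" using M[OF that] by (intro mult_left_mono) auto
      then have "C powr \<mu> d * cmod (g z) \<le> m" using Mm by linarith
      moreover have "0 < C powr \<mu> d" using C1 by linarith
      ultimately show ?thesis
        unfolding cm powr_minus inverse_eq_divide using m by (simp add: pos_divide_le_eq pos_le_divide_eq mult.commute)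
    qed
  qed
qed

text \<open>\<open>t\<close> is fixed by the given ball before \<open>g\<close> is chosen, so \<open>g\<close> can be made small on \<open>K\<close> relative to its
  lower bound on the new ball.\<close>

lemma nested_ball_step:
  fixes f :: "complex ^ 'n \<Rightarrow> complex ^ 'm"
  assumes f: "holomorphic_map_on f UNIV" and \<mu>: "\<And>k. 0 \<le> \<mu> k" and b: "admits_bernstein f \<mu>"
    and K: "K \<noteq> {}" and r: "0 < r" and neg: "\<not> controls f \<mu> K (cball 0 r)" and s: "0 < s" and q: "0 < q"
  shows "\<exists>a' s' d g t. 0 < s' \<and> cball a' s' \<subseteq> cball a s \<and> g \<in> graph_funs f d \<and> 0 < \<mu> d \<and> 0 < t \<and> t \<le> q \<and>
    (\<forall>z\<in>cball 0 r. cmod (g z) \<le> 1) \<and> (\<forall>z\<in>K. cmod (g z) \<le> exp (- (\<mu> d / t))) \<and>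
    (\<forall>z\<in>cball a' s'. exp (- (q * \<mu> d / t)) \<le> cmod (g z))"
proof -
  obtain E where E: "1 \<le> E"
    "\<And>d g M z. g \<in> graph_funs f d \<Longrightarrow> (\<And>z. z \<in> cball a (s / 2) \<Longrightarrow> cmod (g z) \<le> M) \<Longrightarrow>
       z \<in> cball 0 r \<Longrightarrow> cmod (g z) \<le> E powr \<mu> d * M"
    using controlsE[OF admits_bernstein_imp_controls[OF f \<mu> b half_gt_zero[OF s]]] by blast
  have lnE: "0 \<le> ln E" using E(1) by simp
  define t where "t = q / (1 + ln E)"
  have t: "0 < t" "t \<le> q" "q / t = 1 + ln E" using lnE q by (auto simp: t_def field_simps)
  have e1: "1 \<le> exp (1 / t)" using t(1) by simp
  obtain d g where g: "g \<in> graph_funs f d" "0 < \<mu> d" "\<And>z. z \<in> cball 0 r \<Longrightarrow> cmod (g z) \<le> 1"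
    "\<exists>z\<in>cball 0 r. cmod (g z) = 1" "\<And>z. z \<in> K \<Longrightarrow> cmod (g z) \<le> exp (1 / t) powr - \<mu> d"
    using not_controls_normalized[OF f \<mu> b K r neg e1] by blast
  have ent: "entire g" by (rule graph_funs_entire[OF f g(1)])
  define \<epsilon> where "\<epsilon> = exp (- (q * \<mu> d / t))"
  have \<epsilon>: "\<epsilon> = exp (- ((1 + ln E) * \<mu> d))" unfolding \<epsilon>_def t(3)[symmetric] by simp
  have "\<exists>x\<in>cball a (s / 2). \<epsilon> < cmod (g x)"
  proof (rule ccontr)
    assume "\<not> (\<exists>x\<in>cball a (s / 2). \<epsilon> < cmod (g x))"
    then have "\<And>x. x \<in> cball a (s / 2) \<Longrightarrow> cmod (g x) \<le> \<epsilon>" by (auto simp: not_less)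
    then have le: "cmod (g z) \<le> E powr \<mu> d * \<epsilon>" if "z \<in> cball 0 r" for z
      using E(2)[OF g(1) _ that] by blast
    have "E powr \<mu> d * \<epsilon> = exp (ln E * \<mu> d) * exp (- ((1 + ln E) * \<mu> d))"
      unfolding \<epsilon> powr_def using E(1) by (simp add: mult.commute)
    also have "\<dots> = exp (- \<mu> d)" unfolding exp_add[symmetric] by (simp add: algebra_simps)
    also have "\<dots> < 1" using g(2) by simp
    finally show False using g(4) le by fastforce
  qed
  then obtain x where x: "x \<in> cball a (s / 2)" "\<epsilon> < cmod (g x)" by blast
  have "open {y. \<epsilon> < cmod (g y)}"
    by (intro open_Collect_less continuous_on_const continuous_on_norm entire_continuous ent)
  then obtain e where e: "0 < e" "ball x e \<subseteq> {y. \<epsilon> < cmod (g y)}" using x(2) unfolding open_contains_ball by blast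
  define s' where "s' = min (e / 2) (s / 2)"
  have s': "0 < s'" using e(1) s by (simp add: s'_def)
  have "cball x s' \<subseteq> cball a s"
  proof
    fix y assume "y \<in> cball x s'"
    then show "y \<in> cball a s" using x(1) dist_triangle[of a y x] by (auto simp: s'_def)
  qed
  moreover have "\<epsilon> \<le> cmod (g y)" if "y \<in> cball x s'" for y
  proof -
    have "y \<in> ball x e" using that e(1) by (auto simp: s'_def)
    then show ?thesis using e(2) by auto
  qed
  moreover have "cmod (g z) \<le> exp (- (\<mu> d / t))" if "z \<in> K" for z
    using g(5)[OF that] by (simp add: powr_def)
  ultimately show ?thesis
    using s' g(1-3) t(1,2) unfolding \<epsilon>_def by blast
qed

lemma admits_bernstein_controls_nonpluripolar:
  fixes f :: "complex ^ 'n \<Rightarrow> complex ^ 'm"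
  assumes f: "holomorphic_map_on f UNIV" and \<mu>: "\<And>k. 0 \<le> \<mu> k" and b: "admits_bernstein f \<mu>"
    and K: "\<not> pluripolar K" and r: "0 < r"
  shows "controls f \<mu> K (cball 0 r)"
proof (rule ccontr)
  assume neg: "\<not> controls f \<mu> K (cball 0 r)"
  have K0: "K \<noteq> {}" using K pluripolar_empty by blast
  define step where "step = (\<lambda>n (X :: (complex ^ 'n) \<times> real \<times> nat \<times> (complex ^ 'n \<Rightarrow> complex) \<times> real)
      (Y :: (complex ^ 'n) \<times> real \<times> nat \<times> (complex ^ 'n \<Rightarrow> complex) \<times> real).
    case X of (a, s, _) \<Rightarrow> case Y of (a', s', d, g, t) \<Rightarrow>
    0 < s' \<and> cball a' s' \<subseteq> cball a s \<and> g \<in> graph_funs f d \<and> 0 < \<mu> d \<and> 0 < t \<and> t \<le> (1/2) ^ n \<and>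
    (\<forall>z\<in>cball 0 r. cmod (g z) \<le> 1) \<and> (\<forall>z\<in>K. cmod (g z) \<le> exp (- (\<mu> d / t))) \<and>
    (\<forall>z\<in>cball a' s'. exp (- ((1/2) ^ n * \<mu> d / t)) \<le> cmod (g z)))"
  have "\<exists>F. \<forall>n. 0 < fst (snd (F n)) \<and> step n (F n) (F (Suc n))"
  proof (rule dependent_nat_choice)
    show "\<exists>X :: (complex ^ 'n) \<times> real \<times> nat \<times> (complex ^ 'n \<Rightarrow> complex) \<times> real. 0 < fst (snd X)"
      by (rule exI[of _ "(0, 1, 0, \<lambda>_. 0, 0)"]) simp
    fix X :: "(complex ^ 'n) \<times> real \<times> nat \<times> (complex ^ 'n \<Rightarrow> complex) \<times> real" and n
    assume X: "0 < fst (snd X)"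
    obtain a s Z where Z: "X = (a, s, Z)" by (cases X) auto
    have s: "0 < s" using X Z by simp
    have q: "0 < (1/2::real) ^ n" by simp
    obtain a' s' d g t where "0 < s'" "step n X (a', s', d, g, t)"
      using nested_ball_step[OF f \<mu> b K0 r neg s q, of a] unfolding step_def Z prod.case by blast
    then show "\<exists>Y. 0 < fst (snd Y) \<and> step n X Y"
      by (intro exI[of _ "(a', s', d, g, t)"]) simp
  qed
  then obtain F where F: "\<And>n. 0 < fst (snd (F n))" "\<And>n. step n (F n) (F (Suc n))" by blast
  define B where "B = (\<lambda>n. cball (fst (F n)) (fst (snd (F n))))"
  define d where "d = (\<lambda>n. fst (snd (snd (F (Suc n)))))"
  define g where "g = (\<lambda>n. fst (snd (snd (snd (F (Suc n))))))"
  define t where "t = (\<lambda>n. snd (snd (snd (snd (F (Suc n))))))"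
  have step: "B (Suc n) \<subseteq> B n \<and> g n \<in> graph_funs f (d n) \<and> 0 < \<mu> (d n) \<and> 0 < t n \<and> t n \<le> (1/2) ^ n \<and>
    (\<forall>z\<in>cball 0 r. cmod (g n z) \<le> 1) \<and> (\<forall>z\<in>K. cmod (g n z) \<le> exp (- (\<mu> (d n) / t n))) \<and>
    (\<forall>z\<in>B (Suc n). exp (- ((1/2) ^ n * \<mu> (d n) / t n)) \<le> cmod (g n z))" for n
    using F(2)[of n] unfolding step_def B_def d_def g_def t_def
    by (cases "F n"; cases "F (Suc n)") auto
  have "B n \<subseteq> B m" if "m \<le> n" for m n
    using lift_Suc_antimono_le[of B, OF _ that] step by blast
  moreover have "compact (B n)" "B n \<noteq> {}" for n using F(1)[of n] by (auto simp: B_def not_less)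
  ultimately have "\<Inter>(range B) \<noteq> {}" by (intro compact_nest) auto
  then obtain z0 where z0: "\<And>n. z0 \<in> B n" by blast
  define c where "c = (\<lambda>n. t n / \<mu> (d n))"
  have "pluripolar K"
  proof (rule pluripolar_criterion[of g c K z0])
    show "entire (g k)" for k using graph_funs_entire[OF f] step by blast
    show "0 < c k" for k using step[of k] by (simp add: c_def)
    show "cmod (g k z) \<le> exp (- 1 / c k)" if "z \<in> K" for k z
      using step[of k] that by (auto simp: c_def)
    show "exp (- ((1 / 2) ^ k) / c k) \<le> cmod (g k z0)" for k
      using step[of k] z0[of "Suc k"] by (auto simp: c_def)
    fix R
    obtain D where D: "1 \<le> D"
      "\<And>d g M z. g \<in> graph_funs f d \<Longrightarrow> (\<And>z. z \<in> cball 0 r \<Longrightarrow> cmod (g z) \<le> M) \<Longrightarrow>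
         z \<in> cball 0 R \<Longrightarrow> cmod (g z) \<le> D powr \<mu> d * M"
      using controlsE[OF admits_bernstein_imp_controls[OF f \<mu> b r]] by blast
    have "cmod (g k z) \<le> exp (ln D * (1/2) ^ k / c k)" if z: "z \<in> cball 0 R" for k z
    proof -
      have "cmod (g k z) \<le> D powr \<mu> (d k) * 1"
        by (rule D(2)[OF _ _ z]) (use step[of k] in auto)
      also have "\<dots> = exp (ln D * \<mu> (d k) * 1)" using D(1) by (simp add: powr_def mult.commute)
      also have "\<dots> \<le> exp (ln D * \<mu> (d k) * ((1/2) ^ k / t k))"
        using D(1) step[of k] by (simp add: mult_left_mono field_simps)
      also have "ln D * \<mu> (d k) * ((1/2) ^ k / t k) = ln D * (1/2) ^ k / c k"
        using step[of k] by (simp add: c_def field_simps)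
      finally show ?thesis .
    qed
    then show "\<exists>D\<ge>0. \<forall>k. \<forall>z\<in>cball 0 R. cmod (g k z) \<le> exp (D * (1/2) ^ k / c k)"
      using D(1) by (intro exI[of _ "ln D"]) auto
  qed
  then show False using K by blast
qed

lemma admits_bernstein_iff_nonpluripolar:
  fixes f :: "complex ^ 'n \<Rightarrow> complex ^ 'm"
  assumes f: "holomorphic_map_on f UNIV" and \<mu>: "\<And>k. 0 \<le> \<mu> k"
  shows "admits_bernstein f \<mu> \<longleftrightarrow>
    (\<forall>K. compact K \<longrightarrow> \<not> pluripolar K \<longrightarrow>
      (\<exists>C :: real \<Rightarrow> real. (\<forall>r>0. 0 \<le> C r) \<and>
        (\<forall>r>0. \<forall>p. max_on_graph f p (cball 0 r)
          \<le> rpow (C r) (\<mu> (total_degree p)) * max_on_graph f p K)))" (is "_ \<longleftrightarrow> ?R")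
proof
  assume b: "admits_bernstein f \<mu>"
  show ?R
  proof (intro allI impI)
    fix K :: "(complex ^ 'n) set" assume K: "compact K" "\<not> pluripolar K"
    have K0: "K \<noteq> {}" using K pluripolar_empty by blast
    have "\<exists>C\<ge>0. \<forall>p. max_on_graph f p (cball 0 r) \<le> rpow C (\<mu> (total_degree p)) * max_on_graph f p K"
      if r: "0 < r" for r
      using admits_bernstein_controls_nonpluripolar[OF f \<mu> b K(2) r] r
      by (subst (asm) controls_iff_max_on_graph[OF f \<mu> K(1) K0]) (auto simp: not_less)
    then show "\<exists>C :: real \<Rightarrow> real. (\<forall>r>0. 0 \<le> C r) \<and> (\<forall>r>0. \<forall>p. max_on_graph f p (cball 0 r)
          \<le> rpow (C r) (\<mu> (total_degree p)) * max_on_graph f p K)"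
      by metis
  qed
next
  assume R: ?R
  show "admits_bernstein f \<mu>"
    unfolding admits_bernstein_def
  proof (intro allI impI)
    fix r :: real assume r: "0 < r"
    obtain C :: "real \<Rightarrow> real" where C: "\<And>r. 0 < r \<Longrightarrow> 0 \<le> C r"
      "\<And>r' p. 0 < r' \<Longrightarrow> max_on_graph f p (cball 0 r') \<le> rpow (C r') (\<mu> (total_degree p)) * max_on_graph f p (cball 0 r)"
      using R not_pluripolar_cball[OF r] by (metis compact_cball)
    then show "\<exists>C\<ge>0. \<forall>p. max_on_graph f p (cball 0 (exp 1 * r))
        \<le> rpow C (\<mu> (total_degree p)) * max_on_graph f p (cball 0 r)"
      using r by (intro exI[of _ "C (exp 1 * r)"]) auto
  qed
qed

section \<open>Lagrange interpolation on complex lines\<close>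

definition lagrange_poly :: "nat \<Rightarrow> nat \<Rightarrow> complex poly"
  where "lagrange_poly D i =
    (\<Prod>j\<in>{..D} - {i}. [:- of_nat j / (of_nat i - of_nat j), 1 / (of_nat i - of_nat j):])"

lemma degree_lagrange_poly: "i \<le> D \<Longrightarrow> degree (lagrange_poly D i) \<le> D"
proof -
  assume i: "i \<le> D"
  let ?f = "\<lambda>j. [:- of_nat j / (of_nat i - of_nat j), 1 / (of_nat i - of_nat j):] :: complex poly"
  have "degree (lagrange_poly D i) \<le> sum (degree \<circ> ?f) ({..D} - {i})"
    unfolding lagrange_poly_def by (rule degree_prod_sum_le) simp
  also have "\<dots> \<le> (\<Sum>j\<in>{..D} - {i}. 1)" by (rule sum_mono) simp
  also have "\<dots> = D" using i by simp
  finally show ?thesis .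
qed

lemma poly_lagrange_poly:
  assumes "i \<le> D" "j \<le> D"
  shows "poly (lagrange_poly D i) (of_nat j) = (if i = j then 1 else 0)"
proof (cases "i = j")
  case True
  have "poly (lagrange_poly D i) (of_nat i) = (\<Prod>j\<in>{..D} - {i}. 1)"
    unfolding lagrange_poly_def poly_prod by (rule prod.cong) (auto simp: diff_divide_distrib[symmetric])
  then show ?thesis using True by simp
next
  case False
  then have "poly (lagrange_poly D i) (of_nat j) = 0"
    unfolding lagrange_poly_def poly_prod using assms by (intro prod_zero) auto
  then show ?thesis using False by simp
qed

lemma lagrange_interpolation:
  fixes q :: "complex poly"
  assumes "degree q \<le> D"
  shows "poly q \<zeta> = (\<Sum>i\<le>D. poly (lagrange_poly D i) \<zeta> * poly q (of_nat i))"
proof -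
  define p where "p = (\<Sum>i\<le>D. smult (poly q (of_nat i)) (lagrange_poly D i))"
  have deg: "degree p \<le> D" unfolding p_def
    by (intro degree_sum_le) (auto simp: degree_lagrange_poly)
  have card: "card ((of_nat :: nat \<Rightarrow> complex) ` {..D}) = D + 1"
    by (subst card_image) (auto simp: inj_on_def)
  have "poly p (of_nat j) = poly q (of_nat j)" if "j \<le> D" for j
    using that by (simp add: p_def poly_sum poly_lagrange_poly sum.delta if_distrib cong: if_cong)
  then have "p = q"
    using deg assms card by (intro poly_eqI_degree[of "of_nat ` {..D}"]) auto
  then have "poly q \<zeta> = poly p \<zeta>" by simp
  then show ?thesis by (simp add: p_def poly_sum mult.commute)
qed

definition lagrange_on_lines :: "nat \<Rightarrow> (complex ^ 'n \<Rightarrow> complex) \<Rightarrow> bool"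
  where "lagrange_on_lines D y \<longleftrightarrow>
    (\<forall>w b \<zeta>. y (w + \<zeta> *s b) = (\<Sum>i\<le>D. poly (lagrange_poly D i) \<zeta> * y (w + of_nat i *s b)))"

lemma lagrange_on_linesI:
  assumes "\<And>w b. \<exists>q. degree q \<le> D \<and> (\<forall>\<zeta>. y (w + \<zeta> *s b) = poly q \<zeta>)"
  shows "lagrange_on_lines D y"
  unfolding lagrange_on_lines_def
proof (intro allI)
  fix w b and \<zeta> :: complex
  obtain q where q: "degree q \<le> D" "\<And>\<zeta>. y (w + \<zeta> *s b) = poly q \<zeta>" using assms by blast
  show "y (w + \<zeta> *s b) = (\<Sum>i\<le>D. poly (lagrange_poly D i) \<zeta> * y (w + of_nat i *s b))"
    unfolding q(2) by (rule lagrange_interpolation[OF q(1)])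
qed

lemma lagrange_on_lines_coord:
  assumes "lagrange_on_lines D y"
  shows "y z = (\<Sum>i\<le>D. poly (lagrange_poly D i) (z $ k) * y (\<chi> j. if j = k then of_nat i else z $ j))"
proof -
  define w where "w = (\<chi> j. if j = k then 0 else z $ j)"
  have "w + z $ k *s axis k 1 = z" by (auto simp: w_def vec_eq_iff axis_def)
  moreover have "w + of_nat i *s axis k 1 = (\<chi> j. if j = k then of_nat i else z $ j)" for i
    by (auto simp: w_def vec_eq_iff axis_def)
  moreover have "y (w + z $ k *s axis k 1) =
      (\<Sum>i\<le>D. poly (lagrange_poly D i) (z $ k) * y (w + of_nat i *s axis k 1))"
    using assms unfolding lagrange_on_lines_def by blast
  ultimately show ?thesis by simp
qed

lemma polyfun_poly_coord: "degree q \<le> D \<Longrightarrow> polyfun D (\<lambda>z. poly q (z $ k))"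
proof -
  assume q: "degree q \<le> D"
  have "polyfun D (\<lambda>z. \<Sum>i\<le>degree q. coeff q i * (z $ k) ^ i)"
  proof (intro polyfun_sum polyfun_cmult)
    fix i assume "i \<in> {..degree q}"
    then show "polyfun D (\<lambda>z. (z $ k) ^ i)"
      using polyfun_mono[OF polyfun_power[OF polyfun_coord[OF order_refl], of i k]] q by simp
  qed
  then show ?thesis by (simp add: poly_altdef)
qed

lemma polyfun_of_lagrange_on_lines:
  fixes y :: "complex ^ 'n \<Rightarrow> complex"
  assumes y: "lagrange_on_lines D y"
  shows "\<exists>d. polyfun d y"
proof -
  have "polyfun (card S * D) (\<lambda>z. y (\<chi> j. if j \<in> S then z $ j else z0 $ j))" if "finite S" for S :: "'n set" and z0
    using that
  proof (induction S arbitrary: z0)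
    case empty
    then show ?case by (simp add: polyfun_const)
  next
    case (insert k S)
    have eq: "y (\<chi> j. if j \<in> insert k S then z $ j else z0 $ j) =
        (\<Sum>i\<le>D. poly (lagrange_poly D i) (z $ k) *
          y (\<chi> j. if j \<in> S then z $ j else (\<chi> j. if j = k then of_nat i else z0 $ j) $ j))" for z
      unfolding lagrange_on_lines_coord[OF y, of "\<chi> j. if j \<in> insert k S then z $ j else z0 $ j" k]
      using insert.hyps by (intro sum.cong refl arg_cong2[of _ _ _ _ "(*)"] arg_cong[of _ _ y])
        (auto simp: vec_eq_iff)
    show ?case unfolding eq card_insert_disjoint[OF insert.hyps] mult_Suc
      by (intro polyfun_sum polyfun_mult polyfun_poly_coord degree_lagrange_poly insert.IH) simp
  qed
  from this[of UNIV 0] show ?thesis by auto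
qed

lemma zero_of_lagrange_on_lines:
  fixes y :: "complex ^ 'n \<Rightarrow> complex"
  assumes y: "lagrange_on_lines D y"
    and grid: "\<And>\<alpha> :: 'n \<Rightarrow> nat. (\<And>k. \<alpha> k \<le> D) \<Longrightarrow> y (\<chi> k. of_nat (\<alpha> k)) = 0"
  shows "y z = 0"
proof -
  have "\<forall>z. (\<forall>k. k \<notin> S \<longrightarrow> (\<exists>i\<le>D. z $ k = of_nat i)) \<longrightarrow> y z = 0" if "finite S" for S :: "'n set"
    using that
  proof (induction S)
    case empty
    show ?case
    proof (intro allI impI)
      fix z :: "complex ^ 'n" assume "\<forall>k. k \<notin> {} \<longrightarrow> (\<exists>i\<le>D. z $ k = of_nat i)"
      then obtain \<alpha> where "\<And>k. \<alpha> k \<le> D" "\<And>k. z $ k = of_nat (\<alpha> k)" by simp metis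
      then show "y z = 0" using grid[of \<alpha>] by (metis vec_lambda_unique)
    qed
  next
    case (insert k S)
    show ?case
    proof (intro allI impI)
      fix z :: "complex ^ 'n" assume z: "\<forall>j. j \<notin> insert k S \<longrightarrow> (\<exists>i\<le>D. z $ j = of_nat i)"
      have "y (\<chi> j. if j = k then of_nat i else z $ j) = 0" if "i \<le> D" for i
        using insert.IH z that by auto
      then show "y z = 0" unfolding lagrange_on_lines_coord[OF y, of z k] by simp
    qed
  qed
  from this[of UNIV] show ?thesis by simp
qed

lemma polyfun_on_line:
  assumes "polyfun d \<phi>"
  shows "\<exists>q. degree q \<le> d \<and> (\<forall>\<zeta>. \<phi> (w + \<zeta> *s b) = poly q \<zeta>)"
proof -
  obtain c where c: "\<And>x. \<phi> x = (\<Sum>\<alpha> | mon_degree \<alpha> \<le> d. c \<alpha> * mon_eval \<alpha> x)"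
    using polyfun_representation[OF assms] by blast
  define m where "m = (\<lambda>\<alpha>. \<Prod>i\<in>UNIV. [:w $ i, b $ i:] ^ Poly_Mapping.lookup \<alpha> i)"
  have m: "degree (m \<alpha>) \<le> mon_degree \<alpha>" for \<alpha>
  proof -
    have "degree (m \<alpha>) \<le> sum (degree \<circ> (\<lambda>i. [:w $ i, b $ i:] ^ Poly_Mapping.lookup \<alpha> i)) UNIV"
      unfolding m_def by (rule degree_prod_sum_le) simp
    also have "\<dots> \<le> mon_degree \<alpha>"
    proof (rule sum_mono)
      fix i
      have "degree ([:w $ i, b $ i:] ^ Poly_Mapping.lookup \<alpha> i) \<le> degree [:w $ i, b $ i:] * Poly_Mapping.lookup \<alpha> i"
        by (rule degree_power_le)
      also have "\<dots> \<le> 1 * Poly_Mapping.lookup \<alpha> i" by (rule mult_right_mono) auto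
      finally show "(degree \<circ> (\<lambda>i. [:w $ i, b $ i:] ^ Poly_Mapping.lookup \<alpha> i)) i \<le> Poly_Mapping.lookup \<alpha> i" by simp
    qed
    finally show ?thesis .
  qed
  define q where "q = (\<Sum>\<alpha> | mon_degree \<alpha> \<le> d. smult (c \<alpha>) (m \<alpha>))"
  have "degree q \<le> d" unfolding q_def
    by (intro degree_sum_le finite_mon_degree_le)
      (metis (mono_tags, lifting) degree_smult_le m mem_Collect_eq order_trans)
  moreover have "\<phi> (w + \<zeta> *s b) = poly q \<zeta>" for \<zeta>
    unfolding c q_def by (simp add: poly_sum poly_prod m_def algebra_simps)
  ultimately show ?thesis by blast
qed

section \<open>Algebraic entire functions are polynomials\<close>

lemma poly_growth: "\<exists>S\<ge>0. \<forall>z. 1 \<le> cmod z \<longrightarrow> cmod (poly q z) \<le> S * cmod z ^ D" if "degree q \<le> D" for q :: "complex poly"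
proof (intro exI[of _ "\<Sum>i\<le>degree q. cmod (coeff q i)"] conjI allI impI)
  fix z :: complex assume z: "1 \<le> cmod z"
  have "cmod (poly q z) \<le> (\<Sum>i\<le>degree q. cmod (coeff q i) * cmod z ^ D)"
    unfolding poly_altdef
  proof (rule sum_norm_le)
    fix i assume "i \<in> {..degree q}"
    then show "cmod (coeff q i * z ^ i) \<le> cmod (coeff q i) * cmod z ^ D"
      using that z unfolding norm_mult norm_power by (intro mult_left_mono power_increasing) auto
  qed
  then show "cmod (poly q z) \<le> (\<Sum>i\<le>degree q. cmod (coeff q i)) * cmod z ^ D"
    by (simp add: sum_distrib_right)
qed (simp add: sum_nonneg)

lemma poly_bounded_below:
  assumes "q \<noteq> (0 :: complex poly)"
  obtains c A where "0 < c" "\<And>z. A \<le> cmod z \<Longrightarrow> c \<le> cmod (poly q z)"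
proof (cases q)
  case (pCons a p)
  show thesis
  proof (cases "p = 0")
    case True
    then have "a \<noteq> 0" using assms pCons by simp
    then show thesis using True pCons by (intro that[of "cmod a" 0]) auto
  next
    case False
    then obtain r where "\<forall>z. r \<le> cmod z \<longrightarrow> 1 \<le> cmod (poly (pCons a p) z)"
      using poly_infinity[OF False, of 1 a] by blast
    then show thesis using pCons by (intro that[of 1 r]) auto
  qed
qed

lemma entire_polynomial_growth:
  assumes h: "h holomorphic_on UNIV" and growth: "\<And>z. A \<le> cmod z \<Longrightarrow> cmod (h z) \<le> B * cmod z ^ D"
  shows "\<exists>q. degree q \<le> D \<and> (\<forall>\<zeta>. h \<zeta> = poly q \<zeta>)"
proof -
  define q where "q = (\<Sum>k\<le>D. monom ((deriv ^^ k) h 0 / fact k) k)"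
  have "h \<zeta> = (\<Sum>k\<le>D. (deriv ^^ k) h 0 / fact k * \<zeta> ^ k)" for \<zeta>
    by (rule Liouville_polynomial[OF h]) (rule growth)
  then have "h \<zeta> = poly q \<zeta>" for \<zeta> by (simp add: q_def poly_sum poly_monom)
  moreover have "degree q \<le> D" unfolding q_def
    by (intro degree_sum_le) (auto intro: order_trans[OF degree_monom_le])
  ultimately show ?thesis by blast
qed

lemma algebraic_entire_growth:
  assumes h: "h holomorphic_on UNIV" and deg: "\<And>l. degree (c l) \<le> D" and cL: "c L \<noteq> 0"
    and alg: "\<And>\<zeta>. (\<Sum>l\<le>L. poly (c l) \<zeta> * h \<zeta> ^ l) = 0"
  shows "\<exists>q. degree q \<le> D \<and> (\<forall>\<zeta>. h \<zeta> = poly q \<zeta>)"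
proof -
  have "\<forall>l. \<exists>S\<ge>0. \<forall>z. 1 \<le> cmod z \<longrightarrow> cmod (poly (c l) z) \<le> S * cmod z ^ D"
    using poly_growth[OF deg] by blast
  then obtain S where S: "\<And>l. 0 \<le> S l" "\<And>l z. 1 \<le> cmod z \<Longrightarrow> cmod (poly (c l) z) \<le> S l * cmod z ^ D"
    by metis
  obtain c0 A where c0: "0 < c0" "\<And>z. A \<le> cmod z \<Longrightarrow> c0 \<le> cmod (poly (c L) z)"
    using poly_bounded_below[OF cL] by blast
  define T where "T = (\<Sum>l<L. S l)"
  have T: "0 \<le> T" unfolding T_def using S(1) by (simp add: sum_nonneg)
  have growth: "cmod (h z) \<le> (1 + T / c0) * cmod z ^ D" if z: "max A 1 \<le> cmod z" for z
  proof (cases "cmod (h z) \<le> 1")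
    case True
    also have "1 \<le> cmod z ^ D" using z by (simp add: one_le_power)
    also have "\<dots> \<le> (1 + T / c0) * cmod z ^ D"
      using T c0(1) z by (simp add: algebra_simps)
    finally show ?thesis .
  next
    case False
    have L0: "L \<noteq> 0"
    proof
      assume "L = 0"
      then have "poly (c L) z = 0" using alg[of z] by simp
      then show False using c0 z by force
    qed
    then obtain L' where L': "L = Suc L'" by (cases L) auto
    have "(\<Sum>l\<le>L. poly (c l) z * h z ^ l) = (\<Sum>l<L. poly (c l) z * h z ^ l) + poly (c L) z * h z ^ L"
      by (simp add: lessThan_Suc_atMost[symmetric])
    then have "poly (c L) z * h z ^ L = - (\<Sum>l<L. poly (c l) z * h z ^ l)"
      using alg[of z] by (simp add: add_eq_0_iff)
    then have "cmod (poly (c L) z) * cmod (h z) ^ L = cmod (\<Sum>l<L. poly (c l) z * h z ^ l)"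
      by (metis norm_minus_cancel norm_mult norm_power)
    also have "\<dots> \<le> (\<Sum>l<L. S l * cmod z ^ D * cmod (h z) ^ L')"
    proof (rule sum_norm_le)
      fix l assume "l \<in> {..<L}"
      then show "cmod (poly (c l) z * h z ^ l) \<le> S l * cmod z ^ D * cmod (h z) ^ L'"
        unfolding norm_mult norm_power using S z False L'
        by (intro mult_mono power_increasing) auto
    qed
    also have "\<dots> = T * cmod z ^ D * cmod (h z) ^ L'" by (simp add: T_def sum_distrib_right)
    finally have "cmod (poly (c L) z) * cmod (h z) * cmod (h z) ^ L' \<le> T * cmod z ^ D * cmod (h z) ^ L'"
      by (simp add: L' mult_ac)
    moreover have "0 < cmod (h z) ^ L'" using False by (intro zero_less_power) linarith
    ultimately have "cmod (poly (c L) z) * cmod (h z) \<le> T * cmod z ^ D" by (rule mult_right_le_imp_le)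
    moreover have "c0 * cmod (h z) \<le> cmod (poly (c L) z) * cmod (h z)"
      using c0(2) z by (intro mult_right_mono) auto
    ultimately have "c0 * cmod (h z) \<le> T * cmod z ^ D" by linarith
    then have "cmod (h z) \<le> T / c0 * cmod z ^ D" using c0(1) by (simp add: field_simps)
    also have "\<dots> \<le> (1 + T / c0) * cmod z ^ D" by (intro mult_right_mono) auto
    finally show ?thesis .
  qed
  then show ?thesis by (rule entire_polynomial_growth[OF h])
qed

text \<open>On the complex lines through a point where the leading coefficient does not vanish, \<open>y\<close> is a
  polynomial of degree at most \<open>D\<close>. These points are dense, and Lagrange's formula is a closed
  condition.\<close>

lemma algebraic_entire_imp_polyfun:
  fixes y :: "complex ^ 'n \<Rightarrow> complex"
  assumes y: "entire y" and p: "\<And>l. polyfun D (p l)" and w0: "p L w0 \<noteq> 0"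
    and alg: "\<And>z. (\<Sum>l\<le>L. p l z * y z ^ l) = 0"
  shows "\<exists>d. polyfun d y"
proof (rule polyfun_of_lagrange_on_lines[of D])
  have pe: "entire (p L)"
    using entire_polyfun[OF p[of L], of "\<lambda>z. z"] entire_coord by blast
  show "lagrange_on_lines D y"
    unfolding lagrange_on_lines_def
  proof (intro allI)
    fix w b and \<zeta> :: complex
    define \<Delta> where "\<Delta> = (\<lambda>w. y (w + \<zeta> *s b) - (\<Sum>i\<le>D. poly (lagrange_poly D i) \<zeta> * y (w + of_nat i *s b)))"
    have "entire \<Delta>" unfolding \<Delta>_def
      by (intro entire_diff entire_sum entire_mult entire_const entire_translate y)
    have 0: "\<Delta> w = 0" if w: "p L w \<noteq> 0" for w
    proof -
      have "\<forall>l. \<exists>q. degree q \<le> D \<and> (\<forall>\<zeta>. p l (w + \<zeta> *s b) = poly q \<zeta>)"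
        using polyfun_on_line[OF p] by blast
      then obtain c where c: "\<And>l. degree (c l) \<le> D" "\<And>l \<zeta>. p l (w + \<zeta> *s b) = poly (c l) \<zeta>" by metis
      have "poly (c L) 0 \<noteq> 0" using w unfolding c(2)[symmetric] by (simp add: vec_eq_iff)
      then have "c L \<noteq> 0" by fastforce
      have "\<exists>q. degree q \<le> D \<and> (\<forall>\<zeta>. y (w + \<zeta> *s b) = poly q \<zeta>)"
      proof (rule algebraic_entire_growth[where c=c and L=L])
        show "(\<Sum>l\<le>L. poly (c l) \<zeta> * y (w + \<zeta> *s b) ^ l) = 0" for \<zeta>
          unfolding c(2)[symmetric] by (rule alg)
      qed (use c(1) \<open>c L \<noteq> 0\<close> entire_line[OF y] in auto)
      then obtain q where q: "degree q \<le> D \<and> (\<forall>\<zeta>. y (w + \<zeta> *s b) = poly q \<zeta>)" ..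
      then have q2: "y (w + \<zeta> *s b) = poly q \<zeta>" for \<zeta> by simp
      show ?thesis unfolding \<Delta>_def q2 using lagrange_interpolation[of q D \<zeta>] q by simp
    qed
    have "\<Delta> w = 0"
    proof (rule ccontr)
      assume "\<Delta> w \<noteq> 0"
      moreover have "open {w. \<Delta> w \<noteq> 0}"
        by (rule open_Collect_neq[OF entire_continuous[OF \<open>entire \<Delta>\<close>] continuous_on_const])
      ultimately obtain e where e: "0 < e" "ball w e \<subseteq> {w. \<Delta> w \<noteq> 0}"
        unfolding open_contains_ball by blast
      then have "p L z = 0" if "z \<in> ball w e" for z using 0 that by blast
      then have "p L w0 = 0" by (rule entire_zero_on_ball[OF pe e(1)])
      then show False using w0 by simp
    qed
    then show "y (w + \<zeta> *s b) = (\<Sum>i\<le>D. poly (lagrange_poly D i) \<zeta> * y (w + of_nat i *s b))"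
      unfolding \<Delta>_def by simp
  qed
qed

section \<open>Homogeneous expansion at the origin\<close>

definition hom_part :: "(complex ^ 'n \<Rightarrow> complex) \<Rightarrow> nat \<Rightarrow> complex ^ 'n \<Rightarrow> complex"
  where "hom_part g k z = taylor_coeff (\<lambda>\<zeta>. g (\<zeta> *s z)) k"

lemma entire_radial: "entire g \<Longrightarrow> (\<lambda>\<zeta>. g (\<zeta> *s z)) holomorphic_on S"
  using entire_line[of g 0 z S] by simp

lemma hom_part_growth:
  fixes g :: "complex ^ 'n \<Rightarrow> complex"
  assumes g: "entire g"
  obtains M where "0 \<le> M" "\<And>k z. cmod (hom_part g k z) \<le> M * (norm z + 1) ^ k"
proof -
  obtain M where M: "0 \<le> M" "\<And>z. z \<in> cball 0 1 \<Longrightarrow> cmod (g z) \<le> M"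
    using compact_bounded_entire[OF g compact_cball] by blast
  have "cmod (hom_part g k z) \<le> M * (norm z + 1) ^ k" for k z
  proof -
    have R: "0 < 1 / (norm z + 1)" by (simp add: add_nonneg_pos)
    have "cmod (taylor_coeff (\<lambda>\<zeta>. g (\<zeta> *s z)) k) \<le> M / (1 / (norm z + 1)) ^ k"
    proof (rule taylor_coeff_bound[OF entire_radial[OF g] R])
      fix \<zeta> :: complex assume "cmod \<zeta> \<le> 1 / (norm z + 1)"
      then have "cmod \<zeta> * norm z \<le> 1 / (norm z + 1) * (norm z + 1)"
        by (intro mult_mono') auto
      also have "\<dots> = 1" using R by simp
      finally show "cmod (g (\<zeta> *s z)) \<le> M" by (intro M(2)) (simp add: norm_vector_scalar_mult)
    qed
    then show ?thesis by (simp add: hom_part_def power_divide)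
  qed
  with M(1) show thesis by (rule that)
qed

lemma hom_part_holomorphic_on_lines:
  fixes g :: "complex ^ 'n \<Rightarrow> complex"
  assumes g: "entire g"
  shows "(\<lambda>\<xi>. hom_part g k (w + \<xi> *s b)) holomorphic_on UNIV"
proof (induction k rule: less_induct)
  case (less k)
  define i where "i = (\<lambda>N. inverse (of_nat (Suc N)) :: complex)"
  define F where "F = (\<lambda>N \<xi>. of_nat (Suc N) ^ k *
    (g (i N *s (w + \<xi> *s b)) - (\<Sum>j<k. hom_part g j (w + \<xi> *s b) * i N ^ j)))"
  have i1: "of_nat (Suc N) ^ k * i N ^ k = 1" for N
    unfolding i_def power_mult_distrib[symmetric] by (simp del: of_nat_Suc)
  have ni: "cmod (i N) = 1 / real (Suc N)" for N
    unfolding i_def norm_inverse norm_of_nat by (simp add: divide_inverse)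
  show ?case
  proof (rule holomorphic_uniform_sequence[of UNIV F])
    fix N
    have eq: "(\<lambda>\<xi>. g (i N *s (w + \<xi> *s b))) = (\<lambda>\<xi>. g (i N *s w + \<xi> *s (i N *s b)))"
      by (intro ext arg_cong[of _ _ g]) (simp add: vec_eq_iff algebra_simps)
    have "(\<lambda>\<xi>. g (i N *s (w + \<xi> *s b))) holomorphic_on UNIV"
      unfolding eq by (rule entire_line[OF g])
    then show "F N holomorphic_on UNIV"
      unfolding F_def by (intro holomorphic_intros less) auto
  next
    fix \<xi>0 :: complex
    define \<rho> where "\<rho> = norm w + (cmod \<xi>0 + 1) * norm b"
    obtain M where M: "0 \<le> M" "\<And>z. z \<in> cball 0 \<rho> \<Longrightarrow> cmod (g z) \<le> M"
      using compact_bounded_entire[OF g compact_cball] by blast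
    have bound: "cmod (F N \<xi> - hom_part g k (w + \<xi> *s b)) \<le> 2 * M / real (Suc N)"
      if \<xi>: "\<xi> \<in> cball \<xi>0 1" and N: "1 \<le> N" for N \<xi>
    proof -
      define z where "z = w + \<xi> *s b"
      have "cmod \<xi> \<le> cmod \<xi>0 + 1"
        using \<xi> norm_triangle_ineq2[of \<xi> \<xi>0] by (simp add: dist_norm norm_minus_commute)
      then have "norm (\<xi> *s b) \<le> (cmod \<xi>0 + 1) * norm b"
        unfolding norm_vector_scalar_mult by (rule mult_right_mono) simp
      then have z: "norm z \<le> \<rho>" unfolding \<rho>_def z_def using norm_triangle_ineq[of w "\<xi> *s b"] by simp
      have "cmod (g (i N *s z) - (\<Sum>j<Suc k. taylor_coeff (\<lambda>\<zeta>. g (\<zeta> *s z)) j * i N ^ j)) \<le> 2 * M * (cmod (i N) / 1) ^ Suc k"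
      proof (rule taylor_remainder_bound[OF entire_radial[OF g]])
        fix \<zeta> :: complex assume "cmod \<zeta> \<le> 1"
        then have "cmod \<zeta> * norm z \<le> 1 * \<rho>" using z by (intro mult_mono') auto
        then show "cmod (g (\<zeta> *s z)) \<le> M" by (intro M(2)) (simp add: norm_vector_scalar_mult)
      next
        show "cmod (i N) \<le> 1 / 2" unfolding ni using N by (intro divide_left_mono) auto
      qed simp
      then have rem: "cmod (g (i N *s z) - (\<Sum>j<Suc k. hom_part g j z * i N ^ j)) \<le> 2 * M * (1 / real (Suc N)) ^ Suc k"
        unfolding hom_part_def ni by simp
      have "F N \<xi> - hom_part g k z = of_nat (Suc N) ^ k * (g (i N *s z) - (\<Sum>j<k. hom_part g j z * i N ^ j))
          - (of_nat (Suc N) ^ k * i N ^ k) * hom_part g k z"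
        unfolding i1 F_def z_def by simp
      also have "\<dots> = of_nat (Suc N) ^ k * (g (i N *s z) - (\<Sum>j<Suc k. hom_part g j z * i N ^ j))"
        by (simp add: right_diff_distrib distrib_left mult_ac del: of_nat_Suc)
      also have "cmod \<dots> \<le> real (Suc N) ^ k * (2 * M * (1 / real (Suc N)) ^ Suc k)"
        unfolding norm_mult norm_power norm_of_nat by (intro mult_left_mono rem) simp
      also have "\<dots> = 2 * M / real (Suc N)"
        by (simp add: power_divide del: of_nat_Suc)
      finally show ?thesis unfolding z_def .
    qed
    have "uniform_limit (cball \<xi>0 1) F (\<lambda>\<xi>. hom_part g k (w + \<xi> *s b)) sequentially"
    proof (rule uniform_limitI)
      fix e :: real assume e: "0 < e"
      obtain N0 where N0: "2 * M / e < real N0" using reals_Archimedean2 by blast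
      have "dist (F N \<xi>) (hom_part g k (w + \<xi> *s b)) < e"
        if N: "max N0 1 \<le> N" and \<xi>: "\<xi> \<in> cball \<xi>0 1" for N \<xi>
      proof -
        have "2 * M / e < real (Suc N)" using N0 N by simp
        then have "2 * M / real (Suc N) < e" using e by (simp add: field_simps del: of_nat_Suc)
        then show ?thesis using bound[OF \<xi>, of N] N unfolding dist_norm by linarith
      qed
      then show "\<forall>\<^sub>F N in sequentially. \<forall>\<xi>\<in>cball \<xi>0 1. dist (F N \<xi>) (hom_part g k (w + \<xi> *s b)) < e"
        unfolding eventually_sequentially by blast
    qed
    then show "\<exists>d>0. cball \<xi>0 d \<subseteq> UNIV \<and> uniform_limit (cball \<xi>0 d) F (\<lambda>\<xi>. hom_part g k (w + \<xi> *s b)) sequentially"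
      by (intro exI[of _ 1]) simp
  qed simp
qed

lemma hom_part_on_line:
  fixes g :: "complex ^ 'n \<Rightarrow> complex"
  assumes g: "entire g"
  shows "\<exists>q. degree q \<le> k \<and> (\<forall>\<xi>. hom_part g k (w + \<xi> *s b) = poly q \<xi>)"
proof -
  obtain M where M: "0 \<le> M" "\<And>k z. cmod (hom_part g k z) \<le> M * (norm z + 1) ^ k"
    using hom_part_growth[OF g] by blast
  show ?thesis
  proof (rule entire_polynomial_growth[OF hom_part_holomorphic_on_lines[OF g]])
    fix \<xi> :: complex assume \<xi>: "1 \<le> cmod \<xi>"
    have "norm (w + \<xi> *s b) + 1 \<le> norm w + cmod \<xi> * norm b + 1"
      using norm_triangle_ineq[of w "\<xi> *s b"] by (simp add: norm_vector_scalar_mult)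
    also have "\<dots> \<le> cmod \<xi> * norm w + cmod \<xi> * norm b + cmod \<xi>"
      using \<xi> mult_right_mono[OF \<xi>, of "norm w"] by simp
    also have "\<dots> = (norm w + norm b + 1) * cmod \<xi>" by (simp add: algebra_simps)
    finally have "(norm (w + \<xi> *s b) + 1) ^ k \<le> ((norm w + norm b + 1) * cmod \<xi>) ^ k"
      by (rule power_mono) simp
    then have "M * (norm (w + \<xi> *s b) + 1) ^ k \<le> M * ((norm w + norm b + 1) * cmod \<xi>) ^ k"
      using M(1) by (rule mult_left_mono)
    then show "cmod (hom_part g k (w + \<xi> *s b)) \<le> (M * (norm w + norm b + 1) ^ k) * cmod \<xi> ^ k"
      using M(2)[of k "w + \<xi> *s b"] by (simp add: power_mult_distrib mult.assoc)
  qed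
qed

definition taylor_poly :: "nat \<Rightarrow> (complex ^ 'n \<Rightarrow> complex) \<Rightarrow> complex ^ 'n \<Rightarrow> complex"
  where "taylor_poly m g z = (\<Sum>k<m. hom_part g k z)"

lemma taylor_poly_lagrange_on_lines:
  assumes g: "entire g"
  shows "lagrange_on_lines (m - 1) (taylor_poly m g)"
proof (rule lagrange_on_linesI)
  fix w b
  obtain q where q: "\<And>k. degree (q k) \<le> k" "\<And>k \<xi>. hom_part g k (w + \<xi> *s b) = poly (q k) \<xi>"
    using hom_part_on_line[OF g, of _ w b] by metis
  have "degree (\<Sum>k<m. q k) \<le> m - 1"
  proof (rule degree_sum_le)
    fix k assume "k \<in> {..<m}"
    then show "degree (q k) \<le> m - 1" using q(1)[of k] by simp
  qed simp
  moreover have "taylor_poly m g (w + \<xi> *s b) = poly (\<Sum>k<m. q k) \<xi>" for \<xi>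
    by (simp add: taylor_poly_def q(2) poly_sum)
  ultimately show "\<exists>q. degree q \<le> m - 1 \<and> (\<forall>\<zeta>. taylor_poly m g (w + \<zeta> *s b) = poly q \<zeta>)" by blast
qed

lemma schwarz_bound:
  fixes g :: "complex ^ 'n \<Rightarrow> complex"
  assumes g: "entire g" and 0: "\<And>z. taylor_poly m g z = 0"
    and M: "\<And>z. z \<in> cball 0 (exp 1) \<Longrightarrow> cmod (g z) \<le> M" and z: "z \<in> cball 0 1"
  shows "cmod (g z) \<le> 2 * M / exp (real m)"
proof -
  have e2: "2 \<le> exp (1::real)" using exp_ge_add_one_self[of 1] by simp
  have "cmod (g (1 *s z) - (\<Sum>k<m. taylor_coeff (\<lambda>\<zeta>. g (\<zeta> *s z)) k * 1 ^ k)) \<le> 2 * M * (cmod 1 / exp 1) ^ m"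
  proof (rule taylor_remainder_bound[OF entire_radial[OF g]])
    fix \<zeta> :: complex assume "cmod \<zeta> \<le> exp 1"
    then have "cmod \<zeta> * norm z \<le> exp 1 * 1" using z by (intro mult_mono') auto
    then show "cmod (g (\<zeta> *s z)) \<le> M" by (intro M) (simp add: norm_vector_scalar_mult)
  qed (use e2 in auto)
  moreover have "(\<Sum>k<m. taylor_coeff (\<lambda>\<zeta>. g (\<zeta> *s z)) k * 1 ^ k) = 0"
    using 0[of z] by (simp add: taylor_poly_def hom_part_def)
  moreover have "exp (real m) = exp (1::real) ^ m" by (simp add: exp_of_nat_mult[symmetric])
  ultimately show ?thesis by (simp add: power_divide)
qed

lemma taylor_coeff_sum:
  assumes "finite U" "\<And>u. u \<in> U \<Longrightarrow> h u holomorphic_on UNIV"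
  shows "taylor_coeff (\<lambda>\<zeta>. \<Sum>u\<in>U. x u * h u \<zeta>) k = (\<Sum>u\<in>U. x u * taylor_coeff (h u) k)"
  using assms
proof (induction U)
  case empty
  have "(deriv ^^ k) (\<lambda>\<zeta>. 0 * \<zeta>) 0 = 0 * (deriv ^^ k) (\<lambda>\<zeta>. \<zeta>) (0::complex)"
    by (rule higher_deriv_cmult[of _ UNIV]) auto
  then show ?case by (simp add: taylor_coeff_def)
next
  case (insert v U)
  have 1: "(\<lambda>\<zeta>. x v * h v \<zeta>) holomorphic_on UNIV" "(\<lambda>\<zeta>. \<Sum>u\<in>U. x u * h u \<zeta>) holomorphic_on UNIV"
    using insert.prems by (auto intro!: holomorphic_intros)
  have "(deriv ^^ k) (\<lambda>\<zeta>. x v * h v \<zeta> + (\<Sum>u\<in>U. x u * h u \<zeta>)) 0 =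
      (deriv ^^ k) (\<lambda>\<zeta>. x v * h v \<zeta>) 0 + (deriv ^^ k) (\<lambda>\<zeta>. \<Sum>u\<in>U. x u * h u \<zeta>) 0"
    by (rule higher_deriv_add[OF 1]) auto
  also have "(deriv ^^ k) (\<lambda>\<zeta>. x v * h v \<zeta>) 0 = x v * (deriv ^^ k) (h v) 0"
    by (rule higher_deriv_cmult[of _ UNIV]) (use insert.prems in auto)
  finally show ?case using insert by (simp add: taylor_coeff_def add_divide_distrib)
qed

lemma taylor_poly_sum:
  assumes "finite U" "\<And>u. u \<in> U \<Longrightarrow> entire (\<phi> u)"
  shows "taylor_poly m (\<lambda>z. \<Sum>u\<in>U. x u * \<phi> u z) z = (\<Sum>u\<in>U. x u * taylor_poly m (\<phi> u) z)"
proof -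
  have "hom_part (\<lambda>z. \<Sum>u\<in>U. x u * \<phi> u z) k z = (\<Sum>u\<in>U. x u * hom_part (\<phi> u) k z)" for k
    unfolding hom_part_def by (rule taylor_coeff_sum[OF assms(1) entire_radial[OF assms(2)]])
  then show ?thesis
    unfolding taylor_poly_def sum_distrib_left by (subst sum.swap) simp
qed

section \<open>Growth of the exponent on transcendental graphs\<close>

lemma underdetermined_system:
  fixes A :: "'e \<Rightarrow> 'u \<Rightarrow> 'a::field"
  assumes "finite E" "finite U" "card E < card U"
  shows "\<exists>x. (\<exists>u\<in>U. x u \<noteq> 0) \<and> (\<forall>e\<in>E. (\<Sum>u\<in>U. x u * A e u) = 0)"
  using assms
proof (induction E arbitrary: U A)
  case empty
  then have "U \<noteq> {}" by auto
  then show ?case by (intro exI[of _ "\<lambda>_. 1"]) auto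
next
  case (insert e E)
  show ?case
  proof (cases "\<forall>u\<in>U. A e u = 0")
    case True
    obtain x where "\<exists>u\<in>U. x u \<noteq> 0" "\<forall>e\<in>E. (\<Sum>u\<in>U. x u * A e u) = 0"
      using insert.IH[of U A] insert.prems insert.hyps by auto
    then show ?thesis using True by (intro exI[of _ x]) auto
  next
    case False
    then obtain v where v: "v \<in> U" "A e v \<noteq> 0" by blast
    define V where "V = U - {v}"
    have UV: "U = insert v V" "v \<notin> V" "finite V" using v(1) insert.prems by (auto simp: V_def)
    have "card E < card V" using insert.prems insert.hyps UV by simp
    then obtain x where x: "\<exists>u\<in>V. x u \<noteq> 0"
      "\<And>e'. e' \<in> E \<Longrightarrow> (\<Sum>u\<in>V. x u * (A e' u - A e' v / A e v * A e u)) = 0"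
      using insert.IH[of V "\<lambda>e' u. A e' u - A e' v / A e v * A e u"] UV(3) by blast
    define x' where "x' = x(v := - (\<Sum>u\<in>V. x u * A e u) / A e v)"
    have sum_x': "(\<Sum>u\<in>U. x' u * A e' u) = - (\<Sum>u\<in>V. x u * A e u) / A e v * A e' v + (\<Sum>u\<in>V. x u * A e' u)" for e'
    proof -
      have "(\<Sum>u\<in>V. x' u * A e' u) = (\<Sum>u\<in>V. x u * A e' u)"
        using UV(2) by (intro sum.cong) (auto simp: x'_def)
      then show ?thesis unfolding UV(1) using UV(2,3) by (simp add: x'_def)
    qed
    have "(\<Sum>u\<in>U. x' u * A e' u) = 0" if "e' \<in> insert e E" for e'
    proof (cases "e' = e")
      case True
      then show ?thesis unfolding sum_x' using v(2) by simp
    next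
      case False
      then have "(\<Sum>u\<in>V. x u * A e' u) - (\<Sum>u\<in>V. x u * A e u) * (A e' v / A e v) = 0"
        using x(2)[of e'] that unfolding sum_distrib_right sum_subtractf[symmetric]
        by (simp add: right_diff_distrib mult_ac)
      then show ?thesis unfolding sum_x' by simp
    qed
    moreover have "\<exists>u\<in>U. x' u \<noteq> 0" using x(1) UV by (auto simp: x'_def)
    ultimately show ?thesis by blast
  qed
qed

abbreviation grid :: "nat \<Rightarrow> ('n::finite \<Rightarrow> nat) set"
  where "grid D \<equiv> {\<alpha>. \<forall>k. \<alpha> k \<le> D}"

lemma finite_grid: "finite (grid D :: ('n::finite \<Rightarrow> nat) set)"
  and card_grid: "card (grid D :: ('n::finite \<Rightarrow> nat) set) = (D + 1) ^ CARD('n)"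
proof -
  have "(grid D :: ('n \<Rightarrow> nat) set) = PiE UNIV (\<lambda>_. {..D})" by auto
  then show "finite (grid D :: ('n \<Rightarrow> nat) set)" "card (grid D :: ('n \<Rightarrow> nat) set) = (D + 1) ^ CARD('n)"
    by (simp_all add: finite_PiE card_PiE)
qed

abbreviation lagrange_prod :: "nat \<Rightarrow> ('n::finite \<Rightarrow> nat) \<Rightarrow> complex ^ 'n \<Rightarrow> complex"
  where "lagrange_prod D \<alpha> z \<equiv> (\<Prod>k\<in>UNIV. poly (lagrange_poly D (\<alpha> k)) (z $ k))"

lemma polyfun_lagrange_prod: "\<alpha> \<in> grid D \<Longrightarrow> polyfun (CARD('n) * D) (lagrange_prod D (\<alpha> :: 'n::finite \<Rightarrow> nat))"
  using polyfun_prod[of UNIV "\<lambda>_. D" "\<lambda>k z. poly (lagrange_poly D (\<alpha> k)) (z $ k)"]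
  by (simp add: polyfun_poly_coord degree_lagrange_poly)

lemma lagrange_prod_grid:
  assumes "\<alpha> \<in> grid D" "\<beta> \<in> grid D"
  shows "lagrange_prod D \<alpha> (\<chi> k. of_nat (\<beta> k)) = (if \<alpha> = \<beta> then 1 else 0)"
proof (cases "\<alpha> = \<beta>")
  case True
  then show ?thesis using assms by (simp add: poly_lagrange_poly)
next
  case False
  then obtain k where "\<alpha> k \<noteq> \<beta> k" by auto
  then have "poly (lagrange_poly D (\<alpha> k)) ((\<chi> k. of_nat (\<beta> k)) $ k) = 0"
    using assms by (simp add: poly_lagrange_poly)
  then show ?thesis using False by (simp add: prod_zero_iff) blast
qed

text \<open>Siegel's lemma for functions: there are more products \<open>\<Lambda>\<^sub>\<alpha>(z) y(z)\<^sup>l\<close> than conditions for the Taylor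
  polynomial of degree below \<open>m\<close> to vanish.\<close>

lemma auxiliary_function:
  fixes y :: "complex ^ 'n \<Rightarrow> complex"
  assumes y: "entire y" "\<And>d. \<not> polyfun d y" and m: "1 \<le> m" "m ^ CARD('n) < (K + 1) ^ (CARD('n) + 1)"
  obtains P :: "nat \<Rightarrow> complex ^ 'n \<Rightarrow> complex"
  where "\<And>l. polyfun (CARD('n) * K) (P l)" "\<exists>z. (\<Sum>l\<le>K. P l z * y z ^ l) \<noteq> 0"
    "\<And>z. taylor_poly m (\<lambda>z. \<Sum>l\<le>K. P l z * y z ^ l) z = 0"
proof -
  define U where "U = (grid K :: ('n \<Rightarrow> nat) set) \<times> {..K}"
  define E where "E = (grid (m - 1) :: ('n \<Rightarrow> nat) set)"
  define \<phi> where "\<phi> = (\<lambda>(\<alpha> :: 'n \<Rightarrow> nat, l) z. lagrange_prod K \<alpha> z * y z ^ l)"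
  have fin: "finite U" "finite E" unfolding U_def E_def using finite_grid by auto
  have "card E = m ^ CARD('n)" unfolding E_def card_grid using m(1) by simp
  moreover have "card U = (K + 1) ^ (CARD('n) + 1)"
    unfolding U_def card_cartesian_product card_grid by simp
  ultimately have "card E < card U" using m(2) by simp
  from underdetermined_system[OF fin(2,1) this, of "\<lambda>e u. taylor_poly m (\<phi> u) (\<chi> k. of_nat (e k))"]
  obtain x where x: "\<exists>u\<in>U. x u \<noteq> 0"
    "\<And>e. e \<in> E \<Longrightarrow> (\<Sum>u\<in>U. x u * taylor_poly m (\<phi> u) (\<chi> k. of_nat (e k))) = 0" by blast
  define P where "P = (\<lambda>l z. \<Sum>\<alpha>\<in>grid K. x (\<alpha>, l) * lagrange_prod K \<alpha> z)"
  have P: "polyfun (CARD('n) * K) (P l)" for l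
    unfolding P_def by (intro polyfun_sum polyfun_cmult polyfun_lagrange_prod)
  have pe: "entire (lagrange_prod K \<alpha>)" if "\<alpha> \<in> grid K" for \<alpha> :: "'n \<Rightarrow> nat"
    using entire_polyfun[OF polyfun_lagrange_prod[OF that], of "\<lambda>z. z"] entire_coord by blast
  have \<phi>e: "entire (\<phi> u)" if "u \<in> U" for u
    using that pe unfolding \<phi>_def U_def by (cases u) (auto intro!: entire_mult entire_power y(1))
  define g where "g = (\<lambda>z. \<Sum>l\<le>K. P l z * y z ^ l)"
  have g: "g = (\<lambda>z. \<Sum>u\<in>U. x u * \<phi> u z)"
  proof
    fix z
    have "(\<Sum>u\<in>U. x u * \<phi> u z) = (\<Sum>\<alpha>\<in>grid K. \<Sum>l\<le>K. x (\<alpha>, l) * (lagrange_prod K \<alpha> z * y z ^ l))"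
      unfolding U_def \<phi>_def sum.cartesian_product by (intro sum.cong) auto
    also have "\<dots> = g z"
      unfolding g_def P_def sum_distrib_right by (subst sum.swap) (simp add: mult.assoc)
    finally show "g z = (\<Sum>u\<in>U. x u * \<phi> u z)" by simp
  qed
  have ge: "entire g" unfolding g using \<phi>e by (intro entire_sum entire_mult entire_const)
  have T0: "taylor_poly m g z = 0" for z
  proof (rule zero_of_lagrange_on_lines[OF taylor_poly_lagrange_on_lines[OF ge]])
    fix \<alpha> :: "'n \<Rightarrow> nat" assume "\<And>k. \<alpha> k \<le> m - 1"
    then have "\<alpha> \<in> E" unfolding E_def by simp
    have "taylor_poly m g (\<chi> k. of_nat (\<alpha> k)) = (\<Sum>u\<in>U. x u * taylor_poly m (\<phi> u) (\<chi> k. of_nat (\<alpha> k)))"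
      unfolding g by (rule taylor_poly_sum[OF fin(1) \<phi>e])
    also have "\<dots> = 0" by (rule x(2)[OF \<open>\<alpha> \<in> E\<close>])
    finally show "taylor_poly m g (\<chi> k. of_nat (\<alpha> k)) = 0" .
  qed
  have "\<exists>z. g z \<noteq> 0"
  proof (rule ccontr)
    assume "\<not> (\<exists>z. g z \<noteq> 0)"
    then have g0: "g z = 0" for z by simp
    define Ls where "Ls = {l. l \<le> K \<and> (\<exists>\<alpha>\<in>grid K. x (\<alpha>, l) \<noteq> 0)}"
    have Ls: "finite Ls" "Ls \<noteq> {}" using x(1) unfolding Ls_def U_def by auto
    define L where "L = Max Ls"
    have "L \<in> Ls" unfolding L_def by (rule Max_in[OF Ls])
    then obtain \<alpha> where \<alpha>: "\<alpha> \<in> grid K" "x (\<alpha>, L) \<noteq> 0" and LK: "L \<le> K" unfolding Ls_def by blast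
    have P0: "P l z = 0" if "L < l" "l \<le> K" for l z
    proof -
      have "l \<notin> Ls" using that Max_ge[OF Ls(1)] unfolding L_def by (meson not_le)
      then show ?thesis unfolding P_def Ls_def using that by (intro sum.neutral) auto
    qed
    have "P L (\<chi> k. of_nat (\<alpha> k)) = (\<Sum>\<beta>\<in>grid K. if \<beta> = \<alpha> then x (\<beta>, L) else 0)"
      unfolding P_def
    proof (rule sum.cong[OF refl])
      fix \<beta> :: "'n \<Rightarrow> nat" assume \<beta>: "\<beta> \<in> grid K"
      show "x (\<beta>, L) * lagrange_prod K \<beta> (\<chi> k. of_nat (\<alpha> k)) = (if \<beta> = \<alpha> then x (\<beta>, L) else 0)"
        unfolding lagrange_prod_grid[OF \<beta> \<alpha>(1)] by simp
    qed
    also have "\<dots> = x (\<alpha>, L)" using \<alpha>(1) by (subst sum.delta[OF finite_grid]) auto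
    finally have PL: "P L (\<chi> k. of_nat (\<alpha> k)) \<noteq> 0" using \<alpha>(2) by simp
    have alg: "(\<Sum>l\<le>L. P l z * y z ^ l) = 0" for z
    proof -
      have "(\<Sum>l\<le>L. P l z * y z ^ l) = g z"
        unfolding g_def using LK P0 by (intro sum.mono_neutral_left) auto
      then show ?thesis using g0 by simp
    qed
    have "\<exists>d. polyfun d y"
      by (rule algebraic_entire_imp_polyfun[where p=P and L=L, OF y(1)]) (fact P PL alg)+
    then show False using y(2) by blast
  qed
  with P T0 show thesis unfolding g_def by (intro that)
qed

lemma exp_le_of_transcendental:
  fixes f :: "complex ^ 'n \<Rightarrow> complex ^ 'm"
  assumes f: "holomorphic_map_on f UNIV" and y: "\<And>d. \<not> polyfun d (\<lambda>z. f z $ j)"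
    and C: "\<And>d g M z. g \<in> graph_funs f d \<Longrightarrow> (\<And>z. z \<in> cball 0 1 \<Longrightarrow> cmod (g z) \<le> M) \<Longrightarrow>
       z \<in> cball 0 (exp 1) \<Longrightarrow> cmod (g z) \<le> C powr \<mu> d * M"
    and k: "(CARD('n) + 1) * K \<le> k" and m: "1 \<le> m" "m ^ CARD('n) < (K + 1) ^ (CARD('n) + 1)"
  shows "exp (real m) \<le> 2 * C powr \<mu> k"
proof -
  obtain P :: "nat \<Rightarrow> complex ^ 'n \<Rightarrow> complex" where P: "\<And>l. polyfun (CARD('n) * K) (P l)"
    and ex: "\<exists>z. (\<Sum>l\<le>K. P l z * f z $ j ^ l) \<noteq> 0"
    and T: "\<And>z. taylor_poly m (\<lambda>z. \<Sum>l\<le>K. P l z * f z $ j ^ l) z = 0"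
    using auxiliary_function[OF entire_of_holomorphic_map[OF f] y m] by blast
  define g where "g = (\<lambda>z. \<Sum>l\<le>K. P l z * f z $ j ^ l)"
  have "polyfun k (\<lambda>x :: complex ^ ('n + 'm). \<Sum>l\<le>K. P l (vec_fst x) * (x $ Inr j) ^ l)"
  proof (intro polyfun_sum)
    fix l assume "l \<in> {..K}"
    have "polyfun (CARD('n) * K) (\<lambda>x :: complex ^ ('n + 'm). P l (vec_fst x))"
      by (rule polyfun_compose[OF P]) (simp add: polyfun_coord)
    moreover have "polyfun (l * 1) (\<lambda>x :: complex ^ ('n + 'm). (x $ Inr j) ^ l)"
      by (intro polyfun_power polyfun_coord) simp
    ultimately have "polyfun (CARD('n) * K + l * 1) (\<lambda>x :: complex ^ ('n + 'm). P l (vec_fst x) * (x $ Inr j) ^ l)"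
      by (rule polyfun_mult)
    then show "polyfun k (\<lambda>x :: complex ^ ('n + 'm). P l (vec_fst x) * (x $ Inr j) ^ l)"
      by (rule polyfun_mono) (use k \<open>l \<in> {..K}\<close> in \<open>simp add: algebra_simps\<close>)
  qed
  then have g: "g \<in> graph_funs f k" by (rule graph_funsI) (simp add: g_def)
  have ge: "entire g" by (rule graph_funs_entire[OF f g])
  have "cball (0 :: complex ^ 'n) 1 \<noteq> {}" by simp
  then obtain z0 where z0: "z0 \<in> cball 0 1" "\<And>x. x \<in> cball 0 1 \<Longrightarrow> cmod (g x) \<le> cmod (g z0)"
    using compact_attains_max_entire[OF ge compact_cball] by blast
  have "g z0 \<noteq> 0"
  proof
    assume "g z0 = 0"
    then have "g z = 0" if "z \<in> ball 0 1" for z using z0(2)[of z] that by simp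
    then have "g z = 0" for z using entire_zero_on_ball[OF ge, of 1 0] by simp
    then show False using ex unfolding g_def by blast
  qed
  have "cmod (g z0) \<le> 2 * (C powr \<mu> k * cmod (g z0)) / exp (real m)"
    by (rule schwarz_bound[OF ge _ C[OF g z0(2)] z0(1)]) (use T in \<open>auto simp: g_def\<close>)
  then have "exp (real m) * cmod (g z0) \<le> (2 * C powr \<mu> k) * cmod (g z0)"
    by (simp add: field_simps)
  then show ?thesis by (rule mult_right_le_imp_le) (use \<open>g z0 \<noteq> 0\<close> in simp)
qed

lemma transcendental_exponent_lower_bound:
  fixes f :: "complex ^ 'n \<Rightarrow> complex ^ 'm"
  assumes f: "holomorphic_map_on f UNIV" and \<mu>: "\<And>k. 0 \<le> \<mu> k" and b: "admits_bernstein f \<mu>"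
    and y: "\<And>d. \<not> polyfun d (\<lambda>z. f z $ j)"
  shows "\<exists>c>0. \<forall>\<^sub>F k in sequentially. c \<le> \<mu> k / real k powr (1 + 1 / real CARD('n))"
proof -
  let ?n = "CARD('n)"
  define p where "p = 1 + 1 / real ?n"
  have n: "0 < real ?n" by simp
  have p1: "1 \<le> p" by (simp add: p_def)
  have pn: "p * real ?n = real (?n + 1)" unfolding p_def using n by (simp add: field_simps)
  obtain C where C: "1 \<le> C"
    "\<And>d g M z. g \<in> graph_funs f d \<Longrightarrow> (\<And>z. z \<in> cball 0 1 \<Longrightarrow> cmod (g z) \<le> M) \<Longrightarrow>
       z \<in> cball 0 (exp 1) \<Longrightarrow> cmod (g z) \<le> C powr \<mu> d * M"
    using controlsE[OF admits_bernstein_imp_controls[OF f \<mu> b zero_less_one]] by blast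
  define A where "A = ln C + 1"
  have A: "0 < A" "ln C \<le> A" using C(1) by (auto simp: A_def add_nonneg_pos)
  define c1 where "c1 = (1 / real (?n + 1)) powr p"
  have c1: "0 < c1" unfolding c1_def by simp
  have main: "c1 / (2 * A) \<le> \<mu> k / real k powr p" if k: "?n + 1 \<le> k" "4 / c1 \<le> real k" for k
  proof -
    define K where "K = k div (?n + 1)"
    have K1: "1 \<le> K" unfolding K_def using k(1) by (simp add: Suc_le_eq div_greater_zero_iff)
    have kK: "(?n + 1) * K \<le> k" unfolding K_def by (rule times_div_less_eq_dividend)
    have "k < (K + 1) * (?n + 1)" using dividend_less_div_times[of "?n + 1" k] by (simp add: K_def algebra_simps)
    then have "real k \<le> real (K + 1) * real (?n + 1)"
      by (metis less_imp_le of_nat_le_iff of_nat_mult)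
    then have Kk: "1 / real (?n + 1) * real k \<le> real (K + 1)" by (simp add: field_simps)
    define X where "X = real (K + 1) powr p"
    have X2: "2 \<le> X"
    proof -
      have "2 \<le> real (K + 1) powr 1" using K1 by simp
      also have "\<dots> \<le> X" unfolding X_def using p1 by (intro powr_mono) auto
      finally show ?thesis .
    qed
    define m where "m = nat \<lceil>X\<rceil> - 1"
    have m: "1 \<le> m" "real m < X" "X - 1 \<le> real m"
      using X2 unfolding m_def by linarith+
    have "real (m ^ ?n) < X ^ ?n" using m(2) by (simp add: power_strict_mono)
    also have "X ^ ?n = X powr real ?n" using X2 by (simp add: powr_realpow)
    also have "\<dots> = real (K + 1) powr real (?n + 1)" unfolding X_def powr_powr pn ..
    also have "\<dots> = real (K + 1) ^ (?n + 1)" by (rule powr_realpow) simp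
    also have "\<dots> = real ((K + 1) ^ (?n + 1))" by (simp only: of_nat_power)
    finally have mK: "m ^ ?n < (K + 1) ^ (?n + 1)" by (simp only: of_nat_less_iff)
    have "exp (real m) \<le> 2 * C powr \<mu> k"
    proof (rule exp_le_of_transcendental[where f=f and j=j and C=C and K=K])
      show "cmod (g z) \<le> C powr \<mu> d * M" if "g \<in> graph_funs f d"
        "\<And>z. z \<in> cball 0 1 \<Longrightarrow> cmod (g z) \<le> M" "z \<in> cball 0 (exp 1)" for d g M z
        by (rule C(2)[OF that])
    qed (fact f y kK m(1) mK)+
    then have "ln (exp (real m)) \<le> ln (2 * C powr \<mu> k)"
      using C(1) by (subst ln_le_cancel_iff) auto
    also have "\<dots> = ln 2 + \<mu> k * ln C" using C(1) by (simp add: ln_mult ln_powr)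
    also have "\<dots> \<le> 1 + \<mu> k * A"
      using A(2) \<mu>[of k] ln_2_less_1 by (intro add_mono mult_left_mono) auto
    finally have "X - 2 \<le> \<mu> k * A" using m(3) by simp
    moreover have "c1 * real k powr p \<le> X"
    proof -
      have "c1 * real k powr p = (1 / real (?n + 1) * real k) powr p"
        unfolding c1_def by (subst powr_mult) auto
      also have "\<dots> \<le> X" unfolding X_def using Kk p1 by (intro powr_mono2) auto
      finally show ?thesis .
    qed
    moreover have "4 \<le> c1 * real k powr p"
    proof -
      have "4 \<le> c1 * real k" using k(2) c1 by (simp add: field_simps)
      also have "real k powr 1 \<le> real k powr p" using k(1) p1 by (intro powr_mono) auto
      then have "c1 * real k \<le> c1 * real k powr p" using c1 k(1) by (intro mult_left_mono) auto
      finally show ?thesis .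
    qed
    ultimately have "c1 * real k powr p \<le> 2 * (\<mu> k * A)" by linarith
    moreover have "0 < real k powr p" using k(1) by simp
    ultimately show ?thesis using A(1) by (simp add: field_simps)
  qed
  have "\<forall>\<^sub>F k in sequentially. c1 / (2 * A) \<le> \<mu> k / real k powr p"
  proof -
    obtain k0 where k0: "4 / c1 < real k0" using reals_Archimedean2 by blast
    show ?thesis unfolding eventually_sequentially
      by (intro exI[of _ "max (?n + 1) k0"] allI impI main) (use k0 in auto)
  qed
  then show ?thesis using c1 A(1) unfolding p_def by (intro exI[of _ "c1 / (2 * A)"]) auto
qed

section \<open>Graphs of polynomial maps\<close>

definition shear :: "(complex ^ 'n \<Rightarrow> complex ^ 'm) \<Rightarrow> complex ^ ('n + 'm) \<Rightarrow> complex ^ ('n + 'm)"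
  where "shear h x = vec_pair (vec_fst x) (vec_snd x + h (vec_fst x))"

lemma shear_inverse: "shear (\<lambda>z. - h z) (shear h x) = x" "shear h (shear (\<lambda>z. - h z) x) = x"
  by (simp_all add: shear_def)

lemma holomorphic_map_on_shear:
  fixes h :: "complex ^ 'n \<Rightarrow> complex ^ 'm"
  assumes h: "holomorphic_map_on h UNIV" shows "holomorphic_map_on (shear h) UNIV"
  unfolding holomorphic_map_on_def
proof
  fix z :: "complex ^ ('n + 'm)"
  obtain D where D: "(h has_derivative D) (at (vec_fst z))" "\<And>c v. D (c *s v) = c *s D v"
    using h unfolding holomorphic_map_on_def by blast
  have eq: "shear F = (\<lambda>z. vec_pair (vec_fst z) 0 + vec_pair 0 (vec_snd z + F (vec_fst z)))"
    for F :: "complex ^ 'n \<Rightarrow> complex ^ 'm"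
    by (auto simp: fun_eq_iff shear_def vec_eq_iff vec_pair_def split: sum.split)
  note bl = bounded_linear_imp_has_derivative[OF bounded_linear_vec_pair_maps(3)]
    bounded_linear_imp_has_derivative[OF bounded_linear_vec_pair_maps(4)]
  have "(shear h has_derivative shear D) (at z)"
    unfolding eq
    by (intro has_derivative_add bounded_linear.has_derivative[OF bounded_linear_vec_pair_maps(1)]
        bounded_linear.has_derivative[OF bounded_linear_vec_pair_maps(2)]
        has_derivative_compose[OF bl(1) D(1)] bl)
  moreover have "shear D (c *s v) = c *s shear D v" for c and v :: "complex ^ ('n + 'm)"
  proof -
    have "vec_fst (c *s v) = c *s vec_fst v" "vec_snd (c *s v) = c *s vec_snd v"
      by (simp_all add: vec_eq_iff)
    then show ?thesis
      by (simp add: shear_def D(2)) (auto simp: vec_eq_iff vec_pair_def algebra_simps split: sum.split)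
  qed
  ultimately show "\<exists>D. (shear h has_derivative D) (at z) \<and> (\<forall>c v. D (c *s v) = c *s D v)"
    by blast
qed

lemma holomorphic_map_on_uminus:
  assumes "holomorphic_map_on f UNIV" shows "holomorphic_map_on (\<lambda>z. - f z) UNIV"
  unfolding holomorphic_map_on_def
proof
  fix z
  obtain D where D: "(f has_derivative D) (at z)" "\<And>c v. D (c *s v) = c *s D v"
    using assms unfolding holomorphic_map_on_def by blast
  have "((\<lambda>z. - f z) has_derivative (\<lambda>v. - D v)) (at z)"
    by (rule has_derivative_minus[OF D(1)])
  moreover have "- D (c *s v) = c *s (- D v)" for c v by (simp add: D(2) vec_eq_iff)
  ultimately show "\<exists>D. ((\<lambda>z. - f z) has_derivative D) (at z) \<and> (\<forall>c v. D (c *s v) = c *s D v)"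
    by (intro exI[of _ "\<lambda>v. - D v"]) auto
qed

lemma holomorphic_map_on_imp_continuous_on:
  "holomorphic_map_on f UNIV \<Longrightarrow> continuous_on UNIV f"
  unfolding holomorphic_map_on_def
  by (meson UNIV_I continuous_at_imp_continuous_on has_derivative_continuous)

lemma graph_complex_submanifold:
  fixes f :: "complex ^ 'n \<Rightarrow> complex ^ 'm"
  assumes f: "holomorphic_map_on f UNIV"
  shows "complex_submanifold CARD('n) (graph_of f)"
proof -
  define \<psi> where "\<psi> = shear f"
  define \<phi> where "\<phi> = shear (\<lambda>z. - f z)"
  have hol: "holomorphic_map_on \<phi> UNIV" "holomorphic_map_on \<psi> UNIV"
    unfolding \<phi>_def \<psi>_def by (intro holomorphic_map_on_shear holomorphic_map_on_uminus f)+
  have inv: "\<phi> (\<psi> x) = x" "\<psi> (\<phi> x) = x" for x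
    unfolding \<phi>_def \<psi>_def by (simp_all add: shear_inverse)
  have hom: "homeomorphism UNIV UNIV \<phi> \<psi>"
    by (rule homeomorphismI) (use hol inv in \<open>auto intro: holomorphic_map_on_imp_continuous_on\<close>)
  have card: "card (range (Inl :: 'n \<Rightarrow> 'n + 'm)) = CARD('n)"
    by (rule card_image) (simp add: inj_on_def)
  have "\<phi> ` graph_of f = {y. \<forall>i. i \<notin> range Inl \<longrightarrow> y $ i = 0}"
  proof (intro equalityI subsetI)
    fix y assume "y \<in> \<phi> ` graph_of f"
    then obtain z where "y = \<phi> (vec_pair z (f z))" by (auto simp: graph_of_def)
    then have "y = vec_pair z 0" by (simp add: \<phi>_def shear_def)
    then show "y \<in> {y. \<forall>i. i \<notin> range Inl \<longrightarrow> y $ i = 0}"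
      by (auto simp: vec_pair_def split: sum.split)
  next
    fix y :: "complex ^ ('n + 'm)" assume y: "y \<in> {y. \<forall>i. i \<notin> range Inl \<longrightarrow> y $ i = 0}"
    have "y $ Inr j = 0" for j using y by auto
    then have "vec_snd y = 0" by (simp add: vec_eq_iff)
    then have "\<psi> y \<in> graph_of f" by (simp add: \<psi>_def shear_def graph_of_def)
    then show "y \<in> \<phi> ` graph_of f" using inv(1)[of y] by (metis imageI)
  qed
  then show ?thesis
    unfolding complex_submanifold_def
    by (intro ballI exI[of _ UNIV] exI[of _ \<phi>] exI[of _ \<psi>] exI[of _ "range Inl"])
      (use hom hol card in auto)
qed

lemma graph_algebraic_set:
  fixes f :: "complex ^ 'n \<Rightarrow> complex ^ 'm"
  assumes f: "\<And>j. \<exists>d. polyfun d (\<lambda>z. f z $ j)"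
  shows "algebraic_set (graph_of f)"
proof -
  have "\<exists>p. poly_eval p = (\<lambda>x :: complex ^ ('n + 'm). x $ Inr j - f (vec_fst x) $ j)" for j
  proof -
    obtain d where d: "polyfun d (\<lambda>z. f z $ j)" using f by blast
    have "polyfun d (\<lambda>x :: complex ^ ('n + 'm). f (vec_fst x) $ j)"
      by (rule polyfun_compose[OF d]) (simp add: polyfun_coord)
    then have "polyfun (max d 1) (\<lambda>x :: complex ^ ('n + 'm). x $ Inr j - f (vec_fst x) $ j)"
      by (intro polyfun_diff polyfun_coord) (auto intro: polyfun_mono)
    then show ?thesis unfolding polyfun_def by blast
  qed
  then obtain P where P: "\<And>j. poly_eval (P j) = (\<lambda>x :: complex ^ ('n + 'm). x $ Inr j - f (vec_fst x) $ j)"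
    by metis
  have "graph_of f = {x. \<forall>p\<in>range P. poly_eval p x = 0}"
  proof (intro equalityI subsetI)
    fix x assume "x \<in> graph_of f"
    then show "x \<in> {x. \<forall>p\<in>range P. poly_eval p x = 0}" by (auto simp: graph_of_def P)
  next
    fix x assume "x \<in> {x. \<forall>p\<in>range P. poly_eval p x = 0}"
    then have "vec_snd x = f (vec_fst x)" by (simp add: P vec_eq_iff)
    then have "x = vec_pair (vec_fst x) (f (vec_fst x))" using vec_pair_fst_snd[of x] by simp
    then show "x \<in> graph_of f" unfolding graph_of_def by blast
  qed
  then show ?thesis unfolding algebraic_set_def by blast
qed

lemma transcendental_component:
  fixes f :: "complex ^ 'n \<Rightarrow> complex ^ 'm"
  assumes "holomorphic_map_on f UNIV" "\<not> algebraic_submanifold (graph_of f)"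
  obtains j where "\<And>d. \<not> polyfun d (\<lambda>z. f z $ j)"
  using assms graph_algebraic_set[of f] graph_complex_submanifold[of f]
  unfolding algebraic_submanifold_def by blast

lemma liminf_exponent_nonzero:
  fixes f :: "complex ^ 'n \<Rightarrow> complex ^ 'm"
  assumes f: "holomorphic_map_on f UNIV" "\<And>k. 0 \<le> \<mu> k" "admits_bernstein f \<mu>"
    and alg: "\<not> algebraic_submanifold (graph_of f)"
  shows "liminf (\<lambda>k. ereal (\<mu> k / real k powr (1 + 1 / real CARD('n)))) \<noteq> 0"
proof -
  obtain j where j: "\<And>d. \<not> polyfun d (\<lambda>z. f z $ j)"
    using transcendental_component[OF f(1) alg] by blast
  obtain c where c: "0 < c" "\<forall>\<^sub>F k in sequentially. c \<le> \<mu> k / real k powr (1 + 1 / real CARD('n))"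
    using transcendental_exponent_lower_bound[OF f j] by blast
  have "ereal c \<le> liminf (\<lambda>k. ereal (\<mu> k / real k powr (1 + 1 / real CARD('n))))"
  proof (rule Liminf_bounded)
    show "\<forall>\<^sub>F k in sequentially. ereal c \<le> ereal (\<mu> k / real k powr (1 + 1 / real CARD('n)))"
      using c(2) by (rule eventually_mono) (simp only: ereal_less_eq)
  qed
  moreover have "0 < ereal c" using c(1) by simp
  ultimately show ?thesis by (metis not_le)
qed

lemma admits_bernstein_min:
  fixes f :: "complex ^ 'n \<Rightarrow> complex ^ 'm"
  assumes f: "holomorphic_map_on f UNIV"
    and \<mu>: "\<And>k. 0 \<le> \<mu>1 k" "\<And>k. 0 \<le> \<mu>2 k" "\<And>k. 0 \<le> \<mu> k" "\<And>k. min (\<mu>1 k) (\<mu>2 k) \<le> \<mu> k"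
    and b: "admits_bernstein f \<mu>1" "admits_bernstein f \<mu>2"
  shows "admits_bernstein f \<mu>"
  unfolding admits_bernstein_iff_controls[OF f \<mu>(3)]
proof (intro allI impI)
  fix r :: real assume r: "0 < r"
  show "controls f \<mu> (cball 0 r) (cball 0 (exp 1 * r))"
    by (rule controls_min[OF _ _ _ \<mu>(1,2,4)])
      (use r b admits_bernstein_iff_controls[OF f \<mu>(1)] admits_bernstein_iff_controls[OF f \<mu>(2)] in auto)
qed

theorem theorem1p1:
  shows
    "(\<forall>f :: complex ^ 'n \<Rightarrow> complex ^ 'm. holomorphic_map_on f UNIV \<longrightarrow>
        (\<exists>\<mu>. (\<forall>k. 0 \<le> \<mu> k) \<and> admits_bernstein f \<mu>))
   \<and>
     (\<forall>(f :: complex ^ 'n \<Rightarrow> complex ^ 'm) \<mu>.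
        holomorphic_map_on f UNIV \<longrightarrow> (\<forall>k. 0 \<le> \<mu> k) \<longrightarrow>
        (admits_bernstein f \<mu> \<longleftrightarrow>
          (\<forall>K. compact K \<longrightarrow> \<not> pluripolar K \<longrightarrow>
            (\<exists>C :: real \<Rightarrow> real. (\<forall>r>0. 0 \<le> C r) \<and>
              (\<forall>r>0. \<forall>p. max_on_graph f p (cball 0 r)
                \<le> rpow (C r) (\<mu> (total_degree p)) * max_on_graph f p K)))))
   \<and>
     (\<forall>(f :: complex ^ 'n \<Rightarrow> complex ^ 'm) \<mu>.
        holomorphic_map_on f UNIV \<longrightarrow> (\<forall>k. 0 \<le> \<mu> k) \<longrightarrow>
        \<not> algebraic_submanifold (graph_of f) \<longrightarrow> admits_bernstein f \<mu> \<longrightarrow>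
        liminf (\<lambda>k. ereal (\<mu> k / real k powr (1 + 1 / real CARD('n)))) \<noteq> 0)
   \<and>
     (\<forall>(f :: complex ^ 'n \<Rightarrow> complex ^ 'm) \<mu>1 \<mu>2 \<mu>.
        holomorphic_map_on f UNIV \<longrightarrow>
        (\<forall>k. 0 \<le> \<mu>1 k) \<longrightarrow> (\<forall>k. 0 \<le> \<mu>2 k) \<longrightarrow> (\<forall>k. 0 \<le> \<mu> k) \<longrightarrow>
        admits_bernstein f \<mu>1 \<longrightarrow> admits_bernstein f \<mu>2 \<longrightarrow>
        (\<forall>k. min (\<mu>1 k) (\<mu>2 k) \<le> \<mu> k) \<longrightarrow>
        admits_bernstein f \<mu>)
   \<and>
     (\<forall>(f :: complex ^ 'n \<Rightarrow> complex ^ 'm) \<mu> w.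
        holomorphic_map_on f UNIV \<longrightarrow> (\<forall>k. 0 \<le> \<mu> k) \<longrightarrow>
        admits_bernstein f \<mu> \<longrightarrow> admits_bernstein (\<lambda>z. f (z + w)) \<mu>)
   \<and>
     (\<forall>(f1 :: complex ^ 'n1 \<Rightarrow> complex ^ 'm1) (f2 :: complex ^ 'n2 \<Rightarrow> complex ^ 'm2).
        holomorphic_map_on f1 UNIV \<longrightarrow> holomorphic_map_on f2 UNIV \<longrightarrow>
        (\<forall>\<mu>1 \<mu>2. (\<forall>k. 0 \<le> \<mu>1 k) \<longrightarrow> (\<forall>k. 0 \<le> \<mu>2 k) \<longrightarrow>
           admits_bernstein f1 \<mu>1 \<longrightarrow> admits_bernstein f2 \<mu>2 \<longrightarrow>
           admits_bernstein (prod_map f1 f2) (\<lambda>k. max (\<mu>1 k) (\<mu>2 k))) \<and>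
        (\<forall>\<mu>. (\<forall>k. 0 \<le> \<mu> k) \<longrightarrow> admits_bernstein (prod_map f1 f2) \<mu> \<longrightarrow>
           admits_bernstein f1 \<mu> \<and> admits_bernstein f2 \<mu>))"
proof (intro conjI allI impI)
  fix f :: "complex ^ 'n \<Rightarrow> complex ^ 'm" and \<mu> \<mu>1 \<mu>2 :: "nat \<Rightarrow> real"
  assume f: "holomorphic_map_on f UNIV"
  show "\<exists>\<mu>. (\<forall>k. 0 \<le> \<mu> k) \<and> admits_bernstein f \<mu>"
    by (rule exists_admissible_exponent[OF f])
  assume \<mu>: "\<forall>k. 0 \<le> \<mu> k"
  show "admits_bernstein f \<mu> \<longleftrightarrow>
      (\<forall>K. compact K \<longrightarrow> \<not> pluripolar K \<longrightarrow>
        (\<exists>C :: real \<Rightarrow> real. (\<forall>r>0. 0 \<le> C r) \<and>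
          (\<forall>r>0. \<forall>p. max_on_graph f p (cball 0 r)
            \<le> rpow (C r) (\<mu> (total_degree p)) * max_on_graph f p K)))"
    by (rule admits_bernstein_iff_nonpluripolar[OF f]) (use \<mu> in blast)
next
  fix f :: "complex ^ 'n \<Rightarrow> complex ^ 'm" and \<mu>
  assume "holomorphic_map_on f UNIV" "\<forall>k. 0 \<le> \<mu> k"
    "\<not> algebraic_submanifold (graph_of f)" "admits_bernstein f \<mu>"
  then show "liminf (\<lambda>k. ereal (\<mu> k / real k powr (1 + 1 / real CARD('n)))) \<noteq> 0"
    using liminf_exponent_nonzero[of f \<mu>] by blast
next
  fix f :: "complex ^ 'n \<Rightarrow> complex ^ 'm" and \<mu>1 \<mu>2 \<mu>
  assume "holomorphic_map_on f UNIV" "\<forall>k. 0 \<le> \<mu>1 k" "\<forall>k. 0 \<le> \<mu>2 k" "\<forall>k. 0 \<le> \<mu> k"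
    "admits_bernstein f \<mu>1" "admits_bernstein f \<mu>2" "\<forall>k. min (\<mu>1 k) (\<mu>2 k) \<le> \<mu> k"
  then show "admits_bernstein f \<mu>"
    using admits_bernstein_min[of f \<mu>1 \<mu>2 \<mu>] by blast
next
  fix f :: "complex ^ 'n \<Rightarrow> complex ^ 'm" and \<mu> w
  assume "holomorphic_map_on f UNIV" "\<forall>k. 0 \<le> \<mu> k" "admits_bernstein f \<mu>"
  then show "admits_bernstein (\<lambda>z. f (z + w)) \<mu>"
    using admits_bernstein_translate[of f \<mu> w] by blast
next
  fix f1 :: "complex ^ 'n1 \<Rightarrow> complex ^ 'm1" and f2 :: "complex ^ 'n2 \<Rightarrow> complex ^ 'm2" and \<mu>1 \<mu>2
  assume "holomorphic_map_on f1 UNIV" "holomorphic_map_on f2 UNIV" "\<forall>k. 0 \<le> \<mu>1 k" "\<forall>k. 0 \<le> \<mu>2 k"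
    "admits_bernstein f1 \<mu>1" "admits_bernstein f2 \<mu>2"
  then show "admits_bernstein (prod_map f1 f2) (\<lambda>k. max (\<mu>1 k) (\<mu>2 k))"
    using admits_bernstein_prod_map[of f1 f2 \<mu>1 \<mu>2] by blast
next
  fix f1 :: "complex ^ 'n1 \<Rightarrow> complex ^ 'm1" and f2 :: "complex ^ 'n2 \<Rightarrow> complex ^ 'm2" and \<mu>
  assume a: "holomorphic_map_on f1 UNIV" "holomorphic_map_on f2 UNIV" "\<forall>k. 0 \<le> \<mu> k"
    "admits_bernstein (prod_map f1 f2) \<mu>"
  show "admits_bernstein f1 \<mu>" "admits_bernstein f2 \<mu>"
    using admits_bernstein_prod_map_factors[OF a(1,2) _ a(4)] a(3) by blast+
qed

end
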